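(* Let $f:\mathbb{R}^d\to\mathbb{R}$ be $d$-times continuously differentiable and assume: (i) there are constants $G,L\ge 0$ with $\|\nabla f(x)\|\le G$ and $\|\nabla f(x')-\nabla f(x)\|\le L\|x'-x\|$ for all $x,x'\in\mathbb{R}^d$; (ii) the sublevel set $\{x: f(x)\le c\}$ is bounded for every $c<\sup f$; (iii) the set $\{x:\|\nabla f(x)\|\le\varepsilon_0\}$ is bounded for some $\varepsilon_0>0$; (iv) for some $q\in[2,\infty]$ and $\sigma\ge 0$, the oracle error satisfies $\mathbb{E}[Z(x;\omega)]=0$ and $\mathbb{E}[\|Z(x;\omega)\|^q]\le\sigma^q$ for all $x\in\mathbb{R}^d$ (for $q=\infty$, the latter means $\|Z(x;\omega)\|\le\sigma$ almost surely). Suppose stochastic gradient descent $X_{n+1}=X_n-\gamma_n V_n$ is run with a step-size sequence of the form $\gamma_n=\Theta(1/n^p)$ for some $p\in(2/(q+2),1]$ (where $2/(q+2)=0$ if $q=\infty$). Then, with probability $1$, $X_n$ converges to a (possibly random) connected component $\mathcal X^*_\infty$ of the critical set $\mathcal X^*=\{x\in\mathbb{R}^d:\nabla f(x)=0\}$ over which $f$ is constant.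
   Context: $\|\cdot\|$ is the Euclidean norm on $\mathbb{R}^d$. Convergence of $X_n$ to a set $S$ means $\operatorname{dist}(X_n,S)\to 0$. $\gamma_n=\Theta(1/n^p)$ means $c_1/n^p\le\gamma_n\le c_2/n^p$ for some constants $c_1,c_2>0$. Oracle and algorithm. A stochastic first-order oracle returns, at input $x\in\mathbb{R}^d$, the random vector $\mathsf V(x;\omega)=\nabla f(x)+Z(x;\omega)$, with $\omega$ drawn from a complete probability space. Stochastic gradient descent is $X_{n+1}=X_n-\gamma_n V_n$, $n=1,2,\dots$, with step-sizes $\gamma_n>0$ and $V_n=\mathsf V(X_n;\omega_n)=\nabla f(X_n)+Z_n$, $Z_n=Z(X_n;\omega_n)$, where $\omega_n$ is a fresh draw of the random seed, independent of $\mathcal F_n=\sigma(X_1,\dots,X_n)$; thus $\mathbb{E}[Z_n\mid\mathcal F_n]=0$ and $\mathbb{E}[\|Z_n\|^q\mid\mathcal F_n]\le\sigma^q$. *)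

theory Defs
  imports "HOL-Probability.Probability"
begin

text \<open>
  \<open>C_times k f\<close>: \<open>f\<close> is \<open>k\<close>-times continuously differentiable on the whole space, i.e. all
  iterated directional derivatives of order at most \<open>k\<close> exist and are continuous.  At each step
  total differentiability is required; for continuous partial derivatives this is automatic.
\<close>

primrec C_times :: "nat \<Rightarrow> ('a::euclidean_space \<Rightarrow> real) \<Rightarrow> bool" where
  "C_times 0 f \<longleftrightarrow> continuous_on UNIV f"
| "C_times (Suc k) f \<longleftrightarrow>
     (\<forall>x. f differentiable (at x)) \<and> (\<forall>v. C_times k (\<lambda>x. frechet_derivative f (at x) v))"

definition grad :: "('a::euclidean_space \<Rightarrow> real) \<Rightarrow> 'a \<Rightarrow> 'a" where
  "grad f x = (THE D. GDERIV f x :> D)"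

lemma grad_eqI: "grad f x = D" if "GDERIV f x :> D"
  unfolding grad_def
proof (rule the_equality)
  fix D' assume "GDERIV f x :> D'"
  with that have "(\<lambda>h. h \<bullet> D') = (\<lambda>h. h \<bullet> D)"
    unfolding gderiv_def by (auto intro: has_derivative_unique)
  then show "D' = D"
    by (metis vector_eq_ldot)
qed (rule that)

definition crit_set :: "('a::euclidean_space \<Rightarrow> real) \<Rightarrow> 'a set" where
  "crit_set f = {x. grad f x = 0}"

text \<open>
  The bound \<open>E[\<parallel>Y\<parallel>\<^sup>q] \<le> \<sigma>\<^sup>q\<close>, read as \<open>\<parallel>Y\<parallel> \<le> \<sigma>\<close> almost surely if \<open>q = \<infinity>\<close>.  The
  nonnegative integral is used so that the bound includes finiteness of the moment.
\<close>

definition moment_le :: "'s measure \<Rightarrow> ereal \<Rightarrow> real \<Rightarrow> ('s \<Rightarrow> 'a::real_normed_vector) \<Rightarrow> bool" where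
  "moment_le M q \<sigma> Y \<longleftrightarrow>
     (if q = \<infinity> then AE s in M. norm (Y s) \<le> \<sigma>
      else (\<integral>\<^sup>+ s. ennreal (norm (Y s) powr real_of_ereal q) \<partial>M)
             \<le> ennreal (\<sigma> powr real_of_ereal q))"

text \<open>The \<open>\<sigma>\<close>-algebra generated by \<open>X 1, \<dots>, X n\<close>.\<close>

definition history :: "'w measure \<Rightarrow> (nat \<Rightarrow> 'w \<Rightarrow> 'a::topological_space) \<Rightarrow> nat \<Rightarrow> 'w set set" where
  "history P X n =
     sigma_sets (space P) (\<Union>i\<in>{1..n}. {X i -` B \<inter> space P | B. B \<in> sets borel})"

end

theory Submission
  imports Defs
begin

text \<open>
  The critical values of \<open>f\<close> form a null set (Morse--Sard), so \<open>f\<close> is constant on connected sets of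
  critical points and every interval of values contains a slab free of critical points.  Truncation
  and exponential moments show that, almost surely, the noise accumulated over windows of fixed
  length in the time scale \<open>\<Sum>\<gamma>\<close> tends to \<open>0\<close>.  The rest is pathwise: over a window, \<open>f\<close> decreases by
  \<open>\<Sum>\<gamma> \<parallel>\<nabla>f\<parallel>\<^sup>2\<close> up to a vanishing error, uniformly in the starting point.  Hence the path cannot cross
  a noncritical slab upwards infinitely often, so \<open>f\<close> converges along it, the gradients tend to \<open>0\<close>,
  and the limit set is a connected set of critical points.
\<close>

section \<open>Functions of class \<open>C\<^sup>k\<close> on open sets\<close>

text \<open>The iterates are not assumed to be bounded. Two facts make up for this: gradients are
  bounded and Lipschitz on the whole space, so errors over a window do not depend on where it
  starts; and gradients are bounded away from 0 outside a bounded set, so the path keeps returning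
  to that set and cannot climb far above it. For small \<open>p\<close> the full noise series need
  not converge, hence the windows. Their length \<open>c\<^sub>1 / 4\<close> makes a window that
  starts at step \<open>n\<close> end before step \<open>2 * n\<close>, even for
  \<open>p = 1\<close>, so a union bound over its end points costs a factor \<open>n\<close>. The
  stretched exponential tails that pay for this factor come from truncation, as only
  \<open>q\<close> moments are given. Truncation levels exist as soon as \<open>p * q > 1\<close>,
  and this follows from \<open>p > 2 / (q + 2)\<close> because \<open>q\<close> is at least 2. In
  the Morse--Sard part the obstacle is that \<open>f\<close> has exactly as many derivatives as the
  dimension: coordinates built from derivatives of \<open>f\<close> are less smooth than
  \<open>f\<close>, so regularity has to be tracked without differentiating \<open>f\<close> again
  in the new coordinates.\<close>

primrec Ck :: "nat \<Rightarrow> 'a::euclidean_space set \<Rightarrow> ('a \<Rightarrow> real) \<Rightarrow> bool" where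
  "Ck 0 U g \<longleftrightarrow> continuous_on U g"
| "Ck (Suc k) U g \<longleftrightarrow>
     (\<exists>g'. (\<forall>x\<in>U. GDERIV g x :> g' x) \<and> (\<forall>b\<in>Basis. Ck k U (\<lambda>x. g' x \<bullet> b)))"

lemma Ck_subset: "Ck k U g \<Longrightarrow> V \<subseteq> U \<Longrightarrow> Ck k V g"
proof (induction k arbitrary: g)
  case 0
  then show ?case by (auto intro: continuous_on_subset)
next
  case (Suc k)
  then obtain g' where "\<forall>x\<in>U. GDERIV g x :> g' x" "\<forall>b\<in>Basis. Ck k U (\<lambda>x. g' x \<bullet> b)"
    by auto
  with Suc show ?case by (auto intro!: exI[of _ g'])
qed

lemma GDERIV_continuous_on:
  assumes "\<And>x. x \<in> U \<Longrightarrow> GDERIV g x :> g' x"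
  shows "continuous_on U g"
  using assms unfolding gderiv_def
  by (meson continuous_at_imp_continuous_on has_derivative_continuous)

lemma Ck_Suc_imp: "Ck (Suc k) U g \<Longrightarrow> Ck k U g"
proof (induction k arbitrary: g)
  case 0
  then show ?case by (auto intro: GDERIV_continuous_on)
next
  case (Suc k)
  from Suc.prems obtain g' where "\<forall>x\<in>U. GDERIV g x :> g' x"
      "\<forall>b\<in>Basis. Ck (Suc k) U (\<lambda>x. g' x \<bullet> b)"
    unfolding Ck.simps(2)[of "Suc k"] by blast
  with Suc.IH show ?case unfolding Ck.simps(2)[of k U g] by blast
qed

lemma Ck_imp_continuous_on: "Ck k U g \<Longrightarrow> continuous_on U g"
proof (induction k)
  case (Suc k)
  then show ?case using Ck_Suc_imp by blast
qed simp

lemma Ck_const: "Ck k U (\<lambda>x. c)"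
proof (induction k arbitrary: c)
  case (Suc k)
  then show ?case by (auto intro!: exI[of _ "\<lambda>x. 0"] GDERIV_const)
qed auto

lemma Ck_add: "Ck k U g \<Longrightarrow> Ck k U h \<Longrightarrow> Ck k U (\<lambda>x. g x + h x)"
proof (induction k arbitrary: g h)
  case (Suc k)
  then obtain g' h' where "\<forall>x\<in>U. GDERIV g x :> g' x" "\<forall>b\<in>Basis. Ck k U (\<lambda>x. g' x \<bullet> b)"
      "\<forall>x\<in>U. GDERIV h x :> h' x" "\<forall>b\<in>Basis. Ck k U (\<lambda>x. h' x \<bullet> b)"
    by auto
  with Suc.IH show ?case
    by (auto intro!: exI[of _ "\<lambda>x. g' x + h' x"] GDERIV_add simp: inner_add_left)
qed (auto intro: continuous_intros)

lemma Ck_mult: "Ck k U g \<Longrightarrow> Ck k U h \<Longrightarrow> Ck k U (\<lambda>x. g x * h x)"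
proof (induction k arbitrary: g h)
  case (Suc k)
  then obtain g' h' where *: "\<forall>x\<in>U. GDERIV g x :> g' x" "\<forall>b\<in>Basis. Ck k U (\<lambda>x. g' x \<bullet> b)"
      "\<forall>x\<in>U. GDERIV h x :> h' x" "\<forall>b\<in>Basis. Ck k U (\<lambda>x. h' x \<bullet> b)"
    by auto
  have "Ck k U g" "Ck k U h" using Suc.prems Ck_Suc_imp by blast+
  with * Suc.IH show ?case
    by (auto intro!: exI[of _ "\<lambda>x. g x *\<^sub>R h' x + h x *\<^sub>R g' x"] GDERIV_mult Ck_add
        simp: inner_add_left)
qed (auto intro: continuous_intros)

lemma Ck_uminus: "Ck k U g \<Longrightarrow> Ck k U (\<lambda>x. - g x)"
  using Ck_mult[OF Ck_const[of k U "-1"], of g] by simp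

lemma Ck_diff: "Ck k U g \<Longrightarrow> Ck k U h \<Longrightarrow> Ck k U (\<lambda>x. g x - h x)"
  using Ck_add[of k U g "\<lambda>x. - h x"] Ck_uminus[of k U h] by simp

lemma Ck_inverse: "Ck k U g \<Longrightarrow> (\<And>x. x \<in> U \<Longrightarrow> g x \<noteq> 0) \<Longrightarrow> Ck k U (\<lambda>x. inverse (g x))"
proof (induction k arbitrary: g)
  case (Suc k)
  then obtain g' where *: "\<forall>x\<in>U. GDERIV g x :> g' x" "\<forall>b\<in>Basis. Ck k U (\<lambda>x. g' x \<bullet> b)"
    by auto
  have "Ck k U (\<lambda>x. inverse (g x))" using Suc.IH[OF Ck_Suc_imp[OF Suc.prems(1)] Suc.prems(2)] .
  with * Suc.prems show ?case
    by (auto intro!: exI[of _ "\<lambda>x. - (inverse (g x))\<^sup>2 *\<^sub>R g' x"] GDERIV_inverse Ck_mult Ck_uminus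
        simp: power2_eq_square)
qed (auto intro: continuous_intros)

lemma Ck_divide:
  "Ck k U g \<Longrightarrow> Ck k U h \<Longrightarrow> (\<And>x. x \<in> U \<Longrightarrow> h x \<noteq> 0) \<Longrightarrow> Ck k U (\<lambda>x. g x / h x)"
  by (simp add: divide_inverse Ck_mult Ck_inverse)

section \<open>Gradients, and their behaviour along lines\<close>

lemma GDERIV_grad:
  assumes "f differentiable (at x)"
  shows "GDERIV f x :> (\<Sum>b\<in>Basis. frechet_derivative f (at x) b *\<^sub>R b)"
proof -
  let ?D = "frechet_derivative f (at x)"
  have D: "(f has_derivative ?D) (at x)"
    using assms by (simp add: frechet_derivative_works)
  then have lin: "linear ?D" by (rule has_derivative_linear)
  have "?D h = h \<bullet> (\<Sum>b\<in>Basis. ?D b *\<^sub>R b)" for h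
  proof -
    have "?D h = ?D (\<Sum>b\<in>Basis. (h \<bullet> b) *\<^sub>R b)" by (simp add: euclidean_representation)
    also have "\<dots> = (\<Sum>b\<in>Basis. (h \<bullet> b) * ?D b)"
      by (simp add: linear_sum[OF lin] linear_scale[OF lin])
    finally show ?thesis by (simp add: inner_sum_right mult.commute)
  qed
  then have "?D = (\<lambda>h. h \<bullet> (\<Sum>b\<in>Basis. ?D b *\<^sub>R b))" by (rule ext)
  then show ?thesis unfolding gderiv_def by (rule has_derivative_eq_rhs[OF D])
qed

text \<open>\<open>Ck\<close> lives on a set and leaves the gradient existential, so that it can be
  restricted to neighbourhoods and moved along changes of coordinates. Here the gradient is
  assembled from the directional derivatives that \<open>C_times\<close> provides.\<close>

lemma C_times_imp_Ck: "C_times k f \<Longrightarrow> Ck k UNIV f"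
proof (induction k arbitrary: f)
  case (Suc k)
  then show ?case
    by (auto intro!: exI[of _ "\<lambda>x. \<Sum>b\<in>Basis. frechet_derivative f (at x) b *\<^sub>R b"] GDERIV_grad)
qed auto

lemma GDERIV_line:
  assumes "GDERIV g (x + t *\<^sub>R v) :> D"
  shows "DERIV (\<lambda>t. g (x + t *\<^sub>R v)) t :> v \<bullet> D"
proof -
  have "((\<lambda>t. x + t *\<^sub>R v) has_derivative (\<lambda>h. h *\<^sub>R v)) (at t)"
    by (auto intro!: derivative_eq_intros)
  from has_derivative_compose[OF this assms[unfolded gderiv_def]] show ?thesis
    unfolding has_field_derivative_def
    by (rule has_derivative_eq_rhs) (simp add: fun_eq_iff mult.commute)
qed

lemma GDERIV_MVT:
  assumes "\<And>t. 0 \<le> t \<Longrightarrow> t \<le> 1 \<Longrightarrow> GDERIV f (x + t *\<^sub>R (y - x)) :> g (x + t *\<^sub>R (y - x))"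
  obtains t where "0 < t" "t < 1" "f y - f x = (y - x) \<bullet> g (x + t *\<^sub>R (y - x))"
proof -
  from MVT2[of 0 1, OF _ GDERIV_line[OF assms]] show ?thesis using that by auto
qed

section \<open>The Morse--Sard theorem for real-valued functions\<close>

text \<open>By Lindelof, countably many of the neighbourhoods cover \<open>A\<close>. This is what
  allows the argument for critical values to be local.\<close>

lemma negligible_image_locally:
  fixes A :: "'a::euclidean_space set" and f :: "'a \<Rightarrow> 'b::euclidean_space"
  assumes "\<And>x. x \<in> A \<Longrightarrow> \<exists>N. open N \<and> x \<in> N \<and> negligible (f ` (A \<inter> N))"
  shows "negligible (f ` A)"
proof -
  let ?\<F> = "{N. open N \<and> negligible (f ` (A \<inter> N))}"
  obtain \<F>' where F: "\<F>' \<subseteq> ?\<F>" "countable \<F>'" "\<Union>\<F>' = \<Union>?\<F>"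
    by (rule Lindelof[of ?\<F>]) auto
  have "f ` A \<subseteq> (\<Union>N\<in>\<F>'. f ` (A \<inter> N))"
  proof (rule image_subsetI)
    fix x assume x: "x \<in> A"
    with assms have "x \<in> \<Union>?\<F>" by blast
    then have "x \<in> \<Union>\<F>'" using F(3) by simp
    with x show "f x \<in> (\<Union>N\<in>\<F>'. f ` (A \<inter> N))" by blast
  qed
  moreover have "negligible (\<Union>N\<in>\<F>'. f ` (A \<inter> N))"
    using F by (intro negligible_countable_Union) auto
  ultimately show ?thesis by (rule negligible_subset[rotated])
qed

section \<open>Null images by counting grid cells\<close>

lemma floor_divide_eq_imp_dist_le:
  fixes e :: real
  assumes "e > 0" "\<lfloor>u / e\<rfloor> = \<lfloor>v / e\<rfloor>"
  shows "\<bar>u - v\<bar> \<le> e"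
proof -
  have "u / e - v / e \<le> 1" "v / e - u / e \<le> 1" using assms(2) by linarith+
  then have "(u - v) / e \<le> 1" "(v - u) / e \<le> 1" by (simp_all add: diff_divide_distrib)
  with assms(1) show ?thesis by (simp add: divide_le_eq)
qed

text \<open>A grid of mesh \<open>h\<close> cuts \<open>A\<close> into about
  \<open>(1 / h) ^ card B\<close> cells, and the image of each has length of order
  \<open>\<eta> * h ^ m\<close>. As \<open>m\<close> is at least \<open>card B\<close>, the total
  length is at most a constant times \<open>\<eta>\<close>, which is arbitrary.\<close>

lemma negligible_image_Hoelder:
  fixes f :: "'a::euclidean_space \<Rightarrow> real"
  assumes B: "B \<subseteq> Basis" and A: "A \<subseteq> span B" "bounded A" and m: "card B \<le> m"
    and fl: "\<And>\<eta>. \<eta> > 0 \<Longrightarrow> \<exists>\<delta>>0. \<forall>x\<in>A. \<forall>y\<in>A. norm (y - x) < \<delta> \<longrightarrow>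
               \<bar>f y - f x\<bar> \<le> \<eta> * norm (y - x) ^ m"
  shows "negligible (f ` A)"
  unfolding negligible_outer_le
proof (intro allI impI)
  fix e :: real assume e: "e > 0"
  obtain R where R: "R \<ge> 1" "\<And>x. x \<in> A \<Longrightarrow> norm x \<le> R"
    using A(2) unfolding bounded_iff by (metis linorder_le_cases order.trans)
  let ?n = "card B"
  have finB: "finite B" using B finite_Basis by (rule finite_subset)
  \<comment> \<open>\<open>W\<close> collects the factors of the final estimate:
    \<open>(2 * R + 4) ^ ?n\<close> from the number of cells, \<open>(real ?n + 1) ^ m\<close> from
    their diameter, and 2 because an interval is twice as long as its radius.\<close>
  define W where "W = (2 * R + 4) ^ ?n * (real ?n + 1) ^ m * 2"
  have W: "W > 0" using R by (auto simp: W_def)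
  define \<eta> where "\<eta> = e / W"
  have \<eta>: "\<eta> > 0" using e W by (simp add: \<eta>_def)
  obtain \<delta> where \<delta>: "\<delta> > 0" "\<And>x y. x \<in> A \<Longrightarrow> y \<in> A \<Longrightarrow> norm (y - x) < \<delta> \<Longrightarrow>
       \<bar>f y - f x\<bar> \<le> \<eta> * norm (y - x) ^ m"
    using fl[OF \<eta>] by blast
  \<comment> \<open>Mesh at most 1 gives \<open>h ^ m \<le> h ^ ?n\<close>; the other bound keeps
    the diameter of a cell below \<open>\<delta>\<close>.\<close>
  define h where "h = min 1 (\<delta> / (real ?n + 2))"
  have h: "h > 0" "h \<le> 1" using \<delta> by (auto simp: h_def)
  have hd: "(real ?n + 1) * h < \<delta>"
  proof -
    have "(real ?n + 1) * h < (real ?n + 2) * h" using h by simp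
    also have "\<dots> \<le> (real ?n + 2) * (\<delta> / (real ?n + 2))"
      by (intro mult_left_mono) (auto simp: h_def)
    also have "\<dots> = \<delta>" by simp
    finally show ?thesis .
  qed
  define ix where "ix x = (\<lambda>b\<in>B. \<lfloor>(x \<bullet> b) / h\<rfloor>)" for x :: 'a
  define I where "I = (PiE B (\<lambda>_. {\<lfloor>- R / h\<rfloor>..\<lfloor>R / h\<rfloor>}))"
  have finI: "finite I" unfolding I_def using finB by (intro finite_PiE) auto
  have ixI: "ix x \<in> I" if "x \<in> A" for x
  proof -
    have "\<lfloor>(x \<bullet> b) / h\<rfloor> \<in> {\<lfloor>- R / h\<rfloor>..\<lfloor>R / h\<rfloor>}" if "b \<in> B" for b
    proof -
      have "\<bar>x \<bullet> b\<bar> \<le> norm x" using that B by (intro Basis_le_norm) auto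
      also have "\<dots> \<le> R" using R \<open>x \<in> A\<close> by auto
      finally have "- R \<le> x \<bullet> b" "x \<bullet> b \<le> R" by auto
      then have "- R / h \<le> (x \<bullet> b) / h" "(x \<bullet> b) / h \<le> R / h"
        using h by (intro divide_right_mono; simp)+
      then show ?thesis by (auto intro: floor_mono)
    qed
    then show ?thesis unfolding ix_def I_def by (auto simp: restrict_def PiE_def extensional_def)
  qed
  have cardI: "real (card I) \<le> ((2 * R + 4) / h) ^ ?n"
  proof -
    have "real (card {\<lfloor>- R / h\<rfloor>..\<lfloor>R / h\<rfloor>}) \<le> (2 * R + 4) / h"
    proof -
      have "real (card {\<lfloor>- R / h\<rfloor>..\<lfloor>R / h\<rfloor>}) = real_of_int (\<lfloor>R / h\<rfloor> - \<lfloor>- R / h\<rfloor> + 1)"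
      proof -
        have "\<lfloor>- R / h\<rfloor> \<le> \<lfloor>R / h\<rfloor>" using h R by (intro floor_mono divide_right_mono) auto
        then show ?thesis by simp
      qed
      also have "\<dots> \<le> R / h - (- R / h - 1) + 1" by linarith
      also have "\<dots> \<le> (2 * R + 4) / h" using h by (simp add: field_simps)
      finally show ?thesis .
    qed
    then show ?thesis unfolding I_def using finB by (simp add: card_PiE power_mono)
  qed
  define S where "S i = {x\<in>A. ix x = i}" for i
  have close: "norm (y - x) \<le> (real ?n + 1) * h" if "x \<in> S i" "y \<in> S i" for x y i
  proof -
    have xy: "x \<in> A" "y \<in> A" "ix x = ix y" using that by (auto simp: S_def)
    have "y - x \<in> span B" using xy A by (auto intro: span_diff)
    have "norm (y - x) \<le> (\<Sum>b\<in>Basis. \<bar>(y - x) \<bullet> b\<bar>)" by (rule norm_le_l1)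
    also have "\<dots> = (\<Sum>b\<in>B. \<bar>(y - x) \<bullet> b\<bar>)"
    proof (rule sum.mono_neutral_right)
      show "\<forall>i\<in>Basis - B. \<bar>(y - x) \<bullet> i\<bar> = 0"
        using \<open>y - x \<in> span B\<close> B by (auto simp: span_substd_basis)
    qed (use B in auto)
    also have "\<dots> \<le> (\<Sum>b\<in>B. h)"
    proof (rule sum_mono)
      fix b assume "b \<in> B"
      then have "\<lfloor>(x \<bullet> b) / h\<rfloor> = \<lfloor>(y \<bullet> b) / h\<rfloor>"
        using fun_cong[OF xy(3), of b] by (simp add: ix_def)
      then show "\<bar>(y - x) \<bullet> b\<bar> \<le> h"
        using floor_divide_eq_imp_dist_le[OF h(1), of "y \<bullet> b" "x \<bullet> b"] by (simp add: inner_diff_left)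
    qed
    also have "\<dots> \<le> (real ?n + 1) * h" using h by (simp add: algebra_simps)
    finally show ?thesis .
  qed
  define \<rho> where "\<rho> = \<eta> * ((real ?n + 1) * h) ^ m"
  have \<rho>: "\<rho> \<ge> 0" using \<eta> h by (auto simp: \<rho>_def)
  \<comment> \<open>Intervals around one value per nonempty cell stand in for the images of the
    cells, which may fail to be measurable.\<close>
  define T where "T = (\<Union>i\<in>{i\<in>I. S i \<noteq> {}}. cball (f (SOME x. x \<in> S i)) \<rho>)"
  have "f ` A \<subseteq> T"
  proof (rule image_subsetI)
    fix x assume x: "x \<in> A"
    let ?i = "ix x"
    let ?y = "SOME y. y \<in> S ?i"
    have xs: "x \<in> S ?i" using x by (simp add: S_def)
    then have ys: "?y \<in> S ?i" by (rule someI)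
    have "norm (x - ?y) \<le> (real ?n + 1) * h" using close[OF ys xs] .
    moreover have "?y \<in> A" using ys by (simp add: S_def)
    ultimately have "\<bar>f x - f ?y\<bar> \<le> \<eta> * norm (x - ?y) ^ m"
      using \<delta>(2)[OF _ x, of ?y] hd by simp
    also have "\<dots> \<le> \<rho>" unfolding \<rho>_def using \<eta> close[OF ys xs]
      by (intro mult_left_mono power_mono) auto
    finally have "f x \<in> cball (f ?y) \<rho>" by (simp add: dist_real_def abs_minus_commute)
    then show "f x \<in> T" unfolding T_def using ixI[OF x] xs by blast
  qed
  moreover have "T \<in> lmeasurable" unfolding T_def
    using finI by (intro fmeasurable.finite_UN) (auto simp del: cball_eq_atLeastAtMost)
  moreover have "measure lebesgue T \<le> e"
  proof -
    let ?J = "{i\<in>I. S i \<noteq> {}}"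
    have "measure lebesgue T \<le> (\<Sum>i\<in>?J. measure lebesgue (cball (f (SOME x. x \<in> S i)) \<rho>))"
      unfolding T_def by (intro measure_UNION_le) (use finI in \<open>auto simp del: cball_eq_atLeastAtMost\<close>)
    also have "\<dots> = real (card ?J) * (2 * \<rho>)"
      using \<rho> by (simp add: cball_eq_atLeastAtMost)
    also have "\<dots> \<le> real (card I) * (2 * \<rho>)"
      using \<rho> finI by (intro mult_right_mono) (auto intro: card_mono)
    also have "\<dots> \<le> ((2 * R + 4) / h) ^ ?n * (2 * \<rho>)"
      using \<rho> cardI by (intro mult_right_mono) auto
    also have "\<dots> = \<eta> * W * (h ^ m / h ^ ?n)"
      unfolding \<rho>_def W_def power_divide power_mult_distrib by simp
    also have "\<dots> \<le> \<eta> * W * 1"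
      using \<eta> W h m by (intro mult_left_mono) (auto simp: divide_le_eq power_decreasing)
    also have "\<dots> = e" using W by (simp add: \<eta>_def)
    finally show ?thesis .
  qed
  ultimately show "\<exists>T. f ` A \<subseteq> T \<and> T \<in> lmeasurable \<and> measure lebesgue T \<le> e" by blast
qed

text \<open>Upper bounds \<open>s\<close> of the family take the place of its maximum. For empty
  \<open>H\<close> the choice \<open>s = 0\<close> makes the derivatives along \<open>B\<close>
  vanish.\<close>

definition dominated ::
  "'a::euclidean_space set \<Rightarrow> 'a set \<Rightarrow> real \<Rightarrow> ('a \<Rightarrow> real) \<Rightarrow> ('a \<Rightarrow> real) set \<Rightarrow> bool" where
  "dominated B U K g H \<longleftrightarrow> (\<exists>g'. \<forall>x\<in>U. GDERIV g x :> g' x \<and>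
     (\<forall>s\<ge>0. (\<forall>h\<in>H. \<bar>h x\<bar> \<le> s) \<longrightarrow> (\<forall>c\<in>B. \<bar>g' x \<bullet> c\<bar> \<le> K * s)))"

text \<open>
  Here \<open>A\<close> is the set on which all functions in \<open>F 0, \<dots>, F j\<close> vanish, and the partial derivatives in
  the directions of \<open>B\<close> of each function are controlled by the next family.  Unlike the derivatives
  of \<open>f\<close> themselves, such a chain survives composition with a merely \<open>C\<^sup>k\<close> change of coordinates,
  and it makes \<open>f\<close> flat of order \<open>j + 1\<close> at \<open>A\<close>.
\<close>

definition flat_chain ::
  "'a::euclidean_space set \<Rightarrow> 'a set \<Rightarrow> 'a set \<Rightarrow> real \<Rightarrow> nat \<Rightarrow>
   (nat \<Rightarrow> ('a \<Rightarrow> real) set) \<Rightarrow> ('a \<Rightarrow> real) \<Rightarrow> bool" where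
  "flat_chain B U A K j F f \<longleftrightarrow> dominated B U K f (F 0) \<and>
     (\<forall>i<j. \<forall>g\<in>F i. dominated B U K g (F (Suc i))) \<and>
     (\<forall>i\<le>j. finite (F i) \<and> (\<forall>g\<in>F i. \<forall>x\<in>A. g x = 0))"

lemma dominated_mono:
  assumes "dominated B U K g H" "B' \<subseteq> B" "U' \<subseteq> U" "K \<le> K'"
  shows "dominated B' U' K' g H"
proof -
  obtain g' where g': "\<And>x. x \<in> U \<Longrightarrow> GDERIV g x :> g' x"
      "\<And>x s c. x \<in> U \<Longrightarrow> s \<ge> 0 \<Longrightarrow> \<forall>h\<in>H. \<bar>h x\<bar> \<le> s \<Longrightarrow> c \<in> B \<Longrightarrow> \<bar>g' x \<bullet> c\<bar> \<le> K * s"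
    using assms(1) unfolding dominated_def by blast
  have "\<bar>g' x \<bullet> c\<bar> \<le> K' * s" if "x \<in> U'" "s \<ge> 0" "\<forall>h\<in>H. \<bar>h x\<bar> \<le> s" "c \<in> B'" for x s c
  proof -
    have "\<bar>g' x \<bullet> c\<bar> \<le> K * s" using g'(2)[of x s c] that assms by blast
    also have "\<dots> \<le> K' * s" using that assms by (intro mult_right_mono) auto
    finally show ?thesis .
  qed
  with g'(1) assms(3) show ?thesis unfolding dominated_def by (intro exI[of _ g']) auto
qed

text \<open>Mean value theorem on the segment: since \<open>y - x\<close> lies in
  \<open>span B\<close>, only the derivatives along \<open>B\<close> enter, and these are the ones
  under control.\<close>

lemma dominated_segment_bound:
  assumes dom: "dominated B N K g H" and N: "closed_segment x y \<subseteq> N"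
    and B: "B \<subseteq> Basis" "y - x \<in> span B" and s: "s \<ge> 0"
    and H: "\<And>z h. z \<in> closed_segment x y \<Longrightarrow> h \<in> H \<Longrightarrow> \<bar>h z\<bar> \<le> s"
  shows "\<bar>g y - g x\<bar> \<le> real (card B) * K * norm (y - x) * s"
proof -
  obtain g' where g': "\<And>z. z \<in> N \<Longrightarrow> GDERIV g z :> g' z"
      "\<And>z c. z \<in> closed_segment x y \<Longrightarrow> c \<in> B \<Longrightarrow> \<bar>g' z \<bullet> c\<bar> \<le> K * s"
  proof -
    obtain g' where g': "\<And>z. z \<in> N \<Longrightarrow> GDERIV g z :> g' z \<and>
       (\<forall>s\<ge>0. (\<forall>h\<in>H. \<bar>h z\<bar> \<le> s) \<longrightarrow> (\<forall>c\<in>B. \<bar>g' z \<bullet> c\<bar> \<le> K * s))"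
      using dom unfolding dominated_def by blast
    show ?thesis
    proof (rule that)
      show "GDERIV g z :> g' z" if "z \<in> N" for z using g'[OF that] by simp
      show "\<bar>g' z \<bullet> c\<bar> \<le> K * s" if z: "z \<in> closed_segment x y" and c: "c \<in> B" for z c
        using g'[OF subsetD[OF N z]] s H[OF z] c by simp
    qed
  qed
  have seg: "x + t *\<^sub>R (y - x) \<in> closed_segment x y" if "0 \<le> t" "t \<le> 1" for t
    using that by (auto simp: in_segment algebra_simps intro!: exI[of _ t])
  obtain t where t: "0 < t" "t < 1" "g y - g x = (y - x) \<bullet> g' (x + t *\<^sub>R (y - x))"
    using GDERIV_MVT[of g x y g'] g'(1) seg N by blast
  define z where "z = x + t *\<^sub>R (y - x)"
  have z: "z \<in> closed_segment x y" unfolding z_def using seg t by simp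
  have finB: "finite B" using B(1) finite_Basis by (rule finite_subset)
  have "g y - g x = (y - x) \<bullet> g' z" using t by (simp add: z_def)
  also have "\<dots> = (\<Sum>c\<in>Basis. ((y - x) \<bullet> c) * (g' z \<bullet> c))" by (rule euclidean_inner)
  also have "\<dots> = (\<Sum>c\<in>B. ((y - x) \<bullet> c) * (g' z \<bullet> c))"
    by (rule sum.mono_neutral_right) (use B in \<open>auto simp: span_substd_basis\<close>)
  finally have "\<bar>g y - g x\<bar> \<le> (\<Sum>c\<in>B. \<bar>(y - x) \<bullet> c\<bar> * \<bar>g' z \<bullet> c\<bar>)"
    by (simp add: sum_abs flip: abs_mult)
  also have "\<dots> \<le> (\<Sum>c\<in>B. norm (y - x) * (K * s))"
  proof (intro sum_mono mult_mono)
    fix c assume c: "c \<in> B"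
    then show "\<bar>(y - x) \<bullet> c\<bar> \<le> norm (y - x)" using B(1) by (intro Basis_le_norm) auto
    show "\<bar>g' z \<bullet> c\<bar> \<le> K * s" by (rule g'(2)[OF z c])
  qed auto
  also have "\<dots> = real (card B) * K * norm (y - x) * s" by simp
  finally show ?thesis .
qed

text \<open>All functions of the chain vanish at \<open>x\<close>, so passing from a family to the
  previous one gains a factor \<open>norm (y - x)\<close>. The segment may leave \<open>A\<close>;
  only \<open>x\<close> has to lie in it.\<close>

lemma flat_chain_estimate:
  assumes ch: "flat_chain B N A K j F f" and N: "closed_segment x y \<subseteq> N" and x: "x \<in> A"
    and B: "B \<subseteq> Basis" "y - x \<in> span B" and K: "K \<ge> 0" and \<eta>: "\<eta> \<ge> 0"
    and F: "\<And>z h. z \<in> closed_segment x y \<Longrightarrow> h \<in> F j \<Longrightarrow> \<bar>h z\<bar> \<le> \<eta>"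
  shows "\<bar>f y - f x\<bar> \<le> (real (card B) * K * norm (y - x)) ^ (j + 1) * \<eta>"
proof -
  let ?D = "real (card B) * K"
  have seg: "closed_segment x z \<subseteq> closed_segment x y" if "z \<in> closed_segment x y" for z
    using that by (simp add: subset_closed_segment)
  have sp: "z - x \<in> span B" if "z \<in> closed_segment x y" for z
  proof -
    obtain u where "z = (1 - u) *\<^sub>R x + u *\<^sub>R y" using \<open>z \<in> _\<close> by (auto simp: in_segment)
    then have "z - x = u *\<^sub>R (y - x)" by (simp add: algebra_simps)
    then show ?thesis using B(2) by (simp add: span_mul)
  qed
  have nn: "0 \<le> (?D * r) ^ d * \<eta>" if "r \<ge> 0" for r d using K \<eta> that by simp
  \<comment> \<open>\<open>d\<close> counts the links back from the last family.\<close>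
  have est: "\<forall>g\<in>F (j - d). \<forall>z\<in>closed_segment x y. \<bar>g z\<bar> \<le> (?D * norm (z - x)) ^ d * \<eta>" if "d \<le> j" for d
    using that
  proof (induction d)
    case 0
    then show ?case using F by simp
  next
    case (Suc d)
    show ?case
    proof (intro ballI)
      fix g z assume g: "g \<in> F (j - Suc d)" and z: "z \<in> closed_segment x y"
      have "Suc (j - Suc d) = j - d" "j - Suc d < j" using Suc.prems by auto
      then have dom: "dominated B N K g (F (j - d))"
        using ch g unfolding flat_chain_def by metis
      have "g x = 0" using ch g x \<open>j - Suc d < j\<close> unfolding flat_chain_def by (meson less_imp_le)
      have "\<bar>g z - g x\<bar> \<le> ?D * norm (z - x) * ((?D * norm (z - x)) ^ d * \<eta>)"
      proof (rule dominated_segment_bound[OF dom])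
        show "closed_segment x z \<subseteq> N" using seg[OF z] N by blast
        fix v h assume v: "v \<in> closed_segment x z" and h: "h \<in> F (j - d)"
        have "\<bar>h v\<bar> \<le> (?D * norm (v - x)) ^ d * \<eta>" using Suc h v seg[OF z] by auto
        also have "norm (v - x) \<le> norm (z - x)" using segment_bound1[OF v] by simp
        then have "(?D * norm (v - x)) ^ d * \<eta> \<le> (?D * norm (z - x)) ^ d * \<eta>"
          using K \<eta> by (intro mult_right_mono power_mono mult_left_mono) auto
        finally show "\<bar>h v\<bar> \<le> (?D * norm (z - x)) ^ d * \<eta>" .
      qed (use B sp[OF z] K \<eta> in auto)
      then show "\<bar>g z\<bar> \<le> (?D * norm (z - x)) ^ Suc d * \<eta>" using \<open>g x = 0\<close> by (simp add: mult_ac)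
    qed
  qed
  have "\<bar>f y - f x\<bar> \<le> ?D * norm (y - x) * ((?D * norm (y - x)) ^ j * \<eta>)"
  proof (rule dominated_segment_bound[OF _ N B])
    show "dominated B N K f (F 0)" using ch by (simp add: flat_chain_def)
    fix v h assume v: "v \<in> closed_segment x y" and h: "h \<in> F 0"
    have "\<bar>h v\<bar> \<le> (?D * norm (v - x)) ^ j * \<eta>" using est[of j] h v by auto
    also have "norm (v - x) \<le> norm (y - x)" using segment_bound1[OF v] by simp
    then have "(?D * norm (v - x)) ^ j * \<eta> \<le> (?D * norm (y - x)) ^ j * \<eta>"
      using K \<eta> by (intro mult_right_mono power_mono mult_left_mono) auto
    finally show "\<bar>h v\<bar> \<le> (?D * norm (y - x)) ^ j * \<eta>" .
  qed (use K \<eta> in auto)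
  then show ?thesis by (simp add: mult_ac)
qed

text \<open>The last family is continuous and vanishes on \<open>A\<close>, so locally it is
  uniformly small near \<open>A\<close>. Hence the increments of \<open>f\<close> on
  \<open>A\<close> are of smaller order than the power \<open>j + 1\<close>, which is at least the
  dimension.\<close>

lemma negligible_image_flat_chain:
  assumes U: "open U" "A \<subseteq> U" and B: "B \<subseteq> Basis" "A \<subseteq> span B" and K: "K \<ge> 0"
    and ch: "flat_chain B U A K j F f"
    and cont: "\<And>g. g \<in> F j \<Longrightarrow> continuous_on U g"
    and card: "card B \<le> j + 1"
  shows "negligible (f ` A)"
proof (rule negligible_image_locally)
  fix x0 assume "x0 \<in> A"
  then obtain r where r: "r > 0" "cball x0 r \<subseteq> U" using U open_contains_cball by blast
  let ?N = "cball x0 r"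
  let ?D = "real (card B) * K"
  have finF: "finite (F j)" and F0: "\<And>g x. g \<in> F j \<Longrightarrow> x \<in> A \<Longrightarrow> g x = 0"
    using ch by (auto simp: flat_chain_def)
  have "negligible (f ` (A \<inter> ?N))"
  proof (rule negligible_image_Hoelder[OF B(1) _ _ card])
    show "A \<inter> ?N \<subseteq> span B" using B by auto
    show "bounded (A \<inter> ?N)" by (simp add: bounded_Int)
    fix \<eta> :: real assume \<eta>: "\<eta> > 0"
    \<comment> \<open>The summand 1 keeps the denominator positive when \<open>?D = 0\<close>, which
      happens for empty \<open>B\<close> or \<open>K = 0\<close>.\<close>
    define \<eta>' where "\<eta>' = \<eta> / (?D ^ (j + 1) + 1)"
    have D: "?D ^ (j + 1) \<ge> 0" using K by simp
    have \<eta>': "\<eta>' > 0" unfolding \<eta>'_def using \<eta> D by (intro divide_pos_pos) linarith+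
    have D\<eta>: "?D ^ (j + 1) * \<eta>' \<le> \<eta>"
    proof -
      have "?D ^ (j + 1) * \<eta>' \<le> (?D ^ (j + 1) + 1) * \<eta>'" using \<eta>' by (intro mult_right_mono) auto
      also have "\<dots> = \<eta>" unfolding \<eta>'_def using D by simp
      finally show ?thesis .
    qed
    have "\<exists>d>0. \<forall>x\<in>?N. \<forall>y\<in>?N. dist y x < d \<longrightarrow> dist (g y) (g x) < \<eta>'" if "g \<in> F j" for g
    proof -
      have "uniformly_continuous_on ?N g"
        using cont[OF that] r by (intro compact_uniformly_continuous) (auto intro: continuous_on_subset)
      then show ?thesis using \<eta>' unfolding uniformly_continuous_on_def by blast
    qed
    then obtain d where d: "\<And>g. g \<in> F j \<Longrightarrow> d g > 0"
        "\<And>g x y. g \<in> F j \<Longrightarrow> x \<in> ?N \<Longrightarrow> y \<in> ?N \<Longrightarrow> dist y x < d g \<Longrightarrow> dist (g y) (g x) < \<eta>'"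
      by metis
    define \<delta> where "\<delta> = Min (insert 1 (d ` F j))"
    have \<delta>: "\<delta> > 0" "\<And>g. g \<in> F j \<Longrightarrow> \<delta> \<le> d g" using finF d by (auto simp: \<delta>_def)
    have "\<bar>f y - f x\<bar> \<le> \<eta> * norm (y - x) ^ (j + 1)"
      if xy: "x \<in> A \<inter> ?N" "y \<in> A \<inter> ?N" "norm (y - x) < \<delta>" for x y
    proof -
      have seg: "closed_segment x y \<subseteq> ?N" using xy by (intro closed_segment_subset) auto
      have "\<bar>f y - f x\<bar> \<le> (?D * norm (y - x)) ^ (j + 1) * \<eta>'"
      proof (rule flat_chain_estimate[OF ch])
        show "closed_segment x y \<subseteq> U" using seg r by blast
        show "y - x \<in> span B" using xy B by (auto intro: span_diff)
        fix z h assume z: "z \<in> closed_segment x y" and h: "h \<in> F j"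
        have "dist z x < d h"
          using segment_bound1[OF z] \<delta>(2)[OF h] xy by (simp add: dist_norm)
        then show "\<bar>h z\<bar> \<le> \<eta>'"
          using d(2)[OF h, of x z] z seg xy F0[OF h, of x] by (force simp: dist_real_def)
      qed (use xy B K \<eta>' in auto)
      also have "\<dots> = (?D ^ (j + 1) * \<eta>') * norm (y - x) ^ (j + 1)"
        unfolding power_mult_distrib by (simp only: mult_ac)
      also have "\<dots> \<le> \<eta> * norm (y - x) ^ (j + 1)" using D\<eta> by (intro mult_right_mono) auto
      finally show ?thesis .
    qed
    then show "\<exists>\<delta>>0. \<forall>x\<in>A \<inter> ?N. \<forall>y\<in>A \<inter> ?N. norm (y - x) < \<delta> \<longrightarrow>
        \<bar>f y - f x\<bar> \<le> \<eta> * norm (y - x) ^ (j + 1)" using \<delta>(1) by blast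
  qed
  then have "negligible (f ` (A \<inter> ball x0 r))"
    by (rule negligible_subset) auto
  then show "\<exists>N. open N \<and> x0 \<in> N \<and> negligible (f ` (A \<inter> N))" using r by (intro exI[of _ "ball x0 r"]) auto
qed

text \<open>\<open>\<Phi>\<close> replaces the \<open>b\<close>-coordinate by the value of
  \<open>w\<close>. Two points with the same image lie on a line in direction \<open>b\<close> and
  agree in \<open>w\<close>, which the mean value theorem on the convex set \<open>N\<close>
  excludes unless they coincide; openness of the image is invariance of domain. The gradient in the
  conclusion has component \<open>(u' \<bullet> c) - (u' \<bullet> b) * (w' x \<bullet> c) / (w' x
  \<bullet> b)\<close> in each basis direction \<open>c\<close> other than \<open>b\<close>.\<close>

lemma straighten_level_set:
  fixes w :: "'a::euclidean_space \<Rightarrow> real"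
  assumes N: "open N" "convex N" and b: "b \<in> Basis"
    and w: "\<And>x. x \<in> N \<Longrightarrow> GDERIV w x :> w' x" "\<And>x. x \<in> N \<Longrightarrow> w' x \<bullet> b \<noteq> 0"
  defines "\<Phi> \<equiv> \<lambda>x. x + (w x - x \<bullet> b) *\<^sub>R b"
  obtains \<Psi> where "open (\<Phi> ` N)" "\<And>x. x \<in> N \<Longrightarrow> \<Psi> (\<Phi> x) = x"
    "\<And>u u' x. x \<in> N \<Longrightarrow> GDERIV u x :> u' \<Longrightarrow>
       GDERIV (\<lambda>y. u (\<Psi> y)) (\<Phi> x) :> u' + ((u' \<bullet> b) / (w' x \<bullet> b)) *\<^sub>R (b - w' x)"
proof -
  have bb: "b \<bullet> b = 1" using b by simp
  have "inj_on \<Phi> N"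
  proof (rule inj_onI)
    fix x y assume xy: "x \<in> N" "y \<in> N" "\<Phi> x = \<Phi> y"
    have "\<Phi> z \<bullet> b = w z" for z by (simp add: \<Phi>_def inner_add_left bb)
    then have wxy: "w x = w y" using xy(3) by metis
    define t where "t = (y - x) \<bullet> b"
    have "x - (x \<bullet> b) *\<^sub>R b = y - (y \<bullet> b) *\<^sub>R b"
      using xy(3) wxy by (simp add: \<Phi>_def algebra_simps)
    then have y: "y = x + t *\<^sub>R b" by (simp add: t_def algebra_simps)
    have seg: "x + s *\<^sub>R y - s *\<^sub>R x \<in> N" if "0 \<le> s" "s \<le> 1" for s
      using convexD_alt[OF N(2) xy(1,2) that] by (simp add: algebra_simps)
    obtain s where s: "0 < s" "s < 1" "w y - w x = (y - x) \<bullet> w' (x + s *\<^sub>R (y - x))"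
    proof (rule GDERIV_MVT[of w x y w'])
      fix s :: real assume "0 \<le> s" "s \<le> 1"
      then show "GDERIV w (x + s *\<^sub>R (y - x)) :> w' (x + s *\<^sub>R (y - x))"
        using w(1)[OF seg] by (simp add: algebra_simps)
    qed
    have "(y - x) \<bullet> w' (x + s *\<^sub>R (y - x)) = t * (w' (x + s *\<^sub>R (y - x)) \<bullet> b)"
      using y by (simp add: inner_commute)
    moreover have "w' (x + s *\<^sub>R (y - x)) \<bullet> b \<noteq> 0"
      using w(2)[OF seg[of s]] s by (simp add: algebra_simps)
    ultimately have "t = 0" using s wxy by simp
    then show "x = y" using y by simp
  qed
  have der: "(\<Phi> has_derivative (\<lambda>v. v + (v \<bullet> w' x - v \<bullet> b) *\<^sub>R b)) (at x)" if "x \<in> N" for x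
    unfolding \<Phi>_def using w(1)[OF that] unfolding gderiv_def
    by (auto intro!: derivative_eq_intros)
  have cont: "continuous_on N \<Phi>"
    by (meson continuous_at_imp_continuous_on der has_derivative_continuous)
  define \<Psi> where "\<Psi> = inv_into N \<Phi>"
  have inv: "\<Psi> (\<Phi> x) = x" if "x \<in> N" for x
    using that \<open>inj_on \<Phi> N\<close> by (simp add: \<Psi>_def)
  have ope: "open (\<Phi> ` N)"
    by (rule invariance_of_domain[OF cont N(1) \<open>inj_on \<Phi> N\<close>])
  show ?thesis
  proof (rule that[OF ope inv])
    fix u u' x assume x: "x \<in> N" and u: "GDERIV u x :> u'"
    let ?\<beta> = "w' x \<bullet> b"
    have "(\<Psi> has_derivative (\<lambda>y. y + ((y \<bullet> b - y \<bullet> w' x) / ?\<beta>) *\<^sub>R b)) (at (\<Phi> x))"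
    proof (rule has_derivative_inverse_strong[OF N(1) x cont inv der[OF x]])
      have "(b \<bullet> w' x) = ?\<beta>" by (rule inner_commute)
      then show "(\<lambda>v. v + (v \<bullet> w' x - v \<bullet> b) *\<^sub>R b) \<circ> (\<lambda>y. y + ((y \<bullet> b - y \<bullet> w' x) / ?\<beta>) *\<^sub>R b) = id"
        using w(2)[OF x] bb
        by (auto simp: fun_eq_iff algebra_simps diff_divide_distrib)
    qed
    moreover have "(u has_derivative (\<lambda>h. h \<bullet> u')) (at (\<Psi> (\<Phi> x)))"
      using u inv[OF x] by (simp add: gderiv_def)
    ultimately have "((\<lambda>y. u (\<Psi> y)) has_derivative
        (\<lambda>y. (y + ((y \<bullet> b - y \<bullet> w' x) / ?\<beta>) *\<^sub>R b) \<bullet> u')) (at (\<Phi> x))"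
      by (rule has_derivative_compose)
    then show "GDERIV (\<lambda>y. u (\<Psi> y)) (\<Phi> x) :> u' + ((u' \<bullet> b) / ?\<beta>) *\<^sub>R (b - w' x)"
      unfolding gderiv_def
      by (rule has_derivative_eq_rhs)
        (auto simp: fun_eq_iff inner_add_left inner_add_right inner_diff_right inner_commute[of b u']
          algebra_simps diff_divide_distrib)
  qed
qed

text \<open>The gradient of \<open>u\<close> composed with \<open>\<Psi>\<close> is \<open>E\<close>
  composed with \<open>\<Psi>\<close>, where \<open>E\<close> is algebraic in the gradients of
  \<open>u\<close> and \<open>w\<close>. So the regularity follows by induction from the continuity
  of \<open>\<Psi>\<close>, without higher derivatives of \<open>\<Psi>\<close> as a map.\<close>

lemma Ck_straighten:
  fixes w' :: "'a::euclidean_space \<Rightarrow> 'a"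
  assumes \<Psi>: "\<And>x. x \<in> N \<Longrightarrow> \<Psi> (\<Phi> x) = x"
    and der: "\<And>u u' x. x \<in> N \<Longrightarrow> GDERIV u x :> u' \<Longrightarrow>
       GDERIV (\<lambda>y. u (\<Psi> y)) (\<Phi> x) :> u' + ((u' \<bullet> b) / (w' x \<bullet> b)) *\<^sub>R (b - w' x)"
    and b: "b \<in> Basis" and cont: "continuous_on (\<Phi> ` N) \<Psi>"
    and w: "\<And>c. c \<in> Basis \<Longrightarrow> Ck k N (\<lambda>x. w' x \<bullet> c)" "\<And>x. x \<in> N \<Longrightarrow> w' x \<bullet> b \<noteq> 0"
  shows "i \<le> Suc k \<Longrightarrow> Ck i N u \<Longrightarrow> Ck i (\<Phi> ` N) (\<lambda>y. u (\<Psi> y))"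
proof (induction i arbitrary: u)
  case 0
  moreover have "\<Psi> ` \<Phi> ` N = N" using \<Psi> by force
  ultimately show ?case using cont continuous_on_compose2[of N u "\<Phi> ` N" \<Psi>] by simp
next
  case (Suc i)
  from Suc.prems obtain u' where u': "\<And>x. x \<in> N \<Longrightarrow> GDERIV u x :> u' x"
      "\<And>c. c \<in> Basis \<Longrightarrow> Ck i N (\<lambda>x. u' x \<bullet> c)" by auto
  have Ck_le: "Ck m N g" if "Ck k N g" "m \<le> k" for m g
    using that(2,1) by (induction rule: inc_induct) (auto intro: Ck_Suc_imp simp del: Ck.simps)
  define E where "E x = u' x + ((u' x \<bullet> b) / (w' x \<bullet> b)) *\<^sub>R (b - w' x)" for x
  have w'i: "Ck i N (\<lambda>x. w' x \<bullet> c)" if c: "c \<in> Basis" for c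
    using Ck_le[OF w(1)[OF c]] Suc.prems(1) by simp
  have E: "Ck i N (\<lambda>x. E x \<bullet> c)" if c: "c \<in> Basis" for c
    unfolding E_def inner_add_left inner_scaleR_left inner_diff_left
    by (intro Ck_add Ck_mult Ck_diff Ck_divide Ck_const w'i u'(2) b c w(2))
  have "\<forall>c\<in>Basis. Ck i (\<Phi> ` N) (\<lambda>y. E (\<Psi> y) \<bullet> c)"
  proof
    fix c :: 'a assume "c \<in> Basis"
    with Suc.IH[OF _ E] Suc.prems(1) show "Ck i (\<Phi> ` N) (\<lambda>y. E (\<Psi> y) \<bullet> c)" by simp
  qed
  moreover have "\<forall>y\<in>\<Phi> ` N. GDERIV (\<lambda>y. u (\<Psi> y)) y :> E (\<Psi> y)"
    using der u'(1) \<Psi> by (auto simp: E_def)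
  ultimately show ?case by auto
qed

text \<open>
  Induction on \<open>card B\<close> and \<open>k\<close>.  Where all gradients of the last family vanish, the chain gets longer
  and \<open>k\<close> drops.  Elsewhere some \<open>w\<close> in the last family has \<open>\<partial>\<^sub>b w \<noteq> 0\<close>; taking \<open>w\<close> as the new \<open>b\<close>-coordinate
  moves \<open>A\<close> into the hyperplane orthogonal to \<open>b\<close>, so \<open>b\<close> can be dropped from \<open>B\<close>.
\<close>

lemma negligible_image_flat_chain_Ck:
  assumes "open U" "A \<subseteq> U" "B \<subseteq> Basis" "A \<subseteq> span B" "K \<ge> 0"
    and "flat_chain B U A K j F f" "\<And>g. g \<in> F j \<Longrightarrow> Ck k U g" "card B \<le> j + k + 1"
  shows "negligible (f ` A)"
  using assms
proof (induction "card B" arbitrary: B U A K j F f k rule: less_induct)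
  case less
  note outer = less.hyps
  show ?case
    using less.prems
  proof (induction k arbitrary: U A K j F f)
    case 0
    show ?case
      by (rule negligible_image_flat_chain[OF 0(1-6)]) (use 0(7,8) in auto)
  next
    case (Suc k)
    note U = Suc.prems(1,2) and B = Suc.prems(3,4) and K = Suc.prems(5) and ch = Suc.prems(6)
      and smooth = Suc.prems(7) and card = Suc.prems(8)
    have "\<exists>g'. (\<forall>x\<in>U. GDERIV g x :> g' x) \<and> (\<forall>b\<in>Basis. Ck k U (\<lambda>x. g' x \<bullet> b))" if "g \<in> F j" for g
      using smooth[OF that] by simp
    then obtain D where D: "\<And>g x. g \<in> F j \<Longrightarrow> x \<in> U \<Longrightarrow> GDERIV g x :> D g x"
        "\<And>g b. g \<in> F j \<Longrightarrow> b \<in> Basis \<Longrightarrow> Ck k U (\<lambda>x. D g x \<bullet> b)" by metis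
    have finF: "finite (F j)" using ch by (simp add: flat_chain_def)
    have finB: "finite B" using B(1) finite_Basis by (rule finite_subset)
    define A0 where "A0 = {x\<in>A. \<forall>g\<in>F j. \<forall>b\<in>B. D g x \<bullet> b = 0}"
    define H where "H = (\<lambda>(g, b) x. D g x \<bullet> b) ` (F j \<times> B)"
    define F' where "F' = F(Suc j := H)"
    have "negligible (f ` A0)"
    \<comment> \<open>The new links hold with constant 1, as the new family consists of the
      derivatives themselves; \<open>max K 1\<close> serves the old links too.\<close>
    proof (rule Suc.IH[where U = U and K = "max K 1" and j = "Suc j" and F = F'])
      show "flat_chain B U A0 (max K 1) (Suc j) F' f"
        unfolding flat_chain_def
      proof (intro conjI allI impI ballI)
        show "dominated B U (max K 1) f (F' 0)"
          using ch dominated_mono[of B U K f "F 0" B U "max K 1"] by (auto simp: flat_chain_def F'_def)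
        fix i g assume i: "i < Suc j" and g: "g \<in> F' i"
        show "dominated B U (max K 1) g (F' (Suc i))"
        proof (cases "i = j")
          case False
          then have "dominated B U K g (F (Suc i))" using i g ch by (auto simp: flat_chain_def F'_def)
          then show ?thesis using False i dominated_mono[of B U K g "F (Suc i)" B U "max K 1"]
            by (auto simp: F'_def)
        next
          case True
          then have gF: "g \<in> F j" using g by (auto simp: F'_def)
          have "\<bar>D g x \<bullet> c\<bar> \<le> max K 1 * s"
            if "x \<in> U" "s \<ge> 0" "\<forall>h\<in>H. \<bar>h x\<bar> \<le> s" "c \<in> B" for x s c
          proof -
            have "(\<lambda>x. D g x \<bullet> c) \<in> H" using gF that(4) by (auto simp: H_def)
            from bspec[OF that(3) this] have "\<bar>D g x \<bullet> c\<bar> \<le> s" .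
            also have "\<dots> \<le> max K 1 * s" using mult_right_mono[of 1 "max K 1" s] that(2) by simp
            finally show ?thesis .
          qed
          then show ?thesis unfolding dominated_def using D(1)[OF gF] True
            by (auto simp: F'_def intro!: exI[of _ "D g"])
        qed
      next
        fix i assume i: "i \<le> Suc j"
        have "finite H" using finF finB by (simp add: H_def)
        then show "finite (F' i)" using i ch by (cases "i = Suc j") (auto simp: F'_def flat_chain_def)
        fix g x assume g: "g \<in> F' i" and x: "x \<in> A0"
        show "g x = 0"
        proof (cases "i = Suc j")
          case True
          then show ?thesis using g x by (auto simp: F'_def H_def A0_def)
        next
          case False
          then have "i \<le> j" "g \<in> F i" using i g by (auto simp: F'_def)
          then show ?thesis using ch x by (auto simp: flat_chain_def A0_def)
        qed
      qed
      show "Ck k U g" if "g \<in> F' (Suc j)" for g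
        using that D(2) B(1) by (auto simp: F'_def H_def)
    qed (use U B K card in \<open>auto simp: A0_def\<close>)
    moreover have "negligible (f ` (A - A0))"
    proof (rule negligible_image_locally)
      fix x0 assume "x0 \<in> A - A0"
      then obtain w b where w: "w \<in> F j" and b: "b \<in> B" "D w x0 \<bullet> b \<noteq> 0" and x0: "x0 \<in> A"
        by (auto simp: A0_def)
      have bB: "b \<in> Basis" using b(1) B(1) by blast
      have x0U: "x0 \<in> U" using x0 U by blast
      have contD: "continuous_on U (\<lambda>x. D w x \<bullet> c)" if "c \<in> Basis" for c
        using D(2)[OF w that] by (rule Ck_imp_continuous_on)
      \<comment> \<open>\<open>N1\<close> keeps the derivative of \<open>w\<close> along
        \<open>b\<close> above half its size at \<open>x0\<close>, and \<open>N2\<close> keeps all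
        derivatives of \<open>w\<close> bounded. Together they bound the quotients by
        \<open>M\<close>, as needed for the constant of the transported chain.\<close>
      define q where "q x = (\<Sum>c\<in>Basis. \<bar>D w x \<bullet> c\<bar>) - (\<Sum>c\<in>Basis. \<bar>D w x0 \<bullet> c\<bar>)" for x
      define N1 where "N1 = U \<inter> (\<lambda>x. \<bar>D w x \<bullet> b\<bar>) -` {\<bar>D w x0 \<bullet> b\<bar> / 2<..}"
      define N2 where "N2 = U \<inter> q -` {..<1}"
      have "open N1" unfolding N1_def using U(1)
        by (intro continuous_open_preimage continuous_on_rabs contD bB) auto
      moreover have "open N2" unfolding N2_def q_def using U(1)
        by (intro continuous_open_preimage continuous_on_diff continuous_on_sum continuous_on_rabs
            contD continuous_on_const) auto
      ultimately have "open (N1 \<inter> N2)" by blast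
      moreover have "x0 \<in> N1 \<inter> N2" using x0U b(2) by (simp add: N1_def N2_def q_def)
      ultimately obtain r where r: "r > 0" "ball x0 r \<subseteq> N1 \<inter> N2" using open_contains_ball by blast
      define N where "N = ball x0 r"
      have NU: "N \<subseteq> U" using r by (auto simp: N_def N1_def)
      define M where "M = ((\<Sum>c\<in>Basis. \<bar>D w x0 \<bullet> c\<bar>) + 1) / (\<bar>D w x0 \<bullet> b\<bar> / 2)"
      have M0: "M \<ge> 0" unfolding M_def by (intro divide_nonneg_nonneg add_nonneg_nonneg sum_nonneg) auto
      have nz: "D w x \<bullet> b \<noteq> 0" if "x \<in> N" for x
      proof -
        have "\<bar>D w x0 \<bullet> b\<bar> / 2 < \<bar>D w x \<bullet> b\<bar>" using that r by (auto simp: N_def N1_def)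
        then show ?thesis by auto
      qed
      have ratio: "\<bar>D w x \<bullet> c\<bar> / \<bar>D w x \<bullet> b\<bar> \<le> M" if "x \<in> N" "c \<in> Basis" for x c
      proof -
        have 1: "\<bar>D w x0 \<bullet> b\<bar> / 2 \<le> \<bar>D w x \<bullet> b\<bar>" "q x \<le> 1"
          using that r by (force simp: N_def N1_def N2_def)+
        have "\<bar>D w x \<bullet> c\<bar> \<le> (\<Sum>c\<in>Basis. \<bar>D w x \<bullet> c\<bar>)"
          using that by (intro member_le_sum) auto
        also have "\<dots> \<le> (\<Sum>c\<in>Basis. \<bar>D w x0 \<bullet> c\<bar>) + 1" using 1 by (simp add: q_def)
        finally show ?thesis unfolding M_def using 1 b(2) by (intro frac_le) auto
      qed
      define \<Phi> where "\<Phi> = (\<lambda>x. x + (w x - x \<bullet> b) *\<^sub>R b)"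
      obtain \<Psi> where ope: "open (\<Phi> ` N)" and inv: "\<And>x. x \<in> N \<Longrightarrow> \<Psi> (\<Phi> x) = x"
        and der: "\<And>u u' x. x \<in> N \<Longrightarrow> GDERIV u x :> u' \<Longrightarrow>
           GDERIV (\<lambda>y. u (\<Psi> y)) (\<Phi> x) :> u' + ((u' \<bullet> b) / (D w x \<bullet> b)) *\<^sub>R (b - D w x)"
        unfolding \<Phi>_def
        by (rule straighten_level_set[of N b w "D w"]) (use bB D(1)[OF w] NU nz in \<open>auto simp: N_def\<close>)
      \<comment> \<open>Applied to coordinate functions, \<open>der\<close> shows that each
        component of \<open>\<Psi>\<close> is differentiable.\<close>
      have cont\<Psi>: "continuous_on (\<Phi> ` N) \<Psi>"
      proof -
        have "continuous_on (\<Phi> ` N) (\<lambda>y. \<Psi> y \<bullet> c)" for c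
        proof (rule GDERIV_continuous_on)
          fix y assume "y \<in> \<Phi> ` N"
          then obtain x where x: "x \<in> N" "y = \<Phi> x" by blast
          have "GDERIV (\<lambda>x. x \<bullet> c) x :> c" by (auto simp: gderiv_def intro!: derivative_eq_intros)
          from der[OF x(1) this] show "GDERIV (\<lambda>y. \<Psi> y \<bullet> c) y :>
              c + ((c \<bullet> b) / (D w (\<Psi> y) \<bullet> b)) *\<^sub>R (b - D w (\<Psi> y))" using x inv by simp
        qed
        then show ?thesis by (subst continuous_on_componentwise) auto
      qed
      \<comment> \<open>A transported derivative along \<open>c\<close> is the old one minus the old
        one along \<open>b\<close> times a quotient bounded by \<open>M\<close>, hence the factor
        \<open>1 + M\<close>.\<close>
      define K' where "K' = K * (1 + M)"
      have dom\<Psi>: "dominated (B - {b}) (\<Phi> ` N) K' (\<lambda>y. g (\<Psi> y)) ((\<lambda>h y. h (\<Psi> y)) ` H')"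
        if "dominated B U K g H'" for g H'
      proof -
        obtain g' where g': "\<And>x. x \<in> U \<Longrightarrow> GDERIV g x :> g' x"
            "\<And>x s c. x \<in> U \<Longrightarrow> s \<ge> 0 \<Longrightarrow> \<forall>h\<in>H'. \<bar>h x\<bar> \<le> s \<Longrightarrow> c \<in> B \<Longrightarrow> \<bar>g' x \<bullet> c\<bar> \<le> K * s"
          using \<open>dominated B U K g H'\<close> unfolding dominated_def by blast
        define E where "E x = g' x + ((g' x \<bullet> b) / (D w x \<bullet> b)) *\<^sub>R (b - D w x)" for x
        have "\<bar>E x \<bullet> c\<bar> \<le> K' * s"
          if "x \<in> N" "s \<ge> 0" "\<forall>h\<in>H'. \<bar>h x\<bar> \<le> s" "c \<in> B - {b}" for x s c
        proof -
          have cb: "c \<in> Basis" "b \<bullet> c = 0" using that(4) B(1) bB by (auto simp: inner_not_same_Basis)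
          have "E x \<bullet> c = g' x \<bullet> c - (g' x \<bullet> b) * ((D w x \<bullet> c) / (D w x \<bullet> b))"
            using cb by (simp add: E_def inner_add_left inner_diff_left)
          also have "\<bar>\<dots>\<bar> \<le> \<bar>g' x \<bullet> c\<bar> + \<bar>g' x \<bullet> b\<bar> * (\<bar>D w x \<bullet> c\<bar> / \<bar>D w x \<bullet> b\<bar>)"
            by (metis abs_triangle_ineq4 abs_mult abs_divide)
          also have "\<dots> \<le> K * s + (K * s) * M"
            using g'(2)[OF subsetD[OF NU that(1)] that(2,3)] that b(1) K ratio[OF that(1) cb(1)]
            by (intro add_mono mult_mono) auto
          also have "\<dots> = K' * s" by (simp add: K'_def algebra_simps)
          finally show ?thesis .
        qed
        moreover have "GDERIV (\<lambda>y. g (\<Psi> y)) (\<Phi> x) :> E (\<Psi> (\<Phi> x))" if "x \<in> N" for x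
          using der[OF that g'(1)] that NU inv by (auto simp: E_def)
        ultimately show ?thesis unfolding dominated_def
          by (intro exI[of _ "\<lambda>y. E (\<Psi> y)"]) (auto simp: inv)
      qed
      define F'' where "F'' i = (\<lambda>h y. h (\<Psi> y)) ` F i" for i
      \<comment> \<open>\<open>w\<close> belongs to the last family and so vanishes on
        \<open>A\<close>: there the change of coordinates just erases the
        \<open>b\<close>-coordinate.\<close>
      have \<Phi>A: "\<Phi> x = x - (x \<bullet> b) *\<^sub>R b" if "x \<in> A" for x
      proof -
        have "w x = 0" using ch w that unfolding flat_chain_def by blast
        then show ?thesis by (simp add: \<Phi>_def)
      qed
      have "negligible ((\<lambda>y. f (\<Psi> y)) ` (\<Phi> ` (A \<inter> N)))"
      \<comment> \<open>\<open>j\<close> and the order of smoothness stay the same: the chain is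
        moved by composition, and nothing in it is differentiated anew.\<close>
      proof (rule outer[where B = "B - {b}" and U = "\<Phi> ` N" and K = K' and F = F'' and j = j and k = "Suc k"])
        show "card (B - {b}) < card B" using b(1) finB by (rule card_Diff1_less[rotated])
        show "card (B - {b}) \<le> j + Suc k + 1" using card card_Diff1_le[of B b] by linarith
        show "\<Phi> ` (A \<inter> N) \<subseteq> span (B - {b})"
        proof (rule image_subsetI)
          fix x assume x: "x \<in> A \<inter> N"
          have "(x - (x \<bullet> b) *\<^sub>R b) \<bullet> i = 0" if "i \<in> Basis" "i \<notin> B - {b}" for i
          proof (cases "i = b")
            case True
            then show ?thesis using bB by (simp add: inner_diff_left)
          next
            case False
            moreover have "x \<bullet> i = 0" using x B that False by (auto simp: span_substd_basis)
            ultimately show ?thesis using bB that by (simp add: inner_diff_left inner_not_same_Basis)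
          qed
          moreover have "B - {b} \<subseteq> Basis" using B by blast
          ultimately show "\<Phi> x \<in> span (B - {b})"
            using \<Phi>A x by (simp add: span_substd_basis)
        qed
        show "flat_chain (B - {b}) (\<Phi> ` N) (\<Phi> ` (A \<inter> N)) K' j F'' (\<lambda>y. f (\<Psi> y))"
          unfolding flat_chain_def
        proof (intro conjI allI impI ballI)
          show "dominated (B - {b}) (\<Phi> ` N) K' (\<lambda>y. f (\<Psi> y)) (F'' 0)"
            unfolding F''_def by (rule dom\<Psi>) (use ch in \<open>simp add: flat_chain_def\<close>)
          fix i g assume "i < j" "g \<in> F'' i"
          then show "dominated (B - {b}) (\<Phi> ` N) K' g (F'' (Suc i))"
            using ch dom\<Psi> unfolding F''_def flat_chain_def by auto
        next
          fix i assume i: "i \<le> j"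
          then show "finite (F'' i)" using ch by (simp add: flat_chain_def F''_def)
          fix g x assume "g \<in> F'' i" "x \<in> \<Phi> ` (A \<inter> N)"
          then show "g x = 0" using ch i inv by (auto simp: flat_chain_def F''_def)
        qed
        show "Ck (Suc k) (\<Phi> ` N) g" if "g \<in> F'' j" for g
        proof -
          obtain u where u: "u \<in> F j" "g = (\<lambda>y. u (\<Psi> y))" using \<open>g \<in> F'' j\<close> by (auto simp: F''_def)
          have "Ck (Suc k) N u" using smooth[OF u(1)] NU by (rule Ck_subset)
          then show ?thesis unfolding u(2)
            by (rule Ck_straighten[where w' = "D w", OF inv der bB cont\<Psi> Ck_subset[OF D(2)[OF w] NU] nz, rotated -1])
              auto
        qed
      qed (use ope B M0 K in \<open>auto simp: K'_def\<close>)
      moreover have "(\<lambda>y. f (\<Psi> y)) ` (\<Phi> ` (A \<inter> N)) = f ` (A \<inter> N)"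
        using inv by (force simp: image_image)
      ultimately have "negligible (f ` ((A - A0) \<inter> N))"
        using negligible_subset[of "f ` (A \<inter> N)" "f ` ((A - A0) \<inter> N)"] by auto
      then show "\<exists>N. open N \<and> x0 \<in> N \<and> negligible (f ` ((A - A0) \<inter> N))"
        using r by (intro exI[of _ N]) (auto simp: N_def)
    qed
    ultimately have "negligible (f ` A0 \<union> f ` (A - A0))" by (rule negligible_Un)
    moreover have "f ` A = f ` A0 \<union> f ` (A - A0)" by (auto simp: A0_def)
    ultimately show ?case by simp
  qed
qed

text \<open>The partial derivatives form a chain with \<open>j = 0\<close> and smoothness one less
  than the dimension, so the condition \<open>card B \<le> j + k + 1\<close> holds with equality.
  This is where the order of differentiability of \<open>f\<close> is spent.\<close>

theorem Morse_Sard: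
  fixes f :: "'a::euclidean_space \<Rightarrow> real"
  assumes "Ck DIM('a) UNIV f" and f': "\<And>x. GDERIV f x :> f' x"
  shows "negligible (f ` {x. f' x = 0})"
proof -
  obtain k where k: "DIM('a) = Suc k" using DIM_positive[where 'a='a] by (cases "DIM('a)") auto
  obtain g where g: "\<And>x. GDERIV f x :> g x" "\<And>b. b \<in> Basis \<Longrightarrow> Ck k UNIV (\<lambda>x. g x \<bullet> b)"
    using assms(1) unfolding k by auto
  have gf': "g x = f' x" for x
    using g(1)[of x] f'[of x] grad_eqI by metis
  define F where "F = (\<lambda>i::nat. (\<lambda>b x. g x \<bullet> b) ` Basis)"
  show ?thesis
  proof (rule negligible_image_flat_chain_Ck[where U = UNIV and B = Basis and K = 1 and j = 0 and k = k and F = F])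
    have "\<bar>g x \<bullet> c\<bar> \<le> 1 * s" if "\<forall>h\<in>F 0. \<bar>h x\<bar> \<le> s" "c \<in> Basis" for x s c
      using that by (auto simp: F_def)
    then show "flat_chain Basis UNIV {x. f' x = 0} 1 0 F f"
      using g(1) gf' unfolding flat_chain_def dominated_def
      by (auto intro!: exI[of _ g] simp: F_def)
    show "\<And>h. h \<in> F 0 \<Longrightarrow> Ck k UNIV h" using g(2) by (auto simp: F_def)
  qed (use k in auto)
qed

section \<open>Paths of perturbed gradient descent\<close>

text \<open>The mean value theorem yields the factor \<open>L\<close> instead of
  \<open>L / 2\<close>; the constant is immaterial, since every error built from this bound is made
  arbitrarily small.\<close>

lemma GDERIV_Lipschitz_bound:
  fixes f :: "'a::euclidean_space \<Rightarrow> real"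
  assumes grad: "\<And>y. GDERIV f y :> g y"
    and L: "L \<ge> 0" "\<And>y y'. norm (g y' - g y) \<le> L * norm (y' - y)"
  shows "\<bar>f y - f x - (y - x) \<bullet> g x\<bar> \<le> L * (norm (y - x))\<^sup>2"
proof -
  obtain t where t: "0 < t" "t < 1" "f y - f x = (y - x) \<bullet> g (x + t *\<^sub>R (y - x))"
    using GDERIV_MVT[of f x y g] grad by blast
  have "\<bar>(y - x) \<bullet> (g (x + t *\<^sub>R (y - x)) - g x)\<bar> \<le>
      norm (y - x) * norm (g (x + t *\<^sub>R (y - x)) - g x)" by (rule Cauchy_Schwarz_ineq2)
  also have "\<dots> \<le> norm (y - x) * (L * norm (y - x))"
  proof (intro mult_left_mono)
    have "norm (g (x + t *\<^sub>R (y - x)) - g x) \<le> L * (\<bar>t\<bar> * norm (y - x))"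
      using L(2)[of "x + t *\<^sub>R (y - x)" x] by simp
    also have "\<dots> \<le> L * (1 * norm (y - x))" using t L(1) by (intro mult_left_mono mult_right_mono) auto
    finally show "norm (g (x + t *\<^sub>R (y - x)) - g x) \<le> L * norm (y - x)" by simp
  qed simp
  finally show ?thesis using t(3) by (simp add: inner_diff_right power2_eq_square mult_ac)
qed

lemma Lipschitz_continuous_on_UNIV:
  fixes g :: "'a::real_normed_vector \<Rightarrow> 'b::real_normed_vector"
  assumes L: "L \<ge> 0" "\<And>y y'. norm (g y' - g y) \<le> L * norm (y' - y)"
  shows "continuous_on UNIV g"
proof (rule continuous_onI)
  fix y :: 'a and e :: real assume e: "e > 0"
  have "dist (g y') (g y) \<le> e" if "dist y' y < e / (L + 1)" for y'
  proof -
    have "dist (g y') (g y) \<le> L * norm (y' - y)" using L(2) by (simp add: dist_norm)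
    also have "\<dots> \<le> (L + 1) * dist y' y" using L(1) by (simp add: dist_norm algebra_simps)
    also have "\<dots> \<le> e" using that L(1) by (simp add: pos_less_divide_eq mult.commute)
    finally show ?thesis .
  qed
  then show "\<exists>d>0. \<forall>x'\<in>UNIV. dist x' y < d \<longrightarrow> dist (g x') (g y) \<le> e"
    using e L(1) by (intro exI[of _ "e / (L + 1)"]) auto
qed

text \<open>One fixed sample path. Probability survives only in \<open>noise\<close>, which speaks
  of windows of length at most \<open>T\<close> because the full series may diverge. The rest of the
  locale is deterministic.\<close>

locale noisy_gradient_path =
  fixes f :: "'a::euclidean_space \<Rightarrow> real" and g :: "'a \<Rightarrow> 'a"
    and x z :: "nat \<Rightarrow> 'a" and \<gamma> :: "nat \<Rightarrow> real" and G L T \<epsilon>\<^sub>0 :: real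
  assumes grad: "\<And>y. GDERIV f y :> g y"
    and G: "G \<ge> 0" "\<And>y. norm (g y) \<le> G"
    and L: "L \<ge> 0" "\<And>y y'. norm (g y' - g y) \<le> L * norm (y' - y)"
    and path_step: "\<And>n. n \<ge> 1 \<Longrightarrow> x (Suc n) = x n - \<gamma> n *\<^sub>R (g (x n) + z n)"
    and \<gamma>_pos: "\<And>n. n \<ge> 1 \<Longrightarrow> \<gamma> n > 0"
    and \<gamma>_lim: "\<gamma> \<longlonglongrightarrow> 0"
    and \<gamma>_sum: "\<not> summable \<gamma>"
    and T: "T > 0"
    and noise: "\<And>e. e > 0 \<Longrightarrow> \<exists>N\<ge>1. \<forall>n\<ge>N. \<forall>m\<ge>n.
      (\<Sum>i\<in>{n..<m}. \<gamma> i) \<le> T \<longrightarrow> norm (\<Sum>i\<in>{n..<m}. \<gamma> i *\<^sub>R z i) \<le> e"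
    and sublevel: "\<And>c. bounded {y. f y \<le> c}"
    and \<epsilon>\<^sub>0: "\<epsilon>\<^sub>0 > 0" "bounded {y. norm (g y) \<le> \<epsilon>\<^sub>0}"
    and sard: "negligible (f ` {y. g y = 0})"
begin

lemma f_Lipschitz: "\<bar>f y - f y'\<bar> \<le> G * norm (y - y')"
proof -
  obtain t where "f y - f y' = (y - y') \<bullet> g (y' + t *\<^sub>R (y - y'))"
    using GDERIV_MVT[of f y' y g] grad by blast
  also have "\<bar>\<dots>\<bar> \<le> norm (y - y') * norm (g (y' + t *\<^sub>R (y - y')))" by (rule Cauchy_Schwarz_ineq2)
  also have "\<dots> \<le> norm (y - y') * G" using G by (intro mult_left_mono) auto
  finally show ?thesis by (simp add: mult.commute)
qed

lemma continuous_f: "continuous_on UNIV f"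
  using grad by (rule GDERIV_continuous_on)

lemma continuous_g: "continuous_on UNIV g"
  using L by (rule Lipschitz_continuous_on_UNIV)

lemma compact_sublevel: "compact {y. f y \<le> c}"
proof -
  have "closed {y. f y \<le> c}"
    using continuous_f by (intro closed_Collect_le continuous_intros) auto
  with sublevel show ?thesis by (simp add: compact_eq_bounded_closed)
qed

lemma f_bounded_below: "\<exists>B. \<forall>y. B \<le> f y"
proof -
  obtain y0 where "\<forall>y\<in>{y. f y \<le> f 0}. f y0 \<le> f y"
    using continuous_attains_inf[OF compact_sublevel[of "f 0"], of f]
      continuous_on_subset[OF continuous_f] by fastforce
  then have "min (f y0) (f 0) \<le> f y" for y by (cases "f y \<le> f 0") auto
  then show ?thesis by blast
qed

section \<open>Windows in the time scale of the step sizes\<close>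

definition \<tau> :: "nat \<Rightarrow> nat \<Rightarrow> real" where "\<tau> n m = (\<Sum>i\<in>{n..<m}. \<gamma> i)"

lemma \<tau>_mono: "n \<ge> 1 \<Longrightarrow> m \<le> m' \<Longrightarrow> \<tau> n m \<le> \<tau> n m'"
  unfolding \<tau>_def using \<gamma>_pos by (intro sum_mono2) (force intro: less_imp_le)+

lemma \<tau>_Suc: "n \<le> m \<Longrightarrow> \<tau> n (Suc m) = \<tau> n m + \<gamma> m"
  by (simp add: \<tau>_def)

lemma \<gamma>_small: "e > 0 \<Longrightarrow> \<exists>N\<ge>1. \<forall>n\<ge>N. \<gamma> n \<le> e"
proof -
  assume "e > 0"
  then obtain N where "\<forall>n\<ge>N. \<bar>\<gamma> n\<bar> < e"
    using \<gamma>_lim by (auto simp: lim_sequentially dist_real_def)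
  then show ?thesis by (intro exI[of _ "max 1 N"]) (auto simp: abs_less_iff less_imp_le)
qed

lemma \<tau>_unbounded: "\<exists>m\<ge>n. \<tau> n m > c"
proof (rule ccontr)
  assume *: "\<not> ?thesis"
  let ?n = "max n 1"
  have b: "\<tau> n m \<le> c" if "m \<ge> n" for m using * that by force
  have "summable (\<lambda>i. \<gamma> (i + ?n))"
  proof (rule bounded_imp_summable)
    show "\<gamma> (i + ?n) \<ge> 0" for i using less_imp_le[OF \<gamma>_pos[of "i + ?n"]] by simp
    fix k
    have "(\<Sum>i\<le>k. \<gamma> (i + ?n)) = \<tau> ?n (Suc k + ?n)"
      using sum.shift_bounds_nat_ivl[of \<gamma> 0 ?n "Suc k"]
      unfolding \<tau>_def by (simp only: add_0 atLeast0LessThan lessThan_Suc_atMost)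
    \<comment> \<open>Indices start at 1, so the sign of \<open>\<gamma> 0\<close> is unknown and a
      window starting at 0 needs its own case.\<close>
    also have "\<dots> \<le> c + \<bar>\<gamma> 0\<bar>"
    proof (cases "n = 0")
      case True
      have "\<tau> 0 (Suc k + 1) = \<gamma> 0 + \<tau> 1 (Suc k + 1)"
        unfolding \<tau>_def by (subst sum.atLeast_Suc_lessThan) auto
      then show ?thesis using b[of "Suc k + 1"] True by (simp add: max_def)
    next
      case False
      then have "?n = n" by simp
      then show ?thesis using b[of "Suc k + n"] by simp
    qed
    finally show "(\<Sum>i\<le>k. \<gamma> (i + ?n)) \<le> c + \<bar>\<gamma> 0\<bar>" .
  qed
  then show False using \<gamma>_sum by (simp only: summable_iff_shift)
qed

text \<open>Steps are eventually at most \<open>h / 2\<close>, so the first passage over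
  \<open>h / 2\<close> cannot overshoot \<open>h\<close>.\<close>

lemma window_exists:
  assumes "h > 0"
  shows "\<exists>N\<ge>1. \<forall>n\<ge>N. \<exists>m>n. h / 2 \<le> \<tau> n m \<and> \<tau> n m \<le> h"
proof -
  obtain N where N: "N \<ge> 1" "\<And>n. n \<ge> N \<Longrightarrow> \<gamma> n \<le> h / 2" using \<gamma>_small[of "h / 2"] assms by auto
  have "\<exists>m>n. h / 2 \<le> \<tau> n m \<and> \<tau> n m \<le> h" if n: "n \<ge> N" for n
  proof -
    define m where "m = (LEAST m. h / 2 \<le> \<tau> n m)"
    have ex: "\<exists>m. h / 2 \<le> \<tau> n m" using \<tau>_unbounded[of n "h / 2"] by (auto intro: less_imp_le)
    have m: "h / 2 \<le> \<tau> n m" unfolding m_def by (rule LeastI_ex[OF ex])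
    have "m > n" using m assms by (cases "m > n") (auto simp: \<tau>_def)
    then obtain k where k: "m = Suc k" "k \<ge> n" by (cases m) auto
    have "\<tau> n k < h / 2" using not_less_Least[of k "\<lambda>m. h / 2 \<le> \<tau> n m"] k unfolding m_def by force
    then have "\<tau> n m \<le> h" using N(2)[of k] n k by (simp add: \<tau>_Suc)
    with m \<open>m > n\<close> show ?thesis by blast
  qed
  with N show ?thesis by blast
qed

lemma window_move:
  assumes "e > 0"
  shows "\<exists>N\<ge>1. \<forall>n\<ge>N. \<forall>m\<ge>n. \<tau> n m \<le> T \<longrightarrow> norm (x m - x n) \<le> G * \<tau> n m + e"
proof -
  obtain N where N: "N \<ge> 1" "\<And>n m. n \<ge> N \<Longrightarrow> m \<ge> n \<Longrightarrow> \<tau> n m \<le> T \<Longrightarrow>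
      norm (\<Sum>i\<in>{n..<m}. \<gamma> i *\<^sub>R z i) \<le> e" using noise[OF assms] unfolding \<tau>_def by blast
  have "norm (x m - x n) \<le> G * \<tau> n m + e" if n: "n \<ge> N" and m: "m \<ge> n" "\<tau> n m \<le> T" for n m
  proof -
    have eq: "x m - x n = - (\<Sum>i\<in>{n..<m}. \<gamma> i *\<^sub>R g (x i)) - (\<Sum>i\<in>{n..<m}. \<gamma> i *\<^sub>R z i)"
      using m(1)
    proof (induction m rule: dec_induct)
      case (step k)
      have "x (Suc k) - x n = (x k - x n) - \<gamma> k *\<^sub>R g (x k) - \<gamma> k *\<^sub>R z k"
        using step(1) n N(1) path_step[of k] by (simp add: scaleR_add_right)
      then show ?case unfolding step.IH using step(1) by simp
    qed simp
    have "norm (\<Sum>i\<in>{n..<m}. \<gamma> i *\<^sub>R g (x i)) \<le> (\<Sum>i\<in>{n..<m}. norm (\<gamma> i *\<^sub>R g (x i)))"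
      by (rule norm_sum)
    also have "\<dots> \<le> (\<Sum>i\<in>{n..<m}. \<gamma> i * G)"
    proof (rule sum_mono)
      fix i assume "i \<in> {n..<m}"
      then have "\<gamma> i > 0" using \<gamma>_pos n N(1) by auto
      then show "norm (\<gamma> i *\<^sub>R g (x i)) \<le> \<gamma> i * G" using G by simp
    qed
    also have "\<dots> = G * \<tau> n m" by (simp add: \<tau>_def sum_distrib_left mult.commute)
    finally have "norm (\<Sum>i\<in>{n..<m}. \<gamma> i *\<^sub>R g (x i)) \<le> G * \<tau> n m" .
    moreover have "norm (x m - x n) \<le>
        norm (\<Sum>i\<in>{n..<m}. \<gamma> i *\<^sub>R g (x i)) + norm (\<Sum>i\<in>{n..<m}. \<gamma> i *\<^sub>R z i)"
      unfolding eq by (metis norm_triangle_ineq4 norm_minus_cancel)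
    ultimately show ?thesis using N(2)[OF n m] by linarith
  qed
  with N(1) show ?thesis by blast
qed

text \<open>
  Adding the accumulated noise back to the iterates gives a sequence of exact gradient steps
  evaluated at slightly wrong points; \<open>f\<close> is compared along that sequence.
\<close>

lemma window_descent:
  assumes "e > 0"
  shows "\<exists>N\<ge>1. \<forall>n\<ge>N. \<forall>m\<ge>n. \<tau> n m \<le> T \<longrightarrow>
    f (x m) + (\<Sum>i\<in>{n..<m}. \<gamma> i * (norm (g (x i)))\<^sup>2) \<le> f (x n) + e"
proof -
  \<comment> \<open>The summand \<open>T * (G * L + L * G\<^sup>2)\<close> is the error accumulated
    in time \<open>T\<close>, \<open>G\<close> is the price of returning from \<open>y m\<close> to
    \<open>x m\<close>, and 1 makes \<open>C\<close> positive.\<close>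
  define C where "C = T * (G * L + L * G\<^sup>2) + G + 1"
  have C: "C > 0" unfolding C_def using T G L
    by (intro add_nonneg_pos add_nonneg_nonneg mult_nonneg_nonneg) auto
  define \<delta> where "\<delta> = e / C"
  have \<delta>: "\<delta> > 0" using assms C by (simp add: \<delta>_def)
  obtain N1 where N1: "N1 \<ge> 1" "\<And>n m. n \<ge> N1 \<Longrightarrow> m \<ge> n \<Longrightarrow> \<tau> n m \<le> T \<Longrightarrow>
      norm (\<Sum>i\<in>{n..<m}. \<gamma> i *\<^sub>R z i) \<le> \<delta>" using noise[OF \<delta>] unfolding \<tau>_def by blast
  obtain N2 where N2: "\<And>n. n \<ge> N2 \<Longrightarrow> \<gamma> n \<le> \<delta>" using \<gamma>_small[OF \<delta>] by blast
  have "f (x m) + (\<Sum>i\<in>{n..<m}. \<gamma> i * (norm (g (x i)))\<^sup>2) \<le> f (x n) + e"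
    if n: "n \<ge> max N1 N2" and m: "m \<ge> n" "\<tau> n m \<le> T" for n m
  proof -
    have n1: "n \<ge> 1" using n N1 by simp
    define S where "S k = (\<Sum>i\<in>{n..<k}. \<gamma> i *\<^sub>R z i)" for k
    define y where "y k = x k + S k" for k
    have S: "norm (S k) \<le> \<delta>" if "n \<le> k" "k \<le> m" for k
      unfolding S_def using N1(2)[of n k] \<tau>_mono[OF n1 that(2)] n m that by simp
    let ?D = "G * L * \<delta> + L * G\<^sup>2 * \<delta>"
    have main: "f (y k) + (\<Sum>i\<in>{n..<k}. \<gamma> i * (norm (g (x i)))\<^sup>2) \<le> f (x n) + \<tau> n k * ?D"
      if "n \<le> k" "k \<le> m" for k
      using that
    proof (induction k rule: dec_induct)
      case base
      then show ?case by (simp add: y_def S_def \<tau>_def)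
    next
      case (step k)
      have k: "k \<ge> 1" "\<gamma> k > 0" "\<gamma> k \<le> \<delta>" using step n n1 \<gamma>_pos N2 by auto
      have ys: "y (Suc k) - y k = - (\<gamma> k *\<^sub>R g (x k))"
        using path_step[OF k(1)] step by (simp add: y_def S_def algebra_simps)
      have "f (y (Suc k)) \<le> f (y k) + (y (Suc k) - y k) \<bullet> g (y k) + L * (norm (y (Suc k) - y k))\<^sup>2"
        using GDERIV_Lipschitz_bound[OF grad L, of "y (Suc k)" "y k"] by linarith
      also have "L * (norm (y (Suc k) - y k))\<^sup>2 \<le> \<gamma> k * (L * G\<^sup>2 * \<delta>)"
      proof -
        have "(norm (y (Suc k) - y k))\<^sup>2 = \<gamma> k * (\<gamma> k * (norm (g (x k)))\<^sup>2)"
          unfolding ys by (simp add: power_mult_distrib power2_eq_square)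
        also have "\<dots> \<le> \<gamma> k * (\<delta> * G\<^sup>2)"
          using k G by (intro mult_mono power_mono) auto
        finally have "L * (norm (y (Suc k) - y k))\<^sup>2 \<le> L * (\<gamma> k * (\<delta> * G\<^sup>2))"
          using L(1) by (rule mult_left_mono)
        then show ?thesis by (simp add: mult_ac)
      qed
      \<comment> \<open>The step uses the gradient at \<open>x k\<close>, the expansion the one at
        \<open>y k\<close>; they differ by at most \<open>L * \<delta>\<close>.\<close>
      also have "(y (Suc k) - y k) \<bullet> g (y k) \<le> - \<gamma> k * (norm (g (x k)))\<^sup>2 + \<gamma> k * (G * L * \<delta>)"
      proof -
        have "(y (Suc k) - y k) \<bullet> g (y k) =
            - \<gamma> k * (norm (g (x k)))\<^sup>2 + \<gamma> k * (g (x k) \<bullet> (g (x k) - g (y k)))"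
          unfolding ys by (simp add: inner_diff_right power2_norm_eq_inner algebra_simps)
        also have "g (x k) \<bullet> (g (x k) - g (y k)) \<le> norm (g (x k)) * norm (g (x k) - g (y k))"
          by (rule norm_cauchy_schwarz)
        also have "\<dots> \<le> G * (L * \<delta>)"
        proof (intro mult_mono)
          have "norm (g (x k) - g (y k)) \<le> L * norm (S k)"
            using L(2)[of "x k" "y k"] by (simp add: y_def norm_minus_commute)
          also have "\<dots> \<le> L * \<delta>" using S[of k] step L(1) by (intro mult_left_mono) auto
          finally show "norm (g (x k) - g (y k)) \<le> L * \<delta>" .
        qed (use G in auto)
        finally show ?thesis using k by (simp add: mult_ac)
      qed
      finally have "f (y (Suc k)) \<le> f (y k) - \<gamma> k * (norm (g (x k)))\<^sup>2 + \<gamma> k * ?D"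
        by (simp add: algebra_simps)
      then show ?case using step by (simp add: \<tau>_Suc algebra_simps)
    qed
    have "f (x m) \<le> f (y m) + G * \<delta>"
    proof -
      have "\<bar>f (x m) - f (y m)\<bar> \<le> G * norm (S m)" using f_Lipschitz[of "x m" "y m"] by (simp add: y_def)
      also have "\<dots> \<le> G * \<delta>" using S[of m] m G(1) by (intro mult_left_mono) auto
      finally show ?thesis by linarith
    qed
    moreover have "\<tau> n m * ?D \<le> T * ?D"
      using m(2) G L \<delta> by (intro mult_right_mono add_nonneg_nonneg mult_nonneg_nonneg) auto
    moreover have "T * ?D + G * \<delta> \<le> C * \<delta>" using \<delta> by (simp add: C_def algebra_simps)
    moreover have "C * \<delta> = e" using C by (simp add: \<delta>_def)
    ultimately show ?thesis using main[of m] m(1) by linarith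
  qed
  with N1(1) show ?thesis by (intro exI[of _ "max N1 N2"]) auto
qed

section \<open>Long-term behaviour of \<open>f\<close> along the path\<close>

lemma window_descent_steep:
  assumes "e > 0" "n \<ge> 1" "\<And>i. n \<le> i \<Longrightarrow> i < m \<Longrightarrow> norm (g (x i)) \<ge> e"
  shows "e\<^sup>2 * \<tau> n m \<le> (\<Sum>i\<in>{n..<m}. \<gamma> i * (norm (g (x i)))\<^sup>2)"
  unfolding \<tau>_def sum_distrib_left
proof (rule sum_mono)
  fix i assume "i \<in> {n..<m}"
  then have "norm (g (x i)) \<ge> e" "\<gamma> i > 0" using assms \<gamma>_pos by auto
  then show "e\<^sup>2 * \<gamma> i \<le> \<gamma> i * (norm (g (x i)))\<^sup>2"
    using assms(1) by (simp add: power_mono mult.commute)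
qed

text \<open>Otherwise every window of length at least \<open>T / 2\<close> would lower
  \<open>f\<close> by a fixed amount, although \<open>f\<close> is bounded below.\<close>

lemma gradient_small_frequently:
  assumes "e > 0"
  shows "\<exists>n\<ge>N. norm (g (x n)) < e"
proof (rule ccontr)
  assume *: "\<not> ?thesis"
  have steep: "norm (g (x n)) \<ge> e" if "n \<ge> N" for n using * that by force
  \<comment> \<open>Half of the guaranteed decrease \<open>e\<^sup>2 * (T / 2)\<close>, so that an
    error \<open>d\<close> leaves a net decrease \<open>d\<close>.\<close>
  define d where "d = e\<^sup>2 * T / 4"
  have d: "d > 0" using assms T by (simp add: d_def)
  obtain N1 where N1: "N1 \<ge> 1" "\<And>n m. n \<ge> N1 \<Longrightarrow> m \<ge> n \<Longrightarrow> \<tau> n m \<le> T \<Longrightarrow>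
    f (x m) + (\<Sum>i\<in>{n..<m}. \<gamma> i * (norm (g (x i)))\<^sup>2) \<le> f (x n) + d" using window_descent[OF d] by blast
  obtain N2 where N2: "\<And>n. n \<ge> N2 \<Longrightarrow> \<exists>m>n. T / 2 \<le> \<tau> n m \<and> \<tau> n m \<le> T"
    using window_exists[OF T] by blast
  define N' where "N' = max N (max N1 N2)"
  have dec: "\<exists>m>n. f (x m) \<le> f (x n) - d" if n: "n \<ge> N'" for n
  proof -
    obtain m where m: "m > n" "T / 2 \<le> \<tau> n m" "\<tau> n m \<le> T" using N2[of n] n by (auto simp: N'_def)
    have "2 * d = e\<^sup>2 * (T / 2)" by (simp add: d_def)
    also have "\<dots> \<le> e\<^sup>2 * \<tau> n m" using m by (intro mult_left_mono) auto
    also have "\<dots> \<le> (\<Sum>i\<in>{n..<m}. \<gamma> i * (norm (g (x i)))\<^sup>2)"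
      using assms steep n N1(1) by (intro window_descent_steep) (auto simp: N'_def)
    finally show ?thesis using N1(2)[of n m] m n by (intro exI[of _ m]) (auto simp: N'_def)
  qed
  have "\<exists>n\<ge>N'. f (x n) \<le> f (x N') - real k * d" for k
  proof (induction k)
    case (Suc k)
    then obtain n where n: "n \<ge> N'" "f (x n) \<le> f (x N') - real k * d" by blast
    from dec[OF n(1)] obtain m where "m > n" "f (x m) \<le> f (x n) - d" by blast
    with n show ?case by (intro exI[of _ m]) (auto simp: algebra_simps)
  qed auto
  moreover obtain B where B: "\<And>y. B \<le> f y" using f_bounded_below by blast
  moreover obtain k where "real k * d > f (x N') - B" using d reals_Archimedean3 by blast
  ultimately show False by (smt (verit))
qed

text \<open>Between the last visit \<open>n'\<close> below \<alpha> and the first passage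
  \<open>m'\<close> above \<beta>, the path stays in the steep slab. If this takes time at most
  \<open>T\<close>, the rise is at most \<open>d\<close>, too little to cross. If it takes longer,
  the descent within time \<open>T\<close> already brings the path back below \<alpha>,
  contradicting the choice of \<open>n'\<close>.\<close>

lemma trap:
  assumes ab: "\<alpha> < \<beta>" and e: "e > 0"
    and steep: "\<And>y. \<alpha> \<le> f y \<Longrightarrow> f y \<le> \<beta> \<Longrightarrow> norm (g y) \<ge> e"
  shows "\<exists>N\<ge>1. \<forall>n\<ge>N. f (x n) \<le> \<alpha> \<longrightarrow> (\<forall>m\<ge>n. f (x m) \<le> \<beta>)"
proof -
  \<comment> \<open>The first bound excludes a crossing within time \<open>T\<close>. The second is
    half of the decrease over time \<open>T / 4\<close>, which is what remains of
    \<open>T / 2\<close> after giving up the step at \<open>n'\<close>.\<close>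
  define d where "d = min ((\<beta> - \<alpha>) / 2) (e\<^sup>2 * T / 8)"
  have d: "d > 0" using assms T by (simp add: d_def)
  obtain N1 where N1: "N1 \<ge> 1" "\<And>n m. n \<ge> N1 \<Longrightarrow> m \<ge> n \<Longrightarrow> \<tau> n m \<le> T \<Longrightarrow>
    f (x m) + (\<Sum>i\<in>{n..<m}. \<gamma> i * (norm (g (x i)))\<^sup>2) \<le> f (x n) + d" using window_descent[OF d] by blast
  obtain N2 where N2: "\<And>n. n \<ge> N2 \<Longrightarrow> \<exists>m>n. T / 2 \<le> \<tau> n m \<and> \<tau> n m \<le> T"
    using window_exists[OF T] by blast
  obtain N3 where N3: "\<And>n. n \<ge> N3 \<Longrightarrow> \<gamma> n \<le> T / 4" using \<gamma>_small[of "T / 4"] T by auto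
  define N where "N = max N1 (max N2 N3)"
  have "f (x m) \<le> \<beta>" if n: "n \<ge> N" "f (x n) \<le> \<alpha>" and m: "m \<ge> n" for n m
  proof (rule ccontr)
    assume "\<not> f (x m) \<le> \<beta>"
    then have mb: "f (x m) > \<beta>" by simp
    define m' where "m' = (LEAST k. k \<ge> n \<and> f (x k) > \<beta>)"
    have ex: "\<exists>k. k \<ge> n \<and> f (x k) > \<beta>" using m mb by blast
    have m': "m' \<ge> n" "f (x m') > \<beta>" using LeastI_ex[OF ex] unfolding m'_def by auto
    have before: "f (x k) \<le> \<beta>" if "n \<le> k" "k < m'" for k
      using not_less_Least[of k "\<lambda>k. k \<ge> n \<and> f (x k) > \<beta>"] that unfolding m'_def by auto
    define n' where "n' = Max {k. n \<le> k \<and> k \<le> m' \<and> f (x k) \<le> \<alpha>}"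
    have fin: "finite {k. n \<le> k \<and> k \<le> m' \<and> f (x k) \<le> \<alpha>}"
      by (rule finite_subset[of _ "{..m'}"]) auto
    have "n \<in> {k. n \<le> k \<and> k \<le> m' \<and> f (x k) \<le> \<alpha>}" using n m' by simp
    then have "n' \<in> {k. n \<le> k \<and> k \<le> m' \<and> f (x k) \<le> \<alpha>}"
      unfolding n'_def using Max_in[OF fin] by blast
    then have n': "n \<le> n'" "n' \<le> m'" "f (x n') \<le> \<alpha>" by auto
    have after: "\<alpha> < f (x k)" if "n' < k" "k \<le> m'" for k
    proof (rule ccontr)
      assume "\<not> ?thesis"
      then have "k \<in> {k. n \<le> k \<and> k \<le> m' \<and> f (x k) \<le> \<alpha>}" using that n' by auto
      then have "k \<le> n'" unfolding n'_def using Max_ge[OF fin] by blast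
      then show False using that by simp
    qed
    have n'N: "n' \<ge> N1" "n' \<ge> N2" "n' \<ge> N3" "n' \<ge> 1" using n n' N1(1) by (auto simp: N_def)
    show False
    proof (cases "\<tau> n' m' \<le> T")
      case True
      have "0 \<le> (\<Sum>i\<in>{n'..<m'}. \<gamma> i * (norm (g (x i)))\<^sup>2)"
      proof (rule sum_nonneg)
        fix i assume "i \<in> {n'..<m'}"
        then have "\<gamma> i > 0" using \<gamma>_pos n'N by auto
        then show "0 \<le> \<gamma> i * (norm (g (x i)))\<^sup>2" by simp
      qed
      then have "f (x m') \<le> \<alpha> + d" using N1(2)[OF n'N(1) n'(2) True] n'(3) by linarith
      also have "\<dots> < \<beta>" using ab by (simp add: d_def min_def field_simps)
      finally show False using m' by simp
    next
      case False
      obtain k where k: "k > n'" "T / 2 \<le> \<tau> n' k" "\<tau> n' k \<le> T" using N2[OF n'N(2)] by blast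
      have "k < m'" using False k(3) \<tau>_mono[OF n'N(4), of m' k] by (cases "k < m'") auto
      \<comment> \<open>The point at \<open>n'\<close> lies below the slab and need not be steep, so
        its step is separated from the sum.\<close>
      have split: "(\<Sum>i\<in>{n'..<k}. h i) = h n' + (\<Sum>i\<in>{Suc n'..<k}. h i)" for h :: "nat \<Rightarrow> real"
        using k(1) by (rule sum.atLeast_Suc_lessThan)
      have "e\<^sup>2 * \<tau> (Suc n') k \<le> (\<Sum>i\<in>{Suc n'..<k}. \<gamma> i * (norm (g (x i)))\<^sup>2)"
      proof (rule window_descent_steep[OF e])
        fix i assume "Suc n' \<le> i" "i < k"
        then show "norm (g (x i)) \<ge> e" using after[of i] before[of i] n' \<open>k < m'\<close>
          by (intro steep) auto
      qed simp
      moreover have "T / 4 \<le> \<tau> (Suc n') k"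
        using k(2) split[of \<gamma>] N3[OF n'N(3)] by (simp add: \<tau>_def)
      then have "e\<^sup>2 * (T / 4) \<le> e\<^sup>2 * \<tau> (Suc n') k" by (intro mult_left_mono) auto
      moreover have "0 \<le> \<gamma> n' * (norm (g (x n')))\<^sup>2" using \<gamma>_pos[OF n'N(4)] by simp
      moreover have "d \<le> e\<^sup>2 * (T / 8)" by (simp add: d_def)
      moreover have "e\<^sup>2 * T > 0" using e T by simp
      ultimately have "f (x k) \<le> \<alpha>"
        using N1(2)[OF n'N(1) less_imp_le[OF k(1)] k(3)] n'(3)
          split[of "\<lambda>i. \<gamma> i * (norm (g (x i)))\<^sup>2"] by (simp add: field_simps)
      with after[of k] k \<open>k < m'\<close> show False by simp
    qed
  qed
  then show ?thesis using N1(1) by (intro exI[of _ N]) (auto simp: N_def)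
qed

text \<open>\<open>f\<close> is at most \<open>c\<close> where the gradient is small, so the region
  above \<open>c + 1\<close> is steep. The path has small gradients infinitely often, and from such
  a time on \<open>trap\<close> keeps it below \<open>c + 2\<close>.\<close>

lemma f_path_bounded: "\<exists>c. \<forall>\<^sub>F n in sequentially. f (x n) \<le> c"
proof -
  obtain r where r: "\<And>y. norm (g y) \<le> \<epsilon>\<^sub>0 \<Longrightarrow> norm y \<le> r"
    using \<epsilon>\<^sub>0(2) unfolding bounded_iff by blast
  define c where "c = f 0 + G * r"
  have c: "f y \<le> c" if "norm (g y) \<le> \<epsilon>\<^sub>0" for y
  proof -
    have "f y - f 0 \<le> G * norm y" using f_Lipschitz[of y 0] by simp
    also have "\<dots> \<le> G * r" using r[OF that] G(1) by (rule mult_left_mono)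
    finally show ?thesis by (simp add: c_def)
  qed
  obtain N where N: "\<And>n m. n \<ge> N \<Longrightarrow> f (x n) \<le> c + 1 \<Longrightarrow> m \<ge> n \<Longrightarrow> f (x m) \<le> c + 2"
  proof -
    have "norm (g y) \<ge> \<epsilon>\<^sub>0" if "c + 1 \<le> f y" for y using c[of y] that by linarith
    then show ?thesis using trap[of "c + 1" "c + 2", OF _ \<epsilon>\<^sub>0(1)] that by auto
  qed
  obtain n where "n \<ge> N" "norm (g (x n)) < \<epsilon>\<^sub>0" using gradient_small_frequently[OF \<epsilon>\<^sub>0(1)] by blast
  then have "\<forall>m\<ge>n. f (x m) \<le> c + 2" using N[of n] c[of "x n"] by auto
  then show ?thesis unfolding eventually_sequentially by blast
qed

text \<open>The null set of critical values misses some \<open>v\<close> in the interval, and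
  compactness of a sublevel set thickens \<open>v\<close> to a slab with a uniform gradient
  bound.\<close>

lemma noncritical_slab:
  assumes "a < b"
  shows "\<exists>\<alpha> \<beta> e. a < \<alpha> \<and> \<alpha> < \<beta> \<and> \<beta> < b \<and> e > 0 \<and>
    (\<forall>y. \<alpha> \<le> f y \<longrightarrow> f y \<le> \<beta> \<longrightarrow> norm (g y) \<ge> e)"
proof -
  have "\<not> negligible {a<..<b}" using assms by (intro open_not_negligible) auto
  then have "\<not> {a<..<b} \<subseteq> f ` {y. g y = 0}" using sard negligible_subset by blast
  then obtain v where "v \<in> {a<..<b}" "v \<notin> f ` {y. g y = 0}" by blast
  then have v: "a < v" "v < b" "\<And>y. f y = v \<Longrightarrow> g y \<noteq> 0" by auto
  define \<eta> where "\<eta> = min (v - a) (b - v) / 2"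
  have \<eta>: "\<eta> > 0" "a < v - \<eta>" "v + \<eta> < b" using v unfolding \<eta>_def by (auto simp: min_def field_simps)
  let ?S = "{y. f y \<le> v + \<eta>}"
  \<comment> \<open>\<open>h\<close> could vanish only at a critical point of value
    \<open>v\<close>, and there is none. Its minimum \<open>\<mu>\<close> serves twice: in a slab of
    half-width below \<open>\<mu>\<close>, the maximum must be the gradient norm.\<close>
  define h where "h y = max \<bar>f y - v\<bar> (norm (g y))" for y
  have hpos: "h y > 0" for y using v(3)[of y] by (auto simp: h_def less_max_iff_disj)
  obtain \<mu> where \<mu>: "\<mu> > 0" "\<And>y. y \<in> ?S \<Longrightarrow> h y \<ge> \<mu>"
  proof (cases "?S = {}")
    case True
    then show ?thesis using that[of 1] by auto
  next
    case False
    have "continuous_on ?S h" unfolding h_def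
      using continuous_on_subset[OF continuous_f] continuous_on_subset[OF continuous_g]
      by (intro continuous_intros) auto
    from continuous_attains_inf[OF compact_sublevel False this] obtain y where "\<forall>y'\<in>?S. h y \<le> h y'" by blast
    then show ?thesis using that[OF hpos[of y]] by blast
  qed
  define \<rho> where "\<rho> = min \<eta> (\<mu> / 2)"
  have \<rho>: "\<rho> > 0" "\<rho> \<le> \<eta>" "\<rho> < \<mu>" using \<eta> \<mu> by (auto simp: \<rho>_def)
  have "norm (g y) \<ge> \<mu>" if "v - \<rho> \<le> f y" "f y \<le> v + \<rho>" for y
    using \<mu>(2)[of y] that \<rho> by (auto simp: h_def max_def abs_le_iff split: if_splits)
  then show ?thesis using \<rho> \<eta> \<mu>(1)
    by (intro exI[of _ "v - \<rho>"] exI[of _ "v + \<rho>"] exI[of _ \<mu>]) auto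
qed

text \<open>\<open>l\<close> is the limes superior, written as the infimum of the eventual upper
  bounds. Infinitely many values below some \<open>a < l\<close> would let a slab between
  \<open>a\<close> and \<open>l\<close> trap the path below \<open>l\<close>.\<close>

lemma f_converges: "\<exists>l. (\<lambda>n. f (x n)) \<longlonglongrightarrow> l"
proof -
  define U where "U = {\<beta>. \<forall>\<^sub>F n in sequentially. f (x n) \<le> \<beta>}"
  obtain B where B: "\<And>y. B \<le> f y" using f_bounded_below by blast
  have Une: "U \<noteq> {}" using f_path_bounded by (auto simp: U_def)
  have "B \<le> \<beta>" if "\<beta> \<in> U" for \<beta>
  proof -
    have "\<forall>\<^sub>F n in sequentially. f (x n) \<le> \<beta>" using that by (simp add: U_def)
    then obtain n where "f (x n) \<le> \<beta>" unfolding eventually_sequentially by blast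
    with B[of "x n"] show ?thesis by simp
  qed
  then have Ubb: "bdd_below U" by (auto simp: bdd_below_def)
  define l where "l = Inf U"
  have "(\<lambda>n. f (x n)) \<longlonglongrightarrow> l"
  proof (rule order_tendstoI)
    fix a assume a: "l < a"
    then obtain \<beta> where "\<beta> \<in> U" "\<beta> < a" unfolding l_def using cInf_lessD[OF Une] by blast
    then show "\<forall>\<^sub>F n in sequentially. f (x n) < a"
      by (auto simp: U_def elim: eventually_mono)
  next
    fix a assume a: "a < l"
    show "\<forall>\<^sub>F n in sequentially. a < f (x n)"
    proof (rule ccontr)
      assume freq: "\<not> ?thesis"
      obtain \<alpha> \<beta> e where *: "a < \<alpha>" "\<alpha> < \<beta>" "\<beta> < l" "e > 0"
          "\<And>y. \<alpha> \<le> f y \<Longrightarrow> f y \<le> \<beta> \<Longrightarrow> norm (g y) \<ge> e" using noncritical_slab[OF a] by blast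
      from trap[OF *(2,4,5)] obtain N where N: "\<And>n. n \<ge> N \<Longrightarrow> f (x n) \<le> \<alpha> \<Longrightarrow> \<forall>m\<ge>n. f (x m) \<le> \<beta>"
        by blast
      obtain n where "n \<ge> N" "f (x n) \<le> a" using freq unfolding eventually_sequentially by (meson not_less)
      then have "\<forall>m\<ge>n. f (x m) \<le> \<beta>" using N[of n] *(1) by simp
      then have "\<beta> \<in> U" unfolding U_def eventually_sequentially by blast
      then have "l \<le> \<beta>" unfolding l_def using Ubb by (rule cInf_lower)
      with *(3) show False by simp
    qed
  qed
  then show ?thesis by blast
qed

text \<open>A large gradient at a late time stays large over a short window, as the path moves
  little and \<open>g\<close> is Lipschitz. The resulting drop of \<open>f\<close> has a fixed size,
  against convergence of \<open>f\<close>.\<close>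

lemma gradient_converges: "(\<lambda>n. g (x n)) \<longlonglongrightarrow> 0"
proof (rule ccontr)
  assume "\<not> ?thesis"
  then obtain e0 where e0: "e0 > 0" "\<And>N. \<exists>n\<ge>N. norm (g (x n)) \<ge> e0"
    unfolding lim_sequentially by (auto simp: not_less)
  define e where "e = e0 / 2"
  have e: "e > 0" using e0 by (simp add: e_def)
  \<comment> \<open>\<open>h\<close> and \<open>e'\<close> share the allowance:
    \<open>L * (G * h)\<close> and \<open>L * e'\<close> each contribute at most half of
    \<open>e\<close>.\<close>
  define h where "h = min T (e / (2 * (L + 1) * (G + 1)))"
  have h: "h > 0" "h \<le> T" using T e L G by (auto simp: h_def)
  \<comment> \<open>The window lowers \<open>f\<close> by \<open>4 * d\<close> up to an error
    \<open>d\<close>, while late values of \<open>f\<close> differ by less than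
    \<open>2 * d\<close>.\<close>
  define d where "d = e\<^sup>2 * h / 8"
  have d: "d > 0" using e h by (simp add: d_def)
  define e' where "e' = e / (2 * (L + 1))"
  have e': "e' > 0" using e L by (simp add: e'_def)
  have small: "L * (G * h + e') \<le> e"
  proof -
    have "G * h \<le> (G + 1) * h" using h by (simp add: algebra_simps)
    also have "\<dots> \<le> (G + 1) * (e / (2 * (L + 1) * (G + 1)))"
      using G by (intro mult_left_mono) (auto simp: h_def)
    also have "\<dots> = e'" using G by (simp add: e'_def)
    finally have "L * (G * h + e') \<le> L * (2 * e')" using L(1) by (intro mult_left_mono) auto
    also have "\<dots> \<le> (L + 1) * (2 * e')" using e' by (intro mult_right_mono) auto
    also have "\<dots> = e" using L(1) by (simp add: e'_def field_simps add_nonneg_eq_0_iff)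
    finally show ?thesis .
  qed
  obtain N1 where N1: "N1 \<ge> 1" "\<And>n m. n \<ge> N1 \<Longrightarrow> m \<ge> n \<Longrightarrow> \<tau> n m \<le> T \<Longrightarrow>
    f (x m) + (\<Sum>i\<in>{n..<m}. \<gamma> i * (norm (g (x i)))\<^sup>2) \<le> f (x n) + d" using window_descent[OF d] by blast
  obtain N2 where N2: "\<And>n. n \<ge> N2 \<Longrightarrow> \<exists>m>n. h / 2 \<le> \<tau> n m \<and> \<tau> n m \<le> h"
    using window_exists[OF h(1)] by blast
  obtain N3 where N3: "\<And>n m. n \<ge> N3 \<Longrightarrow> m \<ge> n \<Longrightarrow> \<tau> n m \<le> T \<Longrightarrow> norm (x m - x n) \<le> G * \<tau> n m + e'"
    using window_move[OF e'] by blast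
  obtain l where "(\<lambda>n. f (x n)) \<longlonglongrightarrow> l" using f_converges by blast
  then obtain N4 where N4: "\<And>n. n \<ge> N4 \<Longrightarrow> \<bar>f (x n) - l\<bar> < d"
    using d by (auto simp: lim_sequentially dist_real_def)
  obtain n where n: "n \<ge> Max {N1, N2, N3, N4}" "norm (g (x n)) \<ge> e0" using e0(2) by blast
  then have nN: "n \<ge> N1" "n \<ge> N2" "n \<ge> N3" "n \<ge> N4" "n \<ge> 1" using N1(1) by auto
  obtain m where m: "m > n" "h / 2 \<le> \<tau> n m" "\<tau> n m \<le> h" using N2[OF nN(2)] by blast
  have "e\<^sup>2 * \<tau> n m \<le> (\<Sum>i\<in>{n..<m}. \<gamma> i * (norm (g (x i)))\<^sup>2)"
  proof (rule window_descent_steep[OF e nN(5)])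
    fix i assume i: "n \<le> i" "i < m"
    have ti: "\<tau> n i \<le> h" using \<tau>_mono[OF nN(5), of i m] i m by simp
    have "norm (g (x i) - g (x n)) \<le> L * norm (x i - x n)" by (rule L(2))
    also have "\<dots> \<le> L * (G * \<tau> n i + e')"
      using N3[OF nN(3) i(1)] ti h L(1) by (intro mult_left_mono) auto
    also have "\<dots> \<le> L * (G * h + e')" using ti G(1) L(1) by (intro mult_left_mono add_mono) auto
    also have "\<dots> \<le> e" by (rule small)
    finally have "norm (g (x i) - g (x n)) \<le> e" .
    moreover have "norm (g (x n)) \<le> norm (g (x i)) + norm (g (x i) - g (x n))"
      by (metis norm_triangle_sub norm_minus_commute)
    ultimately show "norm (g (x i)) \<ge> e" using n(2) by (simp add: e_def)
  qed
  moreover have "e\<^sup>2 * (h / 2) \<le> e\<^sup>2 * \<tau> n m" using m by (intro mult_left_mono) auto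
  moreover have "e\<^sup>2 * (h / 2) = 4 * d" by (simp add: d_def)
  moreover have "f (x m) + (\<Sum>i\<in>{n..<m}. \<gamma> i * (norm (g (x i)))\<^sup>2) \<le> f (x n) + d"
    using N1(2)[of n m] nN m h by auto
  ultimately have "f (x m) \<le> f (x n) - 3 * d" by linarith
  moreover have "\<bar>f (x n) - l\<bar> < d" "\<bar>f (x m) - l\<bar> < d" using N4 nN m by auto
  ultimately show False by linarith
qed

section \<open>The limit set of the path\<close>

lemma steps_vanish: "(\<lambda>n. x (Suc n) - x n) \<longlonglongrightarrow> 0"
  unfolding lim_sequentially
proof (intro allI impI)
  fix e :: real assume e: "e > 0"
  define d where "d = min T (e / (4 * (G + 1)))"
  have d: "d > 0" "d \<le> T" using e T G by (auto simp: d_def)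
  have Gd: "G * d \<le> e / 4"
  proof -
    have "G * d \<le> (G + 1) * d" using d by (simp add: algebra_simps)
    also have "\<dots> \<le> (G + 1) * (e / (4 * (G + 1)))" using G by (intro mult_left_mono) (auto simp: d_def)
    also have "\<dots> = e / 4" using G(1) by (simp add: field_simps add_nonneg_eq_0_iff)
    finally show ?thesis .
  qed
  obtain N1 where N1: "\<And>n. n \<ge> N1 \<Longrightarrow> \<gamma> n \<le> d" using \<gamma>_small[OF d(1)] by blast
  obtain N2 where N2: "\<And>n m. n \<ge> N2 \<Longrightarrow> m \<ge> n \<Longrightarrow> \<tau> n m \<le> T \<Longrightarrow> norm (x m - x n) \<le> G * \<tau> n m + e / 4"
    using window_move[of "e / 4"] e by auto
  have "dist (x (Suc n) - x n) 0 < e" if n: "n \<ge> max N1 N2" for n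
  proof -
    have \<tau>: "\<tau> n (Suc n) = \<gamma> n" by (simp add: \<tau>_def)
    have "norm (x (Suc n) - x n) \<le> G * \<gamma> n + e / 4"
      using N2[of n "Suc n"] N1[of n] n d \<tau> by simp
    also have "G * \<gamma> n \<le> G * d" using N1[of n] n G by (intro mult_left_mono) auto
    finally show ?thesis using Gd e by simp
  qed
  then show "\<exists>N. \<forall>n\<ge>N. dist (x (Suc n) - x n) 0 < e" by blast
qed

lemma constant_on_critical_component:
  assumes "connected C" "C \<subseteq> {y. g y = 0}"
  shows "f constant_on C"
proof (rule ccontr)
  assume "\<not> ?thesis"
  then obtain y y' where y: "y \<in> C" "y' \<in> C" "f y < f y'"
    unfolding constant_on_def by (metis linorder_neqE)
  have "connected (f ` C)"
    using assms(1) continuous_on_subset[OF continuous_f] by (intro connected_continuous_image) auto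
  then have "{f y<..<f y'} \<subseteq> f ` C"
    using connected_contains_Icc[of "f ` C" "f y" "f y'"] y(1,2) by force
  also have "\<dots> \<subseteq> f ` {y. g y = 0}" using assms(2) by blast
  finally have "negligible {f y<..<f y'}" using sard negligible_subset by blast
  moreover have "\<not> negligible {f y<..<f y'}" using y(3) by (intro open_not_negligible) auto
  ultimately show False by blast
qed

text \<open>
  The tails of the polygonal path through the iterates have compact connected closures, whose
  intersection is the limit set.
\<close>

theorem converges_to_critical_component:
  "\<exists>C\<in>components {y. g y = 0}. (\<lambda>n. infdist (x n) C) \<longlonglongrightarrow> 0 \<and> f constant_on C"
proof -
  obtain c N0 where c: "\<And>n. n \<ge> N0 \<Longrightarrow> f (x n) \<le> c"
    using f_path_bounded unfolding eventually_sequentially by blast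
  obtain r where r: "\<And>n. n \<ge> N0 \<Longrightarrow> norm (x n) \<le> r"
    using sublevel[of c] c unfolding bounded_iff by blast
  define S where "S N = (\<Union>n\<in>{N0 + N..}. closed_segment (x n) (x (Suc n)))" for N
  define K where "K N = closure (S N)" for N
  have SN: "S N \<subseteq> cball 0 r" for N
  proof -
    have "closed_segment (x n) (x (Suc n)) \<subseteq> cball 0 r" if "n \<ge> N0" for n
      using r[of n] r[of "Suc n"] that by (intro closed_segment_subset) auto
    then show ?thesis unfolding S_def by (intro UN_least) auto
  qed
  have compK: "compact (K N)" for N
    unfolding K_def using bounded_subset[OF bounded_cball SN] by (simp add: compact_closure)
  have conS: "connected (\<Union>n\<in>{N..N + k}. closed_segment (x n) (x (Suc n)))" for N k
  proof (induction k)
    case (Suc k)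
    have "connected ((\<Union>n\<in>{N..N + k}. closed_segment (x n) (x (Suc n))) \<union>
        closed_segment (x (Suc (N + k))) (x (Suc (Suc (N + k)))))"
    proof (intro connected_Un Suc)
      have "x (Suc (N + k)) \<in> (\<Union>n\<in>{N..N + k}. closed_segment (x n) (x (Suc n)))"
        by (intro UN_I[of "N + k"]) auto
      then show "(\<Union>n\<in>{N..N + k}. closed_segment (x n) (x (Suc n))) \<inter>
          closed_segment (x (Suc (N + k))) (x (Suc (Suc (N + k)))) \<noteq> {}"
        using ends_in_segment(1) by blast
    qed auto
    also have "(\<Union>n\<in>{N..N + k}. closed_segment (x n) (x (Suc n))) \<union>
        closed_segment (x (Suc (N + k))) (x (Suc (Suc (N + k)))) =
        (\<Union>n\<in>{N..N + Suc k}. closed_segment (x n) (x (Suc n)))"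
      by (simp add: atLeastAtMostSuc_conv Un_commute)
    finally show ?case .
  qed simp
  have conK: "connected (K N)" for N
  proof -
    have "S N = (\<Union>k. \<Union>n\<in>{N0 + N..N0 + N + k}. closed_segment (x n) (x (Suc n)))"
    proof (intro set_eqI iffI)
      fix y assume "y \<in> S N"
      then obtain n where "n \<ge> N0 + N" "y \<in> closed_segment (x n) (x (Suc n))" by (auto simp: S_def)
      then show "y \<in> (\<Union>k. \<Union>n\<in>{N0 + N..N0 + N + k}. closed_segment (x n) (x (Suc n)))"
        by (auto intro!: exI[of _ "n - (N0 + N)"] bexI[of _ n])
    qed (auto simp: S_def)
    moreover have "connected \<dots>"
    proof (rule connected_Union)
      have "x (N0 + N) \<in> (\<Union>n\<in>{N0 + N..N0 + N + k}. closed_segment (x n) (x (Suc n)))" for k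
        by (intro UN_I[of "N0 + N"]) auto
      then show "\<Inter> (range (\<lambda>k. \<Union>n\<in>{N0 + N..N0 + N + k}. closed_segment (x n) (x (Suc n)))) \<noteq> {}"
        by blast
    qed (use conS in auto)
    ultimately show ?thesis unfolding K_def by (simp add: connected_imp_connected_closure)
  qed
  have mono: "K n \<subseteq> K m" if "m \<le> n" for m n
    unfolding K_def S_def using that by (intro closure_mono) force
  have xK: "x (N0 + N) \<in> K N" for N
    unfolding K_def S_def by (intro subsetD[OF closure_subset] UN_I[of "N0 + N"]) auto
  define \<Lambda> where "\<Lambda> = \<Inter> (range K)"
  have "\<Lambda> \<noteq> {}" unfolding \<Lambda>_def using xK by (intro compact_nest compK mono) auto
  have "connected \<Lambda>" unfolding \<Lambda>_def by (intro connected_nest compK conK mono)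
  have "\<Lambda> \<subseteq> {y. g y = 0}"
  proof
    fix y assume y: "y \<in> \<Lambda>"
    have le_e: "norm (g y) \<le> e" if e: "e > 0" for e
    proof -
      obtain N1 where N1: "\<And>n. n \<ge> N1 \<Longrightarrow> norm (g (x n)) < e / 2"
        using gradient_converges e by (fastforce simp: lim_sequentially dest: spec[of _ "e / 2"])
      have "e / (2 * (L + 1)) > 0" using e L(1) by simp
      then obtain N2 where N2: "\<And>n. n \<ge> N2 \<Longrightarrow> norm (x (Suc n) - x n) < e / (2 * (L + 1))"
        using steps_vanish by (fastforce simp: lim_sequentially)
      let ?N = "max N1 N2"
      \<comment> \<open>Points between two iterates inherit small gradients because the steps
        vanish; closedness passes the bound on to the closure.\<close>
      have "norm (g v) \<le> e" if v: "v \<in> S ?N" for v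
      proof -
        obtain n where n: "n \<ge> N0 + ?N" "v \<in> closed_segment (x n) (x (Suc n))"
          using v by (auto simp: S_def)
        have "norm (g v - g (x n)) \<le> L * norm (v - x n)" by (rule L(2))
        also have "\<dots> \<le> (L + 1) * norm (x (Suc n) - x n)"
          using segment_bound1[OF n(2)] L(1) by (intro mult_mono) auto
        also have "\<dots> \<le> (L + 1) * (e / (2 * (L + 1)))"
          using less_imp_le[OF N2[of n]] n L(1) by (intro mult_left_mono) auto
        also have "\<dots> = e / 2" using L(1) by (simp add: field_simps add_nonneg_eq_0_iff)
        finally have "norm (g v - g (x n)) \<le> e / 2" .
        moreover have "norm (g v) \<le> norm (g (x n)) + norm (g v - g (x n))"
          by (metis norm_triangle_sub)
        moreover have "n \<ge> N1" using n(1) by simp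
        ultimately show ?thesis using N1[of n] by linarith
      qed
      then have "S ?N \<subseteq> {v. norm (g v) \<le> e}" by blast
      moreover have "closed {v. norm (g v) \<le> e}"
        using continuous_g by (intro closed_Collect_le continuous_intros) auto
      ultimately have "K ?N \<subseteq> {v. norm (g v) \<le> e}" unfolding K_def by (rule closure_minimal)
      moreover have "y \<in> K ?N" using y by (auto simp: \<Lambda>_def)
      ultimately show ?thesis by blast
    qed
    have "norm (g y) \<le> 0" by (rule field_le_epsilon) (simp add: le_e)
    then show "y \<in> {y. g y = 0}" by simp
  qed
  then obtain C where C: "C \<in> components {y. g y = 0}" "\<Lambda> \<subseteq> C"
    using exists_component_superset[of \<Lambda> "{y. g y = 0}"] \<open>\<Lambda> \<noteq> {}\<close> \<open>connected \<Lambda>\<close> by blast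
  have "(\<lambda>n. infdist (x n) C) \<longlonglongrightarrow> 0"
    unfolding lim_sequentially
  proof (intro allI impI)
    fix e :: real assume e: "e > 0"
    define V where "V = (\<Union>y\<in>\<Lambda>. ball y e)"
    \<comment> \<open>The sets \<open>K N - V\<close> are compact and decreasing with empty
      intersection, so one of them is empty.\<close>
    have "\<exists>N. K N - V = {}"
    proof (rule ccontr)
      assume "\<not> ?thesis"
      moreover have "open V" by (simp add: V_def open_UN)
      moreover have "K n - V \<subseteq> K m - V" if "m \<le> n" for m n using mono[OF that] by blast
      ultimately have "\<Inter> (range (\<lambda>N. K N - V)) \<noteq> {}"
        by (intro compact_nest compact_diff compK) auto
      then obtain y where y: "\<And>N. y \<in> K N - V" by blast
      then have "y \<in> \<Lambda>" by (auto simp: \<Lambda>_def)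
      then have "y \<in> V" unfolding V_def using e by (intro UN_I[of y]) auto
      with y show False by blast
    qed
    then obtain N where N: "K N \<subseteq> V" by blast
    have "dist (infdist (x n) C) 0 < e" if n: "n \<ge> N0 + N" for n
    proof -
      have "N \<le> n - N0" using n by linarith
      then have "x n \<in> K N" using xK[of "n - N0"] mono[of N "n - N0"] n by auto
      then obtain y where y: "y \<in> \<Lambda>" "dist y (x n) < e" using N by (auto simp: V_def)
      then have "infdist (x n) C \<le> dist (x n) y" using C by (intro infdist_le) auto
      with y show ?thesis by (simp add: dist_commute infdist_nonneg)
    qed
    then show "\<exists>N. \<forall>n\<ge>N. dist (infdist (x n) C) 0 < e" by blast
  qed
  moreover have "f constant_on C"
    by (rule constant_on_critical_component[OF in_components_connected in_components_subset, OF C(1) C(1)])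
  ultimately show ?thesis using C(1) by blast
qed

end

section \<open>Accumulated oracle noise\<close>

lemma exp_le_quadratic:
  fixes u :: real
  assumes "\<bar>u\<bar> \<le> 1"
  shows "exp u \<le> 1 + u + u\<^sup>2"
proof (cases "u \<ge> 0")
  case True
  then show ?thesis using assms by (intro exp_bound) auto
next
  case False
  define v where "v = - u"
  have v: "v > 0" using False by (simp add: v_def)
  \<comment> \<open>The claim for \<open>- v\<close> amounts to
    \<open>exp v * (1 - v + v\<^sup>2) \<ge> 1\<close>, and
    \<open>(1 + v) * (1 - v + v\<^sup>2) = 1 + v ^ 3\<close>.\<close>
  have "exp v * (1 - v + v\<^sup>2) \<ge> (1 + v) * (1 - v + v\<^sup>2)"
  proof (rule mult_right_mono)
    show "1 + v \<le> exp v" by (rule exp_ge_add_one_self)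
    have "1 - v + v\<^sup>2 = (1 - v / 2)\<^sup>2 + 3 / 4 * v\<^sup>2" by (simp add: power2_eq_square algebra_simps)
    then show "0 \<le> 1 - v + v\<^sup>2" by simp
  qed
  moreover have "(1 + v) * (1 - v + v\<^sup>2) = 1 + v ^ 3"
    by (simp add: power2_eq_square power3_eq_cube algebra_simps)
  ultimately have "exp v * (1 - v + v\<^sup>2) \<ge> 1" using v by (smt (verit) zero_less_power)
  then have "exp (- v) \<le> 1 - v + v\<^sup>2"
    by (simp add: exp_minus inverse_eq_divide pos_divide_le_eq mult.commute)
  then show ?thesis by (simp add: v_def)
qed

text \<open>Cutting by the norm of \<open>v\<close> and not by its component lets the single event
  \<open>norm v \<le> R\<close> remove the truncation in all directions at once.\<close>

definition trunc :: "real \<Rightarrow> 'a::euclidean_space \<Rightarrow> 'a \<Rightarrow> real" where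
  "trunc R b v = (if norm v \<le> R then v \<bullet> b else 0)"

lemma trunc_measurable [measurable]: "trunc R b \<in> borel_measurable borel"
  unfolding trunc_def by measurable

lemma abs_trunc_le: "norm b = 1 \<Longrightarrow> R \<ge> 0 \<Longrightarrow> \<bar>trunc R b v\<bar> \<le> R"
  using Cauchy_Schwarz_ineq2[of v b] by (auto simp: trunc_def)

lemma powr_tail_le:
  fixes a R q :: real
  assumes "R > 0" "a > R" "q \<ge> 1"
  shows "a \<le> a powr q * R powr (1 - q)"
proof -
  have "a = a powr q * a powr (1 - q)" using assms by (simp add: powr_add[symmetric])
  also have "\<dots> \<le> a powr q * R powr (1 - q)"
    using assms by (intro mult_left_mono powr_mono2') auto
  finally show ?thesis .
qed

text \<open>A pointwise bound that is linear in \<open>v \<bullet> b\<close> and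
  \<open>norm v powr q\<close>, so that integrating it uses only the zero mean and the moment of
  order \<open>q\<close>. The middle term pays for the part of \<open>v \<bullet> b\<close> that
  truncation removes.\<close>

lemma exp_trunc_le:
  fixes v b :: "'a::euclidean_space"
  assumes b: "norm b = 1" and R: "R > 0" and t: "t \<ge> 0" "t * R \<le> 1" and q: "q \<ge> 2"
  shows "exp (t * trunc R b v) \<le>
    1 + t * (v \<bullet> b) + t * R powr (1 - q) * norm v powr q + t\<^sup>2 * (1 + norm v powr q)"
proof -
  have "\<bar>t * trunc R b v\<bar> \<le> t * R"
    using abs_trunc_le[OF b, of R v] R t(1) by (simp add: abs_mult mult_left_mono)
  then have "exp (t * trunc R b v) \<le> 1 + t * trunc R b v + (t * trunc R b v)\<^sup>2"
    using t(2) by (intro exp_le_quadratic) linarith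
  also have "(t * trunc R b v)\<^sup>2 \<le> t\<^sup>2 * (1 + norm v powr q)"
  proof -
    have "(trunc R b v)\<^sup>2 \<le> (norm v)\<^sup>2"
      using Cauchy_Schwarz_ineq2[of v b] b by (auto simp: trunc_def abs_le_square_iff[symmetric])
    also have "\<dots> \<le> 1 + norm v powr q"
    proof (cases "norm v \<le> 1")
      case True
      then have "(norm v)\<^sup>2 \<le> 1" by (simp add: power_le_one)
      then show ?thesis by (simp add: add_increasing2)
    next
      case False
      then have "(norm v)\<^sup>2 = norm v powr 2" by simp
      also have "\<dots> \<le> norm v powr q" using False q by (intro powr_mono) auto
      finally show ?thesis by simp
    qed
    finally show ?thesis by (simp add: power_mult_distrib mult_left_mono)
  qed
  also have "t * trunc R b v \<le> t * (v \<bullet> b) + t * R powr (1 - q) * norm v powr q"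
  proof -
    have "trunc R b v \<le> v \<bullet> b + R powr (1 - q) * norm v powr q"
    proof (cases "norm v \<le> R")
      case True
      then show ?thesis by (simp add: trunc_def)
    next
      case False
      have "- (v \<bullet> b) \<le> norm v" using Cauchy_Schwarz_ineq2[of v b] b by simp
      also have "\<dots> \<le> R powr (1 - q) * norm v powr q"
        using powr_tail_le[of R "norm v" q] False R q by (simp add: mult.commute)
      finally show ?thesis using False by (simp add: trunc_def)
    qed
    from mult_left_mono[OF this t(1)] show ?thesis by (simp add: algebra_simps)
  qed
  finally show ?thesis by simp
qed

text \<open>
  The truncation is not recentred: its bias is at most \<open>R powr (1 - q) * m\<close> and goes into the exponent.
\<close>

lemma (in prob_space) nn_integral_exp_trunc_le:
  fixes Y :: "'a \<Rightarrow> 'b::euclidean_space"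
  assumes Y: "integrable M Y" "integral\<^sup>L M Y = 0"
    and mom: "(\<integral>\<^sup>+ s. ennreal (norm (Y s) powr q) \<partial>M) \<le> ennreal m" and m: "m \<ge> 0"
    and b: "norm b = 1" and R: "R > 0" and t: "t \<ge> 0" "t * R \<le> 1" and q: "q \<ge> 2"
  shows "(\<integral>\<^sup>+ s. ennreal (exp (t * trunc R b (Y s))) \<partial>M) \<le>
    ennreal (exp (t * R powr (1 - q) * m + t\<^sup>2 * (1 + m)))"
proof -
  have [measurable]: "Y \<in> borel_measurable M" using Y(1) by simp
  have int: "integrable M (\<lambda>s. norm (Y s) powr q)"
  proof (rule integrableI_bounded)
    have "(\<integral>\<^sup>+ s. ennreal (norm (norm (Y s) powr q)) \<partial>M) \<le> ennreal m" using mom by simp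
    then show "(\<integral>\<^sup>+ s. ennreal (norm (norm (Y s) powr q)) \<partial>M) < \<infinity>"
      using ennreal_less_top le_less_trans by (metis infinity_ennreal_def)
  qed measurable
  have le_m: "(\<integral>s. norm (Y s) powr q \<partial>M) \<le> m"
    using mom m nn_integral_eq_integral[OF int] by (simp add: ennreal_le_iff)
  define h where "h s = 1 + t * (Y s \<bullet> b) + t * R powr (1 - q) * norm (Y s) powr q +
      t\<^sup>2 * (1 + norm (Y s) powr q)" for s
  have le_h: "exp (t * trunc R b (Y s)) \<le> h s" for s
    unfolding h_def using b R t q by (rule exp_trunc_le)
  have inth: "integrable M h" unfolding h_def using int Y(1) by auto
  have "(\<integral>\<^sup>+ s. ennreal (exp (t * trunc R b (Y s))) \<partial>M) \<le> (\<integral>\<^sup>+ s. ennreal (h s) \<partial>M)"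
    using le_h by (intro nn_integral_mono ennreal_leI)
  also have "\<dots> = ennreal (\<integral>s. h s \<partial>M)"
  proof (rule nn_integral_eq_integral[OF inth])
    have "0 \<le> h s" for s using le_h[of s] exp_ge_zero[of "t * trunc R b (Y s)"] by linarith
    then show "AE s in M. 0 \<le> h s" by simp
  qed
  also have "(\<integral>s. h s \<partial>M) \<le> exp (t * R powr (1 - q) * m + t\<^sup>2 * (1 + m))"
  proof -
    have "(\<integral>s. h s \<partial>M) = 1 + t * R powr (1 - q) * (\<integral>s. norm (Y s) powr q \<partial>M) +
        t\<^sup>2 * (1 + (\<integral>s. norm (Y s) powr q \<partial>M))"
      unfolding h_def using int Y by (simp add: prob_space)
    also have "\<dots> \<le> 1 + t * R powr (1 - q) * m + t\<^sup>2 * (1 + m)"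
      using le_m t(1) by (intro add_mono mult_left_mono) auto
    also have "\<dots> \<le> exp (t * R powr (1 - q) * m + t\<^sup>2 * (1 + m))"
      using exp_ge_add_one_self[of "t * R powr (1 - q) * m + t\<^sup>2 * (1 + m)"] by linarith
    finally show ?thesis .
  qed
  finally show ?thesis by (simp add: ennreal_leI)
qed

text \<open>The joint law is a product measure, so Tonelli allows one variable to be frozen while
  the other is integrated out. This stands in for conditional expectations.\<close>

lemma (in prob_space) nn_integral_independent:
  assumes rv: "random_variable N Y" "random_variable S W" and dist: "distr M S W = D"
    and ind: "\<And>A B. A \<in> sets N \<Longrightarrow> B \<in> sets S \<Longrightarrow>
      prob ((Y -` A \<inter> space M) \<inter> (W -` B \<inter> space M)) =
      prob (Y -` A \<inter> space M) * prob (W -` B \<inter> space M)"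
    and \<phi>: "\<phi> \<in> borel_measurable (N \<Otimes>\<^sub>M S)"
  shows "(\<integral>\<^sup>+ w. \<phi> (Y w, W w) \<partial>M) = (\<integral>\<^sup>+ w. (\<integral>\<^sup>+ s. \<phi> (Y w, s) \<partial>D) \<partial>M)"
proof -
  interpret D: prob_space "distr M S W" using rv(2) by (rule prob_space_distr)
  interpret Y: prob_space "distr M N Y" using rv(1) by (rule prob_space_distr)
  have [measurable]: "Y \<in> measurable M N" "W \<in> measurable M S" "\<phi> \<in> borel_measurable (N \<Otimes>\<^sub>M S)"
    using rv \<phi> by auto
  have \<phi>': "\<phi> \<in> borel_measurable (distr M N Y \<Otimes>\<^sub>M distr M S W)"
    using \<phi> by (simp cong: measurable_cong_sets sets_pair_measure_cong)
  have "(\<integral>\<^sup>+ w. \<phi> (Y w, W w) \<partial>M) = (\<integral>\<^sup>+ v. \<phi> v \<partial>distr M (N \<Otimes>\<^sub>M S) (\<lambda>w. (Y w, W w)))"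
    by (subst nn_integral_distr) auto
  also have "\<dots> = (\<integral>\<^sup>+ v. \<phi> v \<partial>(distr M N Y \<Otimes>\<^sub>M distr M S W))"
  proof (rule arg_cong[where f = "\<lambda>D. \<integral>\<^sup>+ v. \<phi> v \<partial>D"], rule pair_measure_eqI[symmetric])
    show "sigma_finite_measure (distr M N Y)" "sigma_finite_measure (distr M S W)" by unfold_locales
    fix A B assume "A \<in> sets (distr M N Y)" "B \<in> sets (distr M S W)"
    then have [measurable]: "A \<in> sets N" "B \<in> sets S" by auto
    have "(\<lambda>w. (Y w, W w)) -` (A \<times> B) \<inter> space M = (Y -` A \<inter> space M) \<inter> (W -` B \<inter> space M)"
      by auto
    then show "emeasure (distr M N Y) A * emeasure (distr M S W) B =
        emeasure (distr M (N \<Otimes>\<^sub>M S) (\<lambda>w. (Y w, W w))) (A \<times> B)"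
      using ind[of A B] by (simp add: emeasure_distr emeasure_eq_measure ennreal_mult[symmetric])
  qed simp
  also have "\<dots> = (\<integral>\<^sup>+ y. (\<integral>\<^sup>+ s. \<phi> (y, s) \<partial>distr M S W) \<partial>distr M N Y)"
    by (rule D.nn_integral_fst[symmetric]) (rule \<phi>')
  also have "\<dots> = (\<integral>\<^sup>+ w. (\<integral>\<^sup>+ s. \<phi> (Y w, s) \<partial>distr M S W) \<partial>M)"
  proof (rule nn_integral_distr[OF rv(1)])
    show "(\<lambda>y. \<integral>\<^sup>+ s. \<phi> (y, s) \<partial>distr M S W) \<in> borel_measurable (distr M N Y)"
      using D.borel_measurable_nn_integral_fst[OF \<phi>'] .
  qed
  finally show ?thesis by (simp add: dist)
qed

section \<open>Summability of stretched exponentials\<close>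

lemma power_le_fact_exp:
  fixes u :: real
  assumes "u \<ge> 0"
  shows "u ^ k \<le> fact k * exp u"
proof -
  have "(\<Sum>i\<in>{k}. u ^ i /\<^sub>R fact i) \<le> exp u"
    unfolding exp_def using assms by (intro sum_le_suminf summable_exp_generic) auto
  then show ?thesis by (simp add: field_simps)
qed

lemma summable_n_exp_neg_powr:
  fixes a s :: real
  assumes a: "a > 0" and s: "s > 0"
  shows "summable (\<lambda>n. real n * exp (- (a * real n powr s)))"
proof -
  \<comment> \<open>The exponential is bounded by its \<open>k\<close>-th power term; exponent 3
    leaves a summable bound after multiplication by \<open>n\<close>.\<close>
  obtain k :: nat where "3 < real k * s" using reals_Archimedean3[OF s] by blast
  then have k: "3 \<le> s * real k" by (simp add: mult.commute)
  have le: "norm (real n * exp (- (a * real n powr s))) \<le> fact k / a ^ k * real n powr (- 2)"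
    if n: "n \<ge> 1" for n
  proof -
    let ?u = "a * real n powr s"
    have "exp (- ?u) * ?u ^ k \<le> fact k"
      using power_le_fact_exp[of ?u k] a by (simp add: exp_minus inverse_eq_divide pos_divide_le_eq mult.commute)
    then have "exp (- ?u) \<le> fact k / ?u ^ k" using a n by (simp add: pos_le_divide_eq)
    also have "?u ^ k = a ^ k * real n powr (s * real k)"
      using n by (simp add: power_mult_distrib powr_powr[symmetric] powr_realpow)
    also have "fact k / (a ^ k * real n powr (s * real k)) = fact k / a ^ k * real n powr (- (s * real k))"
      by (simp add: powr_minus divide_simps)
    also have "\<dots> \<le> fact k / a ^ k * real n powr (- 3)"
      using k n a by (intro mult_left_mono powr_mono) auto
    finally have "real n * exp (- ?u) \<le> real n * (fact k / a ^ k * real n powr (- 3))"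
      by (intro mult_left_mono) auto
    also have "\<dots> = fact k / a ^ k * real n powr (- 2)"
      using powr_mult_base[of "real n" "- 3"] by simp
    finally show ?thesis by simp
  qed
  show ?thesis
  proof (rule summable_comparison_test[OF exI[of _ 1]])
    show "summable (\<lambda>n. fact k / a ^ k * real n powr (- 2))"
      by (intro summable_mult) (simp add: summable_real_powr_iff)
  qed (use le in auto)
qed

text \<open>The exponent \<open>q\<close> is real here: almost surely bounded noise enters with a
  large finite exponent. The rate condition appears as \<open>p * q > 1\<close>.\<close>

locale oracle_noise = P: prob_space P + M: prob_space M
  for P :: "'w measure" and M :: "'s measure" +
  fixes g :: "'a::euclidean_space \<Rightarrow> 'a" and Z :: "'a \<Rightarrow> 's \<Rightarrow> 'a"
    and \<omega> :: "nat \<Rightarrow> 'w \<Rightarrow> 's" and X :: "nat \<Rightarrow> 'w \<Rightarrow> 'a" and \<gamma> :: "nat \<Rightarrow> real"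
    and q m p c\<^sub>1 c\<^sub>2 :: real
  assumes g_meas [measurable]: "g \<in> borel_measurable borel"
    and Z_meas: "(\<lambda>(x, s). Z x s) \<in> borel_measurable (borel \<Otimes>\<^sub>M M)"
    and Z_mean: "\<And>x. integrable M (Z x)" "\<And>x. (LINT s|M. Z x s) = 0"
    and Z_moment: "\<And>x. (\<integral>\<^sup>+ s. ennreal (norm (Z x s) powr q) \<partial>M) \<le> ennreal m"
    and m: "m \<ge> 0" and q: "q \<ge> 2"
    and init: "X 1 \<in> borel_measurable P"
    and seed: "\<And>n. n \<ge> 1 \<Longrightarrow> \<omega> n \<in> measurable P M"
      "\<And>n. n \<ge> 1 \<Longrightarrow> distr P M (\<omega> n) = M"
    and fresh: "\<And>n. n \<ge> 1 \<Longrightarrow>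
      P.indep_set (sets (vimage_algebra (space P) (\<omega> n) M)) (history P X n)"
    and iterate: "\<And>n w. n \<ge> 1 \<Longrightarrow> w \<in> space P \<Longrightarrow>
      X (Suc n) w = X n w - \<gamma> n *\<^sub>R (g (X n w) + Z (X n w) (\<omega> n w))"
    and \<gamma>: "c\<^sub>1 > 0" "c\<^sub>2 > 0" "\<And>n. n \<ge> 1 \<Longrightarrow> c\<^sub>1 / real n powr p \<le> \<gamma> n"
      "\<And>n. n \<ge> 1 \<Longrightarrow> \<gamma> n \<le> c\<^sub>2 / real n powr p"
    and p: "p > 0" "p \<le> 1" "p * q > 1"
begin

definition \<zeta> :: "nat \<Rightarrow> 'w \<Rightarrow> 'a" where "\<zeta> n w = Z (X n w) (\<omega> n w)"

lemma \<gamma>_pos: "n \<ge> 1 \<Longrightarrow> \<gamma> n > 0"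
  using \<gamma>(1) \<gamma>(3)[of n] by (smt (verit) divide_pos_pos of_nat_0_less_iff powr_gt_zero zero_less_one_class.zero_less_one less_le_trans)

lemma Z_comp_measurable:
  assumes "Y \<in> borel_measurable N" "V \<in> measurable N M"
  shows "(\<lambda>w. Z (Y w) (V w)) \<in> borel_measurable N"
  using measurable_compose[OF measurable_Pair[OF assms] Z_meas] by simp

lemma X_measurable: "n \<ge> 1 \<Longrightarrow> X n \<in> borel_measurable P"
proof (induction n rule: nat_induct_at_least)
  case base
  then show ?case using init by simp
next
  case (Suc n)
  note [measurable] = Suc.IH
  have [measurable]: "(\<lambda>w. Z (X n w) (\<omega> n w)) \<in> borel_measurable P"
    using Suc by (intro Z_comp_measurable seed) auto
  have "(\<lambda>w. X n w - \<gamma> n *\<^sub>R (g (X n w) + Z (X n w) (\<omega> n w))) \<in> borel_measurable P"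
    by measurable
  also have "?this \<longleftrightarrow> ?case"
    using iterate[OF Suc.hyps] by (intro measurable_cong) auto
  finally show ?case .
qed

lemma \<zeta>_measurable: "n \<ge> 1 \<Longrightarrow> \<zeta> n \<in> borel_measurable P"
  unfolding \<zeta>_def by (intro Z_comp_measurable seed X_measurable)

text \<open>The history as a measure space, so that measurability with respect to it can be stated
  for functions.\<close>

definition \<H> :: "nat \<Rightarrow> 'w measure" where
  "\<H> n = sigma (space P) (\<Union>i\<in>{1..n}. {X i -` B \<inter> space P | B. B \<in> sets borel})"

lemma space_\<H>: "space (\<H> n) = space P"
  unfolding \<H>_def by (rule space_measure_of) auto

lemma sets_\<H>: "sets (\<H> n) = history P X n"
  unfolding \<H>_def history_def by (rule sets_measure_of) auto

lemma X_\<H>: "1 \<le> i \<Longrightarrow> i \<le> n \<Longrightarrow> X i \<in> borel_measurable (\<H> n)"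
proof (rule measurableI)
  fix B :: "'a set" assume i: "1 \<le> i" "i \<le> n" and B: "B \<in> sets borel"
  have "X i -` B \<inter> space P \<in> (\<Union>i\<in>{1..n}. {X i -` B \<inter> space P | B. B \<in> sets borel})"
    using i B by (intro UN_I[of i]) auto
  then show "X i -` B \<inter> space (\<H> n) \<in> sets (\<H> n)"
    unfolding space_\<H> sets_\<H> history_def by (rule sigma_sets.Basic)
qed simp

text \<open>The step equation recovers the noise from two consecutive iterates.\<close>

lemma \<zeta>_\<H>: "1 \<le> i \<Longrightarrow> i < n \<Longrightarrow> \<zeta> i \<in> borel_measurable (\<H> n)"
proof -
  assume i: "1 \<le> i" "i < n"
  have [measurable]: "X i \<in> borel_measurable (\<H> n)" "X (Suc i) \<in> borel_measurable (\<H> n)"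
    using i by (auto intro: X_\<H>)
  have "(\<lambda>w. (1 / \<gamma> i) *\<^sub>R (X i w - X (Suc i) w) - g (X i w)) \<in> borel_measurable (\<H> n)"
    by measurable
  also have "?this \<longleftrightarrow> ?thesis"
    using i \<gamma>_pos[of i] iterate[of i] by (intro measurable_cong) (simp add: space_\<H> \<zeta>_def)
  finally show ?thesis .
qed

text \<open>Integral form of conditioning on the history: \<open>Y\<close> carries everything taken
  from the past, and the seed of step \<open>n\<close> is averaged out.\<close>

lemma nn_integral_fresh:
  assumes n: "n \<ge> 1" and Y: "Y \<in> measurable (\<H> n) N"
    and \<phi>: "\<phi> \<in> borel_measurable (N \<Otimes>\<^sub>M M)"
  shows "(\<integral>\<^sup>+ w. \<phi> (Y w, \<omega> n w) \<partial>P) = (\<integral>\<^sup>+ w. (\<integral>\<^sup>+ s. \<phi> (Y w, s) \<partial>M) \<partial>P)"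
proof (rule P.nn_integral_independent[where N = N and S = M and Y = Y and W = "\<omega> n" and \<phi> = \<phi>])
  show "\<phi> \<in> borel_measurable (N \<Otimes>\<^sub>M M)" by (rule \<phi>)
  show "\<omega> n \<in> measurable P M" "distr P M (\<omega> n) = M" using seed n by auto
  have H_sub: "sets (\<H> n) \<subseteq> sets P"
    using P.indep_setD_ev2[OF fresh[OF n]] by (simp add: sets_\<H>)
  show Ym: "Y \<in> measurable P N"
    using Y H_sub by (intro measurable_from_subalg[of P "\<H> n"]) (auto simp: subalgebra_def space_\<H>)
  fix A B assume A: "A \<in> sets N" and B: "B \<in> sets M"
  have "Y -` A \<inter> space P \<in> history P X n"
    using measurable_sets[OF Y A] by (simp add: space_\<H> sets_\<H>)
  moreover have "\<omega> n -` B \<inter> space P \<in> sets (vimage_algebra (space P) (\<omega> n) M)"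
    using B by (rule in_vimage_algebra)
  ultimately show "P.prob ((Y -` A \<inter> space P) \<inter> (\<omega> n -` B \<inter> space P)) =
      P.prob (Y -` A \<inter> space P) * P.prob (\<omega> n -` B \<inter> space P)"
    using P.indep_setD[OF fresh[OF n]] by (metis Int_commute mult.commute)
qed

lemma trunc_noise_measurable:
  assumes "n \<ge> 1"
  shows "(\<lambda>w. \<Sum>i\<in>{n..<k}. \<gamma> i * trunc (R i) b (\<zeta> i w)) \<in> borel_measurable P"
proof (intro borel_measurable_sum borel_measurable_times borel_measurable_const)
  fix i assume "i \<in> {n..<k}"
  then have "\<zeta> i \<in> borel_measurable P" using assms by (intro \<zeta>_measurable) auto
  then show "(\<lambda>w. trunc (R i) b (\<zeta> i w)) \<in> borel_measurable P"
    by (rule measurable_compose[OF _ trunc_measurable])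
qed

text \<open>The last factor is integrated out with the past frozen. Its bound is deterministic,
  because the moment bound on the oracle is uniform in the query point, so the bounds multiply along
  the window.\<close>

lemma nn_integral_exp_noise:
  assumes n: "n \<ge> 1" and b: "norm b = 1" and t: "t \<ge> 0"
    and R: "\<And>i. i \<ge> n \<Longrightarrow> R i > 0" "\<And>i. i \<ge> n \<Longrightarrow> t * \<gamma> i * R i \<le> 1"
    and k: "n \<le> k"
  shows "(\<integral>\<^sup>+ w. ennreal (exp (t * (\<Sum>i\<in>{n..<k}. \<gamma> i * trunc (R i) b (\<zeta> i w)))) \<partial>P) \<le>
    ennreal (exp (\<Sum>i\<in>{n..<k}. t * \<gamma> i * R i powr (1 - q) * m + (t * \<gamma> i)\<^sup>2 * (1 + m)))"
  using k
proof (induction k rule: dec_induct)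
  case base
  then show ?case by (simp add: P.emeasure_space_1)
next
  case (step k)
  have k1: "k \<ge> 1" using step n by simp
  define W where "W w = (\<Sum>i\<in>{n..<k}. \<gamma> i * trunc (R i) b (\<zeta> i w))" for w
  define B where "B i = t * \<gamma> i * R i powr (1 - q) * m + (t * \<gamma> i)\<^sup>2 * (1 + m)" for i
  have W: "W \<in> borel_measurable (\<H> k)"
    unfolding W_def
  proof (intro borel_measurable_sum borel_measurable_times borel_measurable_const)
    fix i assume "i \<in> {n..<k}"
    then have "\<zeta> i \<in> borel_measurable (\<H> k)" using n by (intro \<zeta>_\<H>) auto
    then show "(\<lambda>w. trunc (R i) b (\<zeta> i w)) \<in> borel_measurable (\<H> k)"
      by (rule measurable_compose[OF _ trunc_measurable])
  qed
  \<comment> \<open>The past enters through the earlier sum and the current query point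
    only.\<close>
  have Y: "(\<lambda>w. (W w, X k w)) \<in> measurable (\<H> k) (borel \<Otimes>\<^sub>M borel)"
    using W X_\<H>[of k k] k1 by (intro measurable_Pair) auto
  define \<phi> :: "(real \<times> 'a) \<times> 's \<Rightarrow> ennreal" where
    "\<phi> = (\<lambda>v. ennreal (exp (t * fst (fst v))) *
       ennreal (exp (t * \<gamma> k * trunc (R k) b (Z (snd (fst v)) (snd v)))))"
  have Zm: "(\<lambda>v. Z (snd (fst v)) (snd v)) \<in> borel_measurable ((borel \<Otimes>\<^sub>M borel) \<Otimes>\<^sub>M M)"
    by (rule Z_comp_measurable) measurable
  have \<phi>: "\<phi> \<in> borel_measurable ((borel \<Otimes>\<^sub>M borel) \<Otimes>\<^sub>M M)"
    unfolding \<phi>_def using measurable_compose[OF Zm trunc_measurable[of "R k" b]] by measurable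
  have "(\<integral>\<^sup>+ w. ennreal (exp (t * (\<Sum>i\<in>{n..<Suc k}. \<gamma> i * trunc (R i) b (\<zeta> i w)))) \<partial>P) =
      (\<integral>\<^sup>+ w. \<phi> ((W w, X k w), \<omega> k w) \<partial>P)"
  proof (rule nn_integral_cong)
    fix w
    have "t * (\<Sum>i\<in>{n..<Suc k}. \<gamma> i * trunc (R i) b (\<zeta> i w)) =
        t * W w + t * \<gamma> k * trunc (R k) b (\<zeta> k w)"
      using step by (simp add: W_def distrib_left mult.assoc)
    then show "ennreal (exp (t * (\<Sum>i\<in>{n..<Suc k}. \<gamma> i * trunc (R i) b (\<zeta> i w)))) =
        \<phi> ((W w, X k w), \<omega> k w)"
      by (simp add: \<phi>_def exp_add ennreal_mult \<zeta>_def)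
  qed
  also have "\<dots> = (\<integral>\<^sup>+ w. (\<integral>\<^sup>+ s. \<phi> ((W w, X k w), s) \<partial>M) \<partial>P)"
    by (rule nn_integral_fresh[OF k1 Y \<phi>])
  also have "\<dots> \<le> (\<integral>\<^sup>+ w. ennreal (exp (B k)) * ennreal (exp (t * W w)) \<partial>P)"
  proof (rule nn_integral_mono)
    fix w
    have [measurable]: "Z (X k w) \<in> borel_measurable M" using Z_mean(1)[of "X k w"] by simp
    have "(\<integral>\<^sup>+ s. \<phi> ((W w, X k w), s) \<partial>M) = ennreal (exp (t * W w)) *
        (\<integral>\<^sup>+ s. ennreal (exp (t * \<gamma> k * trunc (R k) b (Z (X k w) s))) \<partial>M)"
      unfolding \<phi>_def fst_conv snd_conv
      by (intro nn_integral_cmult) measurable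
    also have "\<dots> \<le> ennreal (exp (t * W w)) * ennreal (exp (B k))"
      unfolding B_def using k1 step t R[of k] \<gamma>_pos[of k]
      by (intro mult_left_mono M.nn_integral_exp_trunc_le Z_mean Z_moment m b q)
        (auto simp: mult_ac)
    finally show "(\<integral>\<^sup>+ s. \<phi> ((W w, X k w), s) \<partial>M) \<le> ennreal (exp (B k)) * ennreal (exp (t * W w))"
      by (simp add: mult.commute)
  qed
  also have "\<dots> = ennreal (exp (B k)) * (\<integral>\<^sup>+ w. ennreal (exp (t * W w)) \<partial>P)"
  proof (rule nn_integral_cmult)
    have "W \<in> borel_measurable P"
      unfolding W_def using n by (rule trunc_noise_measurable)
    then show "(\<lambda>w. ennreal (exp (t * W w))) \<in> borel_measurable P" by measurable
  qed
  also have "\<dots> \<le> ennreal (exp (B k)) * ennreal (exp (\<Sum>i\<in>{n..<k}. B i))"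
    using step.IH unfolding W_def B_def by (intro mult_left_mono) auto
  also have "\<dots> = ennreal (exp (\<Sum>i\<in>{n..<Suc k}. B i))"
    using step by (simp add: exp_add ennreal_mult[symmetric] mult.commute)
  finally show ?case by (simp add: B_def)
qed

text \<open>For \<open>p \<le> 1\<close> each step between \<open>n\<close> and \<open>2 * n\<close>
  is at least \<open>c\<^sub>1 / (2 * real n)\<close>, so these \<open>n\<close> steps take time at
  least \<open>c\<^sub>1 / 2\<close>.\<close>

lemma window_short:
  assumes n: "n \<ge> 1" and k: "(\<Sum>i\<in>{n..<k}. \<gamma> i) \<le> c\<^sub>1 / 4"
  shows "k < 2 * n"
proof (rule ccontr)
  assume *: "\<not> k < 2 * n"
  have "real n * (c\<^sub>1 / (2 * real n)) \<le> (\<Sum>i\<in>{n..<2 * n}. \<gamma> i)"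
  proof -
    have "c\<^sub>1 / (2 * real n) \<le> \<gamma> i" if i: "i \<in> {n..<2 * n}" for i
    proof -
      have "real i powr p \<le> real i powr 1" using i n p by (intro powr_mono) auto
      also have "\<dots> \<le> 2 * real n" using i by simp
      finally have "c\<^sub>1 / (2 * real n) \<le> c\<^sub>1 / real i powr p"
        using \<gamma>(1) i n by (intro divide_left_mono) auto
      also have "\<dots> \<le> \<gamma> i" using i n by (intro \<gamma>(3)) auto
      finally show ?thesis .
    qed
    then have "(\<Sum>i\<in>{n..<2 * n}. c\<^sub>1 / (2 * real n)) \<le> (\<Sum>i\<in>{n..<2 * n}. \<gamma> i)" by (rule sum_mono)
    then show ?thesis by simp
  qed
  also have "\<dots> \<le> (\<Sum>i\<in>{n..<k}. \<gamma> i)"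
  proof (rule sum_mono2)
    show "{n..<2 * n} \<subseteq> {n..<k}" using * by auto
    show "\<gamma> i \<ge> 0" if "i \<in> {n..<k} - {n..<2 * n}" for i using that n \<gamma>_pos[of i] by auto
  qed simp
  also note k
  finally show False using \<gamma>(1) n by simp
qed

text \<open>
  The noise at time \<open>i\<close> is truncated at level \<open>i powr \<kappa>\<close>, where \<open>\<kappa> q > 1\<close> makes the truncation events
  summable, and the exponential moments are taken at parameter proportional to \<open>n powr \<theta>\<close>.
\<close>

definition \<kappa> :: real where "\<kappa> = (1 / q + p) / 2"

text \<open>The midpoint of \<open>1 / q\<close> and \<open>p\<close>: being above
  \<open>1 / q\<close> makes excesses summable, being below \<open>p\<close> leaves room for a
  growing exponential parameter.\<close>

lemma \<kappa>: "0 < \<kappa>" "\<kappa> < p" "\<kappa> * q > 1"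
proof -
  have pq: "1 / q < p" using p q by (simp add: pos_divide_less_eq)
  have "0 < 1 / q + p" using p(1) q by (intro add_pos_pos) auto
  then show "0 < \<kappa>" by (simp add: \<kappa>_def)
  show "\<kappa> < p" using pq by (simp add: \<kappa>_def)
  have "\<kappa> * q = (1 + p * q) / 2" using q by (simp add: \<kappa>_def field_simps)
  with p show "\<kappa> * q > 1" by simp
qed

text \<open>With parameter \<open>t\<close> of order \<open>n powr \<theta>\<close> and levels
  \<open>R i = i powr \<kappa>\<close>, the three bounds keep, in this order,
  \<open>t * \<gamma> i * R i\<close>, the truncation bias \<open>t * R i powr (1 - q)\<close> and
  the variance factor \<open>t\<^sup>2 * \<gamma> i\<close> at most 1.\<close>

definition \<theta> :: real where "\<theta> = min (p - \<kappa>) (min (\<kappa> * (q - 1)) (p / 2))"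

lemma \<theta>: "\<theta> > 0" "\<theta> \<le> p - \<kappa>" "\<theta> \<le> \<kappa> * (q - 1)" "2 * \<theta> \<le> p"
proof -
  have "\<theta> \<le> p / 2" unfolding \<theta>_def by (intro min.coboundedI2) simp
  then show "2 * \<theta> \<le> p" by simp
qed (use \<kappa> q p in \<open>auto simp: \<theta>_def\<close>)

definition window_noise :: "'a \<Rightarrow> nat \<Rightarrow> nat \<Rightarrow> 'w \<Rightarrow> real" where
  "window_noise b n k w = (\<Sum>i\<in>{n..<k}. \<gamma> i * trunc (real i powr \<kappa>) b (\<zeta> i w))"

lemma window_noise_tail:
  assumes n: "n \<ge> 1" "n \<le> k" and b: "norm b = 1" and k: "(\<Sum>i\<in>{n..<k}. \<gamma> i) \<le> c\<^sub>1 / 4"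
  shows "P.prob {w\<in>space P. window_noise b n k w \<ge> e} \<le>
    exp (c\<^sub>1 / 4 * (1 + 2 * m)) * exp (- (e / (c\<^sub>2 + 1) * real n powr \<theta>))"
proof -
  \<comment> \<open>Chernoff parameter; dividing by \<open>c\<^sub>2 + 1\<close> absorbs the
    constant of the step sizes.\<close>
  define t where "t = real n powr \<theta> / (c\<^sub>2 + 1)"
  have t: "t > 0" using n \<gamma>(2) by (simp add: t_def)
  have i_facts: "t * \<gamma> i * real i powr \<kappa> \<le> 1" "t * (real i powr \<kappa>) powr (1 - q) \<le> 1" "t * t * \<gamma> i \<le> 1"
    if i: "i \<ge> n" for i
  proof -
    have i1: "i \<ge> 1" using i n by simp
    have \<gamma>i: "\<gamma> i \<le> c\<^sub>2 * real i powr (- p)" using \<gamma>(4)[OF i1] by (simp add: powr_minus_divide)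
    have \<gamma>0: "\<gamma> i \<ge> 0" using \<gamma>_pos[OF i1] by simp
    \<comment> \<open>Since \<open>i \<ge> n\<close>, a negative power of \<open>i\<close> can pay
      for a power of \<open>n\<close>.\<close>
    have shrink: "real n powr u * real i powr v \<le> 1" if "v \<le> 0" "u + v \<le> 0" for u v
    proof -
      have "real n powr u * real i powr v \<le> real n powr u * real n powr v"
        using that(1) i n by (intro mult_left_mono powr_mono2') auto
      also have "\<dots> = real n powr (u + v)" by (simp add: powr_add)
      also have "\<dots> \<le> real n powr 0" using that(2) n by (intro powr_mono) auto
      finally show ?thesis using n by simp
    qed
    have c: "c\<^sub>2 / (c\<^sub>2 + 1) \<le> 1" "1 / (c\<^sub>2 + 1) \<le> 1" using \<gamma>(2) by auto
    have "t * \<gamma> i * real i powr \<kappa> \<le> t * (c\<^sub>2 * real i powr (- p)) * real i powr \<kappa>"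
      using \<gamma>i t by (intro mult_right_mono mult_left_mono) auto
    also have "\<dots> = c\<^sub>2 / (c\<^sub>2 + 1) * (real n powr \<theta> * real i powr (\<kappa> - p))"
      by (simp add: t_def powr_diff powr_minus_divide)
    also have "\<dots> \<le> 1 * 1" using shrink[of "\<kappa> - p" \<theta>] \<kappa> \<theta> c \<gamma>(2) by (intro mult_mono) auto
    finally show "t * \<gamma> i * real i powr \<kappa> \<le> 1" by simp
    have "t * (real i powr \<kappa>) powr (1 - q) = 1 / (c\<^sub>2 + 1) * (real n powr \<theta> * real i powr (\<kappa> * (1 - q)))"
      by (simp add: t_def powr_powr)
    also have "\<dots> \<le> 1 * 1"
    proof (intro mult_mono)
      have "\<kappa> * (1 - q) \<le> 0" using \<kappa> q by (simp add: mult_nonneg_nonpos)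
      moreover have "\<theta> + \<kappa> * (1 - q) \<le> 0" using \<theta>(3) by (simp add: algebra_simps)
      ultimately show "real n powr \<theta> * real i powr (\<kappa> * (1 - q)) \<le> 1" by (rule shrink)
    qed (use c in auto)
    finally show "t * (real i powr \<kappa>) powr (1 - q) \<le> 1" by simp
    have "t * t * \<gamma> i \<le> t * t * (c\<^sub>2 * real i powr (- p))"
      using \<gamma>i t by (intro mult_left_mono) auto
    also have "\<dots> = c\<^sub>2 / (c\<^sub>2 + 1) * (1 / (c\<^sub>2 + 1)) * (real n powr (2 * \<theta>) * real i powr (- p))"
      using powr_add[of "real n" \<theta> \<theta>] by (simp add: t_def)
    also have "\<dots> \<le> 1 * 1 * 1"
      using shrink[of "- p" "2 * \<theta>"] p \<theta> c \<gamma>(2) by (intro mult_mono) auto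
    finally show "t * t * \<gamma> i \<le> 1" by simp
  qed
  have expo: "(\<Sum>i\<in>{n..<k}. t * \<gamma> i * (real i powr \<kappa>) powr (1 - q) * m + (t * \<gamma> i)\<^sup>2 * (1 + m))
      \<le> c\<^sub>1 / 4 * (1 + 2 * m)"
  proof -
    have "(\<Sum>i\<in>{n..<k}. t * \<gamma> i * (real i powr \<kappa>) powr (1 - q) * m + (t * \<gamma> i)\<^sup>2 * (1 + m))
        \<le> (\<Sum>i\<in>{n..<k}. \<gamma> i * (1 + 2 * m))"
    proof (rule sum_mono)
      fix i assume "i \<in> {n..<k}"
      then have i: "i \<ge> n" "\<gamma> i > 0" using n \<gamma>_pos by auto
      have "t * \<gamma> i * (real i powr \<kappa>) powr (1 - q) * m = (t * (real i powr \<kappa>) powr (1 - q)) * (\<gamma> i * m)"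
        by (simp add: mult_ac)
      also have "\<dots> \<le> 1 * (\<gamma> i * m)" using i_facts(2)[OF i(1)] i m by (intro mult_right_mono) auto
      finally have 1: "t * \<gamma> i * (real i powr \<kappa>) powr (1 - q) * m \<le> \<gamma> i * m" by simp
      have "(t * \<gamma> i)\<^sup>2 * (1 + m) = (t * t * \<gamma> i) * (\<gamma> i * (1 + m))"
        by (simp add: power2_eq_square mult_ac)
      also have "\<dots> \<le> 1 * (\<gamma> i * (1 + m))" using i_facts(3)[OF i(1)] i m by (intro mult_right_mono) auto
      finally have "(t * \<gamma> i)\<^sup>2 * (1 + m) \<le> \<gamma> i * (1 + m)" by simp
      with 1 show "t * \<gamma> i * (real i powr \<kappa>) powr (1 - q) * m + (t * \<gamma> i)\<^sup>2 * (1 + m) \<le> \<gamma> i * (1 + 2 * m)"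
        by (simp add: algebra_simps)
    qed
    also have "\<dots> = (\<Sum>i\<in>{n..<k}. \<gamma> i) * (1 + 2 * m)" by (simp add: sum_distrib_right)
    also have "\<dots> \<le> c\<^sub>1 / 4 * (1 + 2 * m)" using k m by (intro mult_right_mono) auto
    finally show ?thesis .
  qed
  have meas: "window_noise b n k \<in> borel_measurable P"
    unfolding window_noise_def using n(1) by (rule trunc_noise_measurable)
  have "ennreal (P.prob {w\<in>space P. window_noise b n k w \<ge> e}) \<le>
      ennreal (exp (- t * e)) * (\<integral>\<^sup>+ w. ennreal (exp (t * window_noise b n k w)) * indicator (space P) w \<partial>P)"
    unfolding P.emeasure_eq_measure[symmetric]
    using meas by (intro Chernoff_ineq_nn_integral_ge[OF t]) auto
  also have "(\<integral>\<^sup>+ w. ennreal (exp (t * window_noise b n k w)) * indicator (space P) w \<partial>P) =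
      (\<integral>\<^sup>+ w. ennreal (exp (t * window_noise b n k w)) \<partial>P)"
    by (intro nn_integral_cong) simp
  also have "\<dots> \<le> ennreal (exp (\<Sum>i\<in>{n..<k}. t * \<gamma> i * (real i powr \<kappa>) powr (1 - q) * m + (t * \<gamma> i)\<^sup>2 * (1 + m)))"
    unfolding window_noise_def
    by (rule nn_integral_exp_noise) (use n b t i_facts(1) in auto)
  also have "\<dots> \<le> ennreal (exp (c\<^sub>1 / 4 * (1 + 2 * m)))" using expo by (intro ennreal_leI) simp
  finally have "ennreal (P.prob {w\<in>space P. window_noise b n k w \<ge> e}) \<le>
      ennreal (exp (- t * e)) * ennreal (exp (c\<^sub>1 / 4 * (1 + 2 * m)))"
    by (simp add: mult_left_mono)
  also have "\<dots> = ennreal (exp (c\<^sub>1 / 4 * (1 + 2 * m)) * exp (- (e / (c\<^sub>2 + 1) * real n powr \<theta>)))"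
    by (simp add: ennreal_mult[symmetric] t_def mult.commute)
  finally show ?thesis by (simp add: ennreal_le_iff)
qed

text \<open>At most \<open>n\<close> windows start at step \<open>n\<close>, so the union bound only
  multiplies a stretched exponential tail by \<open>n\<close>, and Borel--Cantelli applies.\<close>

lemma AE_window_noise_small:
  assumes b: "norm b = 1" and e: "e > 0"
  shows "AE w in P. \<forall>\<^sub>F n in sequentially. \<forall>k\<ge>n.
    (\<Sum>i\<in>{n..<k}. \<gamma> i) \<le> c\<^sub>1 / 4 \<longrightarrow> window_noise b n k w < e"
proof -
  define J where "J n = {k\<in>{n..<2 * n}. (\<Sum>i\<in>{n..<k}. \<gamma> i) \<le> c\<^sub>1 / 4}" for n
  define A where "A n = (\<Union>k\<in>J n. {w\<in>space P. window_noise b n k w \<ge> e})" for n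
  have finJ: "finite (J n)" for n by (simp add: J_def)
  have ev: "{w\<in>space P. window_noise b n k w \<ge> e} \<in> P.events" if "k \<in> J n" for n k
  proof -
    have "n \<ge> 1" using that by (auto simp: J_def)
    then have [measurable]: "window_noise b n k \<in> borel_measurable P"
      unfolding window_noise_def by (rule trunc_noise_measurable)
    show ?thesis by measurable
  qed
  have A: "A n \<in> P.events" for n unfolding A_def using finJ ev by (intro sets.finite_UN) auto
  define C where "C = exp (c\<^sub>1 / 4 * (1 + 2 * m))"
  define a where "a = e / (c\<^sub>2 + 1)"
  have "P.prob (A n) \<le> C * (real n * exp (- (a * real n powr \<theta>)))" for n
  proof -
    have "P.prob (A n) \<le> (\<Sum>k\<in>J n. P.prob {w\<in>space P. window_noise b n k w \<ge> e})"
      unfolding A_def using finJ ev by (intro P.finite_measure_subadditive_finite) auto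
    also have "\<dots> \<le> (\<Sum>k\<in>J n. C * exp (- (a * real n powr \<theta>)))"
      unfolding C_def a_def by (intro sum_mono window_noise_tail b) (auto simp: J_def)
    also have "\<dots> = real (card (J n)) * (C * exp (- (a * real n powr \<theta>)))" by simp
    also have "\<dots> \<le> real n * (C * exp (- (a * real n powr \<theta>)))"
    proof (rule mult_right_mono)
      have "card (J n) \<le> card {n..<2 * n}" by (rule card_mono) (auto simp: J_def)
      then show "real (card (J n)) \<le> real n" by simp
    qed (simp add: C_def)
    finally show ?thesis by (simp add: mult_ac)
  qed
  then have bound: "norm (P.prob (A n)) \<le> C * (real n * exp (- (a * real n powr \<theta>)))" for n by simp
  have "summable (\<lambda>n. C * (real n * exp (- (a * real n powr \<theta>))))"
    using e \<gamma>(2) \<theta> by (intro summable_mult summable_n_exp_neg_powr) (auto simp: a_def)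
  then have "summable (\<lambda>n. P.prob (A n))"
    by (rule summable_comparison_test'[where N = 0]) (rule bound)
  then have "AE w in P. \<forall>\<^sub>F n in sequentially. w \<in> space P - A n"
    using A by (intro borel_cantelli_AE1) (auto simp: P.emeasure_eq_measure)
  then show ?thesis
  proof (rule AE_mp, intro AE_I2 impI)
    fix w assume w: "w \<in> space P" "\<forall>\<^sub>F n in sequentially. w \<in> space P - A n"
    from w(2) eventually_ge_at_top[of 1]
    show "\<forall>\<^sub>F n in sequentially. \<forall>k\<ge>n. (\<Sum>i\<in>{n..<k}. \<gamma> i) \<le> c\<^sub>1 / 4 \<longrightarrow> window_noise b n k w < e"
    proof eventually_elim
      case (elim n)
      show ?case
      proof (intro allI impI)
        fix k assume k: "n \<le> k" "(\<Sum>i\<in>{n..<k}. \<gamma> i) \<le> c\<^sub>1 / 4"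
        then have "k \<in> J n" using window_short[OF elim(2)] by (simp add: J_def)
        then show "window_noise b n k w < e" using elim(1) w(1) by (auto simp: A_def not_le)
      qed
    qed
  qed
qed

text \<open>Markov's inequality at order \<open>q\<close> gives tails of order
  \<open>n powr (- (\<kappa> * q))\<close>, summable because
  \<open>\<kappa> * q > 1\<close>.\<close>

lemma AE_noise_truncated: "AE w in P. \<forall>\<^sub>F n in sequentially. norm (\<zeta> n w) \<le> real n powr \<kappa>"
proof -
  \<comment> \<open>The conjunct \<open>n \<ge> 1\<close> empties the event at index 0, where the
    seed and the iterate are unconstrained.\<close>
  define A where "A n = {w\<in>space P. n \<ge> 1 \<and> norm (\<zeta> n w) > real n powr \<kappa>}" for n
  have A: "A n \<in> P.events" for n
  proof (cases "n \<ge> 1")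
    case True
    then have [measurable]: "\<zeta> n \<in> borel_measurable P" by (rule \<zeta>_measurable)
    show ?thesis unfolding A_def by measurable
  qed (simp add: A_def)
  have bound: "P.prob (A n) \<le> m * real n powr (- (\<kappa> * q))" for n
  proof (cases "n \<ge> 1")
    case n: True
    define \<phi> :: "'a \<times> 's \<Rightarrow> ennreal" where
      "\<phi> = (\<lambda>v. ennreal (real n powr (- (\<kappa> * q))) * ennreal (norm (Z (fst v) (snd v)) powr q))"
    have "(\<lambda>v. Z (fst v) (snd v)) \<in> borel_measurable (borel \<Otimes>\<^sub>M M)"
      by (rule Z_comp_measurable) measurable
    then have \<phi>: "\<phi> \<in> borel_measurable (borel \<Otimes>\<^sub>M M)" unfolding \<phi>_def by measurable
    have "ennreal (P.prob (A n)) = (\<integral>\<^sup>+ w. indicator (A n) w \<partial>P)"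
      using A by (simp add: P.emeasure_eq_measure)
    also have "\<dots> \<le> (\<integral>\<^sup>+ w. \<phi> (X n w, \<omega> n w) \<partial>P)"
    proof (rule nn_integral_mono)
      fix w
      show "indicator (A n) w \<le> \<phi> (X n w, \<omega> n w)"
      proof (cases "w \<in> A n")
        case True
        then have "real n powr \<kappa> < norm (\<zeta> n w)" by (simp add: A_def)
        then have "(real n powr \<kappa>) powr q \<le> norm (\<zeta> n w) powr q" using q by (intro powr_mono2) auto
        then have "real n powr (- (\<kappa> * q)) * (real n powr \<kappa>) powr q \<le>
            real n powr (- (\<kappa> * q)) * norm (\<zeta> n w) powr q" by (intro mult_left_mono) auto
        moreover have "real n powr (- (\<kappa> * q)) * (real n powr \<kappa>) powr q = 1"
          using n by (simp add: powr_powr powr_minus)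
        ultimately have "1 \<le> ennreal (real n powr (- (\<kappa> * q)) * norm (\<zeta> n w) powr q)" by simp
        also have "\<dots> = \<phi> (X n w, \<omega> n w)" by (simp add: \<phi>_def \<zeta>_def ennreal_mult)
        finally show ?thesis using True by simp
      qed simp
    qed
    also have "\<dots> = (\<integral>\<^sup>+ w. (\<integral>\<^sup>+ s. \<phi> (X n w, s) \<partial>M) \<partial>P)"
      using n X_\<H>[OF n order_refl] \<phi> by (rule nn_integral_fresh)
    also have "\<dots> \<le> (\<integral>\<^sup>+ w. ennreal (real n powr (- (\<kappa> * q))) * ennreal m \<partial>P)"
    proof (rule nn_integral_mono)
      fix w
      have [measurable]: "Z (X n w) \<in> borel_measurable M" using Z_mean(1)[of "X n w"] by simp
      have "(\<integral>\<^sup>+ s. \<phi> (X n w, s) \<partial>M) =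
          ennreal (real n powr (- (\<kappa> * q))) * (\<integral>\<^sup>+ s. ennreal (norm (Z (X n w) s) powr q) \<partial>M)"
        unfolding \<phi>_def fst_conv snd_conv by (intro nn_integral_cmult) measurable
      then show "(\<integral>\<^sup>+ s. \<phi> (X n w, s) \<partial>M) \<le> ennreal (real n powr (- (\<kappa> * q))) * ennreal m"
        using Z_moment[of "X n w"] by (simp add: mult_left_mono)
    qed
    also have "\<dots> = ennreal (m * real n powr (- (\<kappa> * q)))"
      using m by (simp add: P.emeasure_space_1 ennreal_mult[symmetric] mult.commute)
    finally show ?thesis using m by (simp add: ennreal_le_iff)
  next
    case False
    then show ?thesis using m by (simp add: A_def)
  qed
  have "summable (\<lambda>n. m * real n powr (- (\<kappa> * q)))"
    using \<kappa> by (intro summable_mult) (simp add: summable_real_powr_iff)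
  then have "summable (\<lambda>n. P.prob (A n))"
    by (rule summable_comparison_test'[where N = 0]) (use bound in simp)
  then have "AE w in P. \<forall>\<^sub>F n in sequentially. w \<in> space P - A n"
    using A by (intro borel_cantelli_AE1) (auto simp: P.emeasure_eq_measure)
  then show ?thesis
  proof (rule AE_mp, intro AE_I2 impI)
    fix w assume w: "w \<in> space P" "\<forall>\<^sub>F n in sequentially. w \<in> space P - A n"
    from w(2) eventually_ge_at_top[of 1]
    show "\<forall>\<^sub>F n in sequentially. norm (\<zeta> n w) \<le> real n powr \<kappa>"
      by eventually_elim (use w(1) in \<open>auto simp: A_def not_less\<close>)
  qed
qed

text \<open>One-sided bounds in the directions \<open>b\<close> and \<open>- b\<close> for all basis
  vectors control the norm, and the countably many levels \<open>inverse (real (Suc j))\<close> give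
  one null set for all \<open>e\<close>.\<close>

theorem AE_accumulated_noise_vanishes:
  "AE w in P. \<forall>e>0. \<exists>N\<ge>1. \<forall>n\<ge>N. \<forall>k\<ge>n. (\<Sum>i\<in>{n..<k}. \<gamma> i) \<le> c\<^sub>1 / 4 \<longrightarrow>
     norm (\<Sum>i\<in>{n..<k}. \<gamma> i *\<^sub>R \<zeta> i w) \<le> e"
proof -
  let ?D = "Basis \<union> uminus ` Basis :: 'a set"
  have "AE w in P. \<forall>b\<in>?D. \<forall>j::nat. \<forall>\<^sub>F n in sequentially. \<forall>k\<ge>n.
      (\<Sum>i\<in>{n..<k}. \<gamma> i) \<le> c\<^sub>1 / 4 \<longrightarrow> window_noise b n k w < inverse (real (Suc j))"
  proof (subst AE_ball_countable)
    show "countable ?D" by (simp add: countable_finite)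
    show "\<forall>b\<in>?D. AE w in P. \<forall>j::nat. \<forall>\<^sub>F n in sequentially. \<forall>k\<ge>n.
        (\<Sum>i\<in>{n..<k}. \<gamma> i) \<le> c\<^sub>1 / 4 \<longrightarrow> window_noise b n k w < inverse (real (Suc j))"
      unfolding AE_all_countable by (intro ballI allI AE_window_noise_small) auto
  qed
  with AE_noise_truncated show ?thesis
  proof eventually_elim
    case (elim w)
    show ?case
    proof (intro allI impI)
      fix e :: real assume e: "e > 0"
      obtain j where j: "inverse (real (Suc j)) < e / real DIM('a)"
        using reals_Archimedean[of "e / real DIM('a)"] e by auto
      have "\<forall>\<^sub>F n in sequentially. \<forall>b\<in>?D. \<forall>k\<ge>n.
          (\<Sum>i\<in>{n..<k}. \<gamma> i) \<le> c\<^sub>1 / 4 \<longrightarrow> window_noise b n k w < inverse (real (Suc j))"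
        using elim(2) by (intro eventually_ball_finite) auto
      then obtain N1 where N1: "\<And>n b k. n \<ge> N1 \<Longrightarrow> b \<in> ?D \<Longrightarrow> k \<ge> n \<Longrightarrow> (\<Sum>i\<in>{n..<k}. \<gamma> i) \<le> c\<^sub>1 / 4 \<Longrightarrow>
          window_noise b n k w < inverse (real (Suc j))"
        unfolding eventually_sequentially by blast
      obtain N2 where N2: "\<And>n. n \<ge> N2 \<Longrightarrow> norm (\<zeta> n w) \<le> real n powr \<kappa>"
        using elim(1) unfolding eventually_sequentially by blast
      let ?N = "max 1 (max N1 N2)"
      have "norm (\<Sum>i\<in>{n..<k}. \<gamma> i *\<^sub>R \<zeta> i w) \<le> e"
        if n: "n \<ge> ?N" and k: "k \<ge> n" "(\<Sum>i\<in>{n..<k}. \<gamma> i) \<le> c\<^sub>1 / 4" for n k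
      proof -
        let ?S = "\<Sum>i\<in>{n..<k}. \<gamma> i *\<^sub>R \<zeta> i w"
        have eq: "?S \<bullet> b = window_noise b n k w" for b
          unfolding window_noise_def inner_sum_left
        proof (rule sum.cong)
          fix i assume "i \<in> {n..<k}"
          then have "norm (\<zeta> i w) \<le> real i powr \<kappa>" using n by (intro N2) auto
          then show "(\<gamma> i *\<^sub>R \<zeta> i w) \<bullet> b = \<gamma> i * trunc (real i powr \<kappa>) b (\<zeta> i w)"
            by (simp add: trunc_def)
        qed simp
        have comp: "\<bar>?S \<bullet> b\<bar> \<le> e / real DIM('a)" if b: "b \<in> Basis" for b
        proof -
          have "?S \<bullet> b < inverse (real (Suc j))" "?S \<bullet> (- b) < inverse (real (Suc j))"
            unfolding eq by (rule N1; use n k b in simp)+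
          then show ?thesis using j by (simp add: abs_le_iff)
        qed
        have "norm ?S \<le> (\<Sum>b\<in>Basis. \<bar>?S \<bullet> b\<bar>)" by (rule norm_le_l1)
        also have "\<dots> \<le> (\<Sum>b\<in>(Basis :: 'a set). e / real DIM('a))" using comp by (rule sum_mono)
        finally show ?thesis by simp
      qed
      then show "\<exists>N\<ge>1. \<forall>n\<ge>N. \<forall>k\<ge>n. (\<Sum>i\<in>{n..<k}. \<gamma> i) \<le> c\<^sub>1 / 4 \<longrightarrow>
          norm (\<Sum>i\<in>{n..<k}. \<gamma> i *\<^sub>R \<zeta> i w) \<le> e"
        by (intro exI[of _ ?N]) auto
    qed
  qed
qed

end

section \<open>Stochastic gradient descent\<close>

text \<open>
  If \<open>f\<close> were bounded above, maximising \<open>f y - \<epsilon>/2 * norm (y - a)\<close> would yield a point of the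
  bounded set \<open>norm (g y) \<le> \<epsilon>\<close> for every \<open>a\<close>, which forces \<open>f a\<close> far below \<open>sup f\<close> for distant \<open>a\<close>.
\<close>

lemma unbounded_above_if_steep_at_infinity:
  fixes f :: "'a::euclidean_space \<Rightarrow> real"
  assumes grad: "\<And>y. GDERIV f y :> g y"
    and L: "L \<ge> 0" "\<And>y y'. norm (g y' - g y) \<le> L * norm (y' - y)"
    and sublevel: "\<And>c. ereal c < (SUP x. ereal (f x)) \<Longrightarrow> bounded {x. f x \<le> c}"
    and \<epsilon>: "\<epsilon> > 0" "bounded {y. norm (g y) \<le> \<epsilon>}"
  shows "\<exists>y. f y > c"
proof (rule ccontr)
  assume "\<not> ?thesis"
  then have bdd: "bdd_above (range f)" by (auto simp: bdd_above_def not_less)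
  define s where "s = Sup (range f)"
  have s: "f y \<le> s" for y unfolding s_def using bdd by (intro cSup_upper) auto
  obtain r where r: "\<And>y. norm (g y) \<le> \<epsilon> \<Longrightarrow> norm y \<le> r" using \<epsilon>(2) unfolding bounded_iff by blast
  have contf: "continuous_on UNIV f"
    using grad by (rule GDERIV_continuous_on)
  have key: "f a \<le> s - \<epsilon> / 2 * (norm a - r)" for a
  proof -
    define h where "h y = f y - \<epsilon> / 2 * norm (y - a)" for y
    \<comment> \<open>Outside this ball the penalty exceeds \<open>s - f a\<close>, so
      \<open>h\<close> is below \<open>h a\<close> there and a maximum over the ball is
      global.\<close>
    define R where "R = 2 * (s - f a) / \<epsilon>"
    have R: "R \<ge> 0" "\<epsilon> / 2 * R = s - f a" using s[of a] \<epsilon> by (auto simp: R_def)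
    have "continuous_on (cball a R) h" unfolding h_def
      using continuous_on_subset[OF contf] by (intro continuous_intros) auto
    then obtain x where x: "x \<in> cball a R" "\<And>y. y \<in> cball a R \<Longrightarrow> h y \<le> h x"
      using continuous_attains_sup[of "cball a R" h] R(1) by auto
    have ha: "f a \<le> h x" using x(2)[of a] R(1) by (simp add: h_def)
    have max: "h y \<le> h x" for y
    proof (cases "y \<in> cball a R")
      case False
      then have "R \<le> norm (y - a)" by (simp add: dist_norm norm_minus_commute)
      then have "\<epsilon> / 2 * R \<le> \<epsilon> / 2 * norm (y - a)" using \<epsilon> by (intro mult_left_mono) auto
      then show ?thesis using ha s[of y] R(2) unfolding h_def by linarith
    qed (rule x(2))
    have "norm (g x) \<le> \<epsilon>"
    proof (rule ccontr)
      assume big: "\<not> norm (g x) \<le> \<epsilon>"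
      \<comment> \<open>A gradient step of this length gains at least
        \<open>t / 2 * (norm (g x))\<^sup>2\<close>, while the penalty grows by at most
        \<open>\<epsilon> / 2 * t * norm (g x)\<close>; so it would beat the maximum.\<close>
      define t where "t = 1 / (2 * (L + 1))"
      have t: "t > 0" "L * t \<le> 1 / 2" using L(1) by (auto simp: t_def field_simps)
      have "\<bar>f (x + t *\<^sub>R g x) - f x - (t *\<^sub>R g x) \<bullet> g x\<bar> \<le> L * (norm (t *\<^sub>R g x))\<^sup>2"
        using GDERIV_Lipschitz_bound[OF grad L, of "x + t *\<^sub>R g x" x] by simp
      then have "f (x + t *\<^sub>R g x) \<ge> f x + t * (norm (g x))\<^sup>2 - L * (t * norm (g x))\<^sup>2"
        using t(1) by (simp add: power2_norm_eq_inner)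
      moreover have "h (x + t *\<^sub>R g x) \<ge> f (x + t *\<^sub>R g x) - \<epsilon> / 2 * (norm (x - a) + t * norm (g x))"
      proof -
        have "norm (x + t *\<^sub>R g x - a) \<le> norm (x - a) + t * norm (g x)"
          using norm_triangle_ineq[of "x - a" "t *\<^sub>R g x"] t(1) by (simp add: algebra_simps)
        then have "\<epsilon> / 2 * norm (x + t *\<^sub>R g x - a) \<le> \<epsilon> / 2 * (norm (x - a) + t * norm (g x))"
          using \<epsilon> by (intro mult_left_mono) auto
        then show ?thesis by (simp add: h_def)
      qed
      moreover note max[of "x + t *\<^sub>R g x"]
      ultimately have "t * (norm (g x))\<^sup>2 \<le> L * (t * norm (g x))\<^sup>2 + \<epsilon> / 2 * (t * norm (g x))"
        by (simp add: h_def algebra_simps)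
      also have "L * (t * norm (g x))\<^sup>2 = (L * t) * (t * (norm (g x))\<^sup>2)" by (simp add: power2_eq_square)
      also have "\<dots> \<le> 1 / 2 * (t * (norm (g x))\<^sup>2)" using t by (intro mult_right_mono) auto
      finally have "(t * norm (g x)) * norm (g x) \<le> (t * norm (g x)) * \<epsilon>"
        by (simp add: power2_eq_square algebra_simps)
      moreover have "norm (g x) > 0" using big \<epsilon>(1) by linarith
      then have "t * norm (g x) > 0" using t(1) by simp
      ultimately show False using big by (simp only: mult_le_cancel_left_pos)
    qed
    then have "norm x \<le> r" by (rule r)
    then have "norm a - r \<le> norm (x - a)" using norm_triangle_ineq2[of a x] by (simp add: norm_minus_commute)
    then have "\<epsilon> / 2 * (norm a - r) \<le> \<epsilon> / 2 * norm (x - a)" using \<epsilon> by (intro mult_left_mono) auto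
    then show ?thesis using ha s[of x] by (simp add: h_def)
  qed
  obtain y where "f y > s - 1"
    using less_cSupE[of "s - 1" "range f"] unfolding s_def by auto
  then have "ereal (s - 1) < (SUP x. ereal (f x))" by (intro less_SUP_iff[THEN iffD2] bexI[of _ y]) auto
  from sublevel[OF this] obtain B where B: "\<And>y. f y \<le> s - 1 \<Longrightarrow> norm y \<le> B"
    unfolding bounded_iff by blast
  obtain b :: 'a where b: "b \<in> Basis" using nonempty_Basis by blast
  \<comment> \<open>Far enough that \<open>key\<close> gives \<open>f a \<le> s - 1\<close>, and
    outside the ball of radius \<open>B\<close> that contains this sublevel set.\<close>
  define a where "a = (\<bar>B\<bar> + \<bar>r\<bar> + 2 / \<epsilon> + 1) *\<^sub>R b"
  have na: "norm a = \<bar>B\<bar> + \<bar>r\<bar> + 2 / \<epsilon> + 1" using b \<epsilon>(1) by (simp add: a_def)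
  have "\<epsilon> / 2 * (2 / \<epsilon>) \<le> \<epsilon> / 2 * (norm a - r)" using \<epsilon>(1) na by (intro mult_left_mono) auto
  then have "f a \<le> s - 1" using key[of a] \<epsilon>(1) by simp
  then have "norm a \<le> B" by (rule B)
  moreover have "2 / \<epsilon> > 0" using \<epsilon>(1) by simp
  ultimately show False using na by linarith
qed

text \<open>For finite \<open>q \<ge> 2\<close> one has \<open>1 / q \<le> 2 / (q + 2)\<close>, so
  \<open>q\<close> itself can be kept. For infinite \<open>q\<close> the choice
  \<open>max 2 (2 / p)\<close> makes \<open>p * q' \<ge> 2\<close>.\<close>

lemma moment_le_finite_exponent:
  fixes Z :: "'a \<Rightarrow> 's \<Rightarrow> 'b::real_normed_vector"
  assumes "prob_space M" and q: "2 \<le> q" and \<sigma>: "\<sigma> \<ge> 0"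
    and mom: "\<And>x. moment_le M q \<sigma> (Z x)" and p: "2 / (q + 2) < ereal p"
  obtains q' where "q' \<ge> 2" "p > 0" "p * q' > 1"
    "\<And>x. (\<integral>\<^sup>+ s. ennreal (norm (Z x s) powr q') \<partial>M) \<le> ennreal (\<sigma> powr q')"
proof (cases q)
  case (real q0)
  have q0: "q0 \<ge> 2" using q by (simp add: real)
  have "2 / (q + 2) = ereal (2 / (q0 + 2))" using q0 by (simp add: real numeral_eq_ereal)
  then have p0: "2 / (q0 + 2) < p" using p by simp
  moreover have "0 < 2 / (q0 + 2)" using q0 by simp
  ultimately have "p > 0" by linarith
  have "1 / q0 \<le> 2 / (q0 + 2)" using q0 by (simp add: field_simps)
  then have "1 / q0 < p" using p0 by simp
  then have "p * q0 > 1" using q0 by (simp add: pos_divide_less_eq)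
  then show ?thesis using q0 \<open>p > 0\<close> mom by (intro that[of q0]) (auto simp: moment_le_def real)
next
  case PInf
  interpret prob_space M by fact
  have p0: "p > 0" using p by (simp add: PInf)
  define q' where "q' = max 2 (2 / p)"
  have "p * (2 / p) \<le> p * q'" using p0 by (intro mult_left_mono) (auto simp: q'_def)
  then have "p * q' > 1" using p0 by simp
  moreover have "(\<integral>\<^sup>+ s. ennreal (norm (Z x s) powr q') \<partial>M) \<le> ennreal (\<sigma> powr q')" for x
  proof -
    have "AE s in M. norm (Z x s) \<le> \<sigma>" using mom[of x] by (simp add: moment_le_def PInf)
    then have "(\<integral>\<^sup>+ s. ennreal (norm (Z x s) powr q') \<partial>M) \<le> (\<integral>\<^sup>+ s. ennreal (\<sigma> powr q') \<partial>M)"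
      by (intro nn_integral_mono_AE) (auto elim!: eventually_mono intro!: ennreal_leI powr_mono2 simp: q'_def)
    then show ?thesis by (simp add: emeasure_space_1)
  qed
  ultimately show ?thesis using p0 by (intro that[of q']) (auto simp: q'_def)
next
  case MInf
  then show ?thesis using q by simp
qed

theorem theorem2:
  fixes f :: "'a::euclidean_space \<Rightarrow> real"
    and G L \<epsilon>\<^sub>0 \<sigma> p :: real
    and q :: ereal
    and M :: "'s measure"
    and Z :: "'a \<Rightarrow> 's \<Rightarrow> 'a"
    and P :: "'w measure"
    and \<omega> :: "nat \<Rightarrow> 'w \<Rightarrow> 's"
    and X :: "nat \<Rightarrow> 'w \<Rightarrow> 'a"
    and \<gamma> :: "nat \<Rightarrow> real"
  assumes smooth: "C_times DIM('a) f"
    and G: "G \<ge> 0" "\<And>x. norm (grad f x) \<le> G"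
    and L: "L \<ge> 0" "\<And>x x'. norm (grad f x' - grad f x) \<le> L * norm (x' - x)"
    and sublevel: "\<And>c. ereal c < (SUP x. ereal (f x)) \<Longrightarrow> bounded {x. f x \<le> c}"
    and grad_sublevel: "\<epsilon>\<^sub>0 > 0" "bounded {x. norm (grad f x) \<le> \<epsilon>\<^sub>0}"
    and seed_space: "prob_space M" "complete_measure M"
    and Z_meas: "(\<lambda>(x, s). Z x s) \<in> borel_measurable (borel \<Otimes>\<^sub>M M)"
    and q: "2 \<le> q"
    and \<sigma>: "\<sigma> \<ge> 0"
    and Z_mean: "\<And>x. integrable M (Z x)" "\<And>x. (LINT s|M. Z x s) = 0"
    and Z_moment: "\<And>x. moment_le M q \<sigma> (Z x)"
    and P: "prob_space P"
    and init: "X 1 \<in> borel_measurable P"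
    and seed: "\<And>n. n \<ge> 1 \<Longrightarrow> \<omega> n \<in> measurable P M"
      "\<And>n. n \<ge> 1 \<Longrightarrow> distr P M (\<omega> n) = M"
    and fresh: "\<And>n. n \<ge> 1 \<Longrightarrow>
      prob_space.indep_set P (sets (vimage_algebra (space P) (\<omega> n) M)) (history P X n)"
    and step: "\<And>n w. n \<ge> 1 \<Longrightarrow> w \<in> space P \<Longrightarrow>
      X (Suc n) w = X n w - \<gamma> n *\<^sub>R (grad f (X n w) + Z (X n w) (\<omega> n w))"
    and \<gamma>_pos: "\<And>n. n \<ge> 1 \<Longrightarrow> \<gamma> n > 0"
    and p: "2 / (q + 2) < ereal p" "p \<le> 1"
    and \<gamma>_rate: "\<exists>c\<^sub>1>0. \<exists>c\<^sub>2>0. \<forall>n\<ge>1.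
      c\<^sub>1 / real n powr p \<le> \<gamma> n \<and> \<gamma> n \<le> c\<^sub>2 / real n powr p"
  shows "AE w in P. \<exists>C \<in> components (crit_set f).
      (\<lambda>n. infdist (X n w) C) \<longlonglongrightarrow> 0 \<and> f constant_on C"
proof -
  obtain k where k: "DIM('a) = Suc k" using DIM_positive[where 'a='a] by (cases "DIM('a)") auto
  have gd: "GDERIV f x :> grad f x" for x
  proof -
    have "f differentiable (at x)" using smooth unfolding k by simp
    from GDERIV_grad[OF this] show ?thesis using grad_eqI by metis
  qed
  have sard: "negligible (f ` {x. grad f x = 0})"
    using Morse_Sard[OF C_times_imp_Ck[OF smooth] gd] .
  \<comment> \<open>The assumption covers only levels below the supremum of \<open>f\<close>, which
    turns out to be infinite.\<close>
  have sublevel': "bounded {x. f x \<le> c}" for c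
  proof -
    obtain y where "f y > c"
      using unbounded_above_if_steep_at_infinity[OF gd L sublevel grad_sublevel] by blast
    then have "ereal c < (SUP x. ereal (f x))" by (intro less_SUP_iff[THEN iffD2] bexI[of _ y]) auto
    then show ?thesis by (rule sublevel)
  qed
  obtain q' where q': "q' \<ge> 2" "p > 0" "p * q' > 1"
      "\<And>x. (\<integral>\<^sup>+ s. ennreal (norm (Z x s) powr q') \<partial>M) \<le> ennreal (\<sigma> powr q')"
    using moment_le_finite_exponent[of M q \<sigma> Z p] seed_space(1) q \<sigma> Z_moment p(1) by blast
  obtain c\<^sub>1 c\<^sub>2 where c: "c\<^sub>1 > 0" "c\<^sub>2 > 0" "\<And>n. n \<ge> 1 \<Longrightarrow> c\<^sub>1 / real n powr p \<le> \<gamma> n"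
      "\<And>n. n \<ge> 1 \<Longrightarrow> \<gamma> n \<le> c\<^sub>2 / real n powr p" using \<gamma>_rate by blast
  have g_meas: "grad f \<in> borel_measurable borel"
    using Lipschitz_continuous_on_UNIV[OF L] by (rule borel_measurable_continuous_onI)
  interpret P: prob_space P by (rule P)
  interpret M: prob_space M by (rule seed_space)
  interpret noise: oracle_noise P M "grad f" Z \<omega> X \<gamma> q' "\<sigma> powr q'" p c\<^sub>1 c\<^sub>2
    by unfold_locales (use g_meas Z_meas Z_mean q' init seed fresh step c p in auto)
  have \<gamma>_lim: "\<gamma> \<longlonglongrightarrow> 0"
  proof (rule real_tendsto_sandwich[where f = "\<lambda>_. 0" and h = "\<lambda>n. c\<^sub>2 * real n powr (- p)"])
    show "\<forall>\<^sub>F n in sequentially. 0 \<le> \<gamma> n"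
      using eventually_ge_at_top[of 1] by eventually_elim (use \<gamma>_pos less_imp_le in blast)
    show "\<forall>\<^sub>F n in sequentially. \<gamma> n \<le> c\<^sub>2 * real n powr (- p)"
      using eventually_ge_at_top[of 1] by eventually_elim (use c(4) in \<open>simp add: powr_minus_divide\<close>)
    have "(\<lambda>n. real n powr (- p)) \<longlonglongrightarrow> 0"
      using q'(2) by (intro tendsto_neg_powr filterlim_real_sequentially) auto
    then show "(\<lambda>n. c\<^sub>2 * real n powr (- p)) \<longlonglongrightarrow> 0" by (rule tendsto_mult_right_zero)
  qed simp
  have \<gamma>_sum: "\<not> summable \<gamma>"
  proof
    assume "summable \<gamma>"
    then have "summable (\<lambda>n. c\<^sub>1 * real n powr (- p))"
    proof (rule summable_comparison_test'[where N = 1])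
      fix n :: nat assume "n \<ge> 1"
      then show "norm (c\<^sub>1 * real n powr (- p)) \<le> \<gamma> n"
        using c(1) c(3)[of n] by (simp add: powr_minus_divide)
    qed
    then have "summable (\<lambda>n. real n powr (- p))" using c(1) by (simp add: summable_cmult_iff)
    then show False using p(2) by (simp add: summable_real_powr_iff)
  qed
  show ?thesis
    using noise.AE_accumulated_noise_vanishes
  proof (rule AE_mp, intro AE_I2 impI)
    fix w
    assume w: "w \<in> space P" and small: "\<forall>e>0. \<exists>N\<ge>1. \<forall>n\<ge>N. \<forall>k\<ge>n.
      (\<Sum>i\<in>{n..<k}. \<gamma> i) \<le> c\<^sub>1 / 4 \<longrightarrow> norm (\<Sum>i\<in>{n..<k}. \<gamma> i *\<^sub>R noise.\<zeta> i w) \<le> e"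
    \<comment> \<open>The window length \<open>T\<close> of the path is the
      \<open>c\<^sub>1 / 4\<close> for which the noise bound was obtained.\<close>
    interpret noisy_gradient_path f "grad f" "\<lambda>n. X n w" "\<lambda>n. noise.\<zeta> n w" \<gamma> G L "c\<^sub>1 / 4" \<epsilon>\<^sub>0
    proof unfold_locales
      show "X (Suc n) w = X n w - \<gamma> n *\<^sub>R (grad f (X n w) + noise.\<zeta> n w)" if "n \<ge> 1" for n
        using step[OF that w] by (simp add: noise.\<zeta>_def)
    qed (use gd G L \<gamma>_pos \<gamma>_lim \<gamma>_sum c(1) small sublevel' grad_sublevel sard in auto)
    show "\<exists>C\<in>components (crit_set f). (\<lambda>n. infdist (X n w) C) \<longlonglongrightarrow> 0 \<and> f constant_on C"
      unfolding crit_set_def by (rule converges_to_critical_component)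
  qed
qed

end
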